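(* For every $n\in\{2,3,4,\dots\}$, $VN(F_n)$ is completely isomorphic to $VN(F_\infty)$; that is, there is a linear bijection $u:VN(F_n)\to VN(F_\infty)$ such that $u$ and $u^{-1}$ are completely bounded.
   Context: For a discrete group $G$, let $\ell_2(G)$ have orthonormal basis $\{\delta_x\}$, $\lambda(x)\delta_y=\delta_{xy}$ the left regular representation, and $VN(G)$ the strong operator closure of $\mathrm{span}\{\lambda(x):x\in G\}$ in $B(\ell_2(G))$. $F_n$ is the free group on $n$ generators, $F_\infty$ on countably infinitely many generators. A linear map $u$ between operator spaces is completely bounded if $\sup_k\|u_k\|<\infty$, where $u_k$ acts entrywise on $k\times k$ matrices normed via $M_k(B(H))=B(H^k)$. *)

theory Defs
  imports "HOL-Algebra.Group" "HOL-Analysis.Analysis"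
begin

type_synonym fg_letter = "nat \<times> bool"   (* (generator index, is_inverse) *)

definition fg_inv_letter :: "fg_letter \<Rightarrow> fg_letter" where
  "fg_inv_letter a = (fst a, \<not> snd a)"

fun fg_reduced :: "fg_letter list \<Rightarrow> bool" where
  "fg_reduced (a # b # w) = (b \<noteq> fg_inv_letter a \<and> fg_reduced (b # w))"
| "fg_reduced _ = True"

definition fg_push :: "fg_letter \<Rightarrow> fg_letter list \<Rightarrow> fg_letter list" where
  "fg_push a v = (case v of [] \<Rightarrow> [a] | b # v' \<Rightarrow> if b = fg_inv_letter a then v' else a # v)"

text \<open>Free group on the generators indexed by I: reduced words, product = concatenation
  followed by free cancellation.\<close>
definition free_grp :: "nat set \<Rightarrow> fg_letter list monoid" where
  "free_grp I = \<lparr>carrier = {w. fg_reduced w \<and> fst ` set w \<subseteq> I},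
                 monoid.mult = (\<lambda>w v. foldr fg_push w v), monoid.one = []\<rparr>"

definition l2 :: "('a, 'b) monoid_scheme \<Rightarrow> ('a \<Rightarrow> complex) set" where
  "l2 G = {f. (\<forall>x. x \<notin> carrier G \<longrightarrow> f x = 0) \<and> (\<lambda>x. (cmod (f x))^2) summable_on carrier G}"

definition l2norm :: "('a, 'b) monoid_scheme \<Rightarrow> ('a \<Rightarrow> complex) \<Rightarrow> real" where
  "l2norm G f = sqrt (infsum (\<lambda>x. (cmod (f x))^2) (carrier G))"

type_synonym 'a op = "('a \<Rightarrow> complex) \<Rightarrow> ('a \<Rightarrow> complex)"

definition bounded_ops :: "('a, 'b) monoid_scheme \<Rightarrow> 'a op set" where
  "bounded_ops G = {T.
      (\<forall>f\<in>l2 G. T f \<in> l2 G) \<and> (\<forall>f. f \<notin> l2 G \<longrightarrow> T f = (\<lambda>_. 0)) \<and>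
      (\<forall>f\<in>l2 G. \<forall>g\<in>l2 G. \<forall>a b :: complex.
          T (\<lambda>x. a * f x + b * g x) = (\<lambda>x. a * T f x + b * T g x)) \<and>
      (\<exists>C. \<forall>f\<in>l2 G. l2norm G (T f) \<le> C * l2norm G f)}"

text \<open>Left regular representation: (lambda(x) f)(y) = f(x^-1 y), i.e. lambda(x) delta_y = delta_{xy}.\<close>
definition lreg :: "('a, 'b) monoid_scheme \<Rightarrow> 'a \<Rightarrow> 'a op" where
  "lreg G x = (\<lambda>f. if f \<in> l2 G
      then (\<lambda>y. if y \<in> carrier G then f (inv\<^bsub>G\<^esub> x \<otimes>\<^bsub>G\<^esub> y) else 0)
      else (\<lambda>_. 0))"

definition lspan :: "('a, 'b) monoid_scheme \<Rightarrow> 'a op set" where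
  "lspan G = {T. \<exists>F c. finite F \<and> F \<subseteq> carrier G \<and>
                 T = (\<lambda>f y. \<Sum>x\<in>F. c x * lreg G x f y)}"

text \<open>VN(G): closure of span of lambda(G) in B(l2 G) for the strong operator topology
  (basic SOT neighbourhoods of T are given by finitely many vectors and an epsilon).\<close>
definition VN :: "('a, 'b) monoid_scheme \<Rightarrow> 'a op set" where
  "VN G = {T \<in> bounded_ops G. \<forall>F \<epsilon>. finite F \<and> F \<subseteq> l2 G \<and> \<epsilon> > 0 \<longrightarrow>
             (\<exists>S\<in>lspan G. \<forall>\<xi>\<in>F. l2norm G (\<lambda>y. T \<xi> y - S \<xi> y) < \<epsilon>)}"

text \<open>Norm of a k x k matrix of operators via M_k(B(H)) = B(H^k).\<close>
definition matnorm :: "('a, 'b) monoid_scheme \<Rightarrow> nat \<Rightarrow> (nat \<Rightarrow> nat \<Rightarrow> 'a op) \<Rightarrow> real" where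
  "matnorm G k X = Sup {sqrt (\<Sum>i<k. (l2norm G (\<lambda>y. \<Sum>j<k. X i j (\<xi> j) y))^2) | \<xi>.
       (\<forall>j<k. \<xi> j \<in> l2 G) \<and> (\<Sum>j<k. (l2norm G (\<xi> j))^2) \<le> 1}"

definition completely_bounded ::
  "('a, 'b) monoid_scheme \<Rightarrow> ('c, 'd) monoid_scheme \<Rightarrow> ('a op \<Rightarrow> 'c op) \<Rightarrow> bool" where
  "completely_bounded G H u \<longleftrightarrow> (\<exists>C. \<forall>k\<ge>1. \<forall>X. (\<forall>i<k. \<forall>j<k. X i j \<in> VN G) \<longrightarrow>
       matnorm H k (\<lambda>i j. u (X i j)) \<le> C * matnorm G k X)"

definition linear_on_VN :: "('a, 'b) monoid_scheme \<Rightarrow> ('a op \<Rightarrow> 'c op) \<Rightarrow> bool" where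
  "linear_on_VN G u \<longleftrightarrow> (\<forall>S\<in>VN G. \<forall>T\<in>VN G. \<forall>a b :: complex.
       u (\<lambda>f y. a * S f y + b * T f y) = (\<lambda>f y. a * u S f y + b * u T f y))"

definition completely_isomorphic ::
  "('a, 'b) monoid_scheme \<Rightarrow> ('c, 'd) monoid_scheme \<Rightarrow> bool" where
  "completely_isomorphic G H \<longleftrightarrow> (\<exists>u. bij_betw u (VN G) (VN H) \<and> linear_on_VN G u \<and>
       completely_bounded G H u \<and> completely_bounded H G (inv_into (VN G) u))"

end

(*
  An operator T in VN(G) is convolution by its symbol x = T delta_1, and conversely every bounded
  convolver lies in VN(G) (commutation theorem). Hence a complete isomorphism can be produced from
  a bijection of the index sets that respects, up to constants, the norms of the matrix kernels
  (s, t) |-> X (s t^-1).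

  Cutting a kernel down to the pairs with alpha s = beta t makes it block diagonal and does not
  increase its norm. So the indicator of a set A is a completely bounded multiplier whenever
  1_A (s t^-1) is a finite sum of indicators [alpha s = beta t]. This applies to cosets of
  subgroups and, crucially, to the infinite union of the cosets g H, where H is generated by some
  of the free generators of F_infinity and g runs through the remaining ones. Shifting these
  cosets shows VN(F_infinity) = VN(F_infinity) + VN(H), both for H = F_n and for H = F_infinity.
  As F_infinity embeds into F_n, VN(F_n) = VN(F_infinity) + W for some W, and Pelczynski's
  decomposition method gives
  VN(F_n) = VN(F_infinity) + W = VN(F_infinity) + VN(F_infinity) + W
          = VN(F_infinity) + VN(F_n) = VN(F_infinity).
*)
theory Submission
  imports Defs "HOL-Algebra.Coset"
begin

section \<open>Bounded kernels and reindexing of symbols\<close>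

text \<open>Spaces of symbols supported on subsets of a group stand for the operator spaces, and a
  direct sum is a disjoint union of two subsets. The decomposition argument thus becomes bookkeeping
  with bijections; operators return only when the final bijection is transported to VN. In place of
  the infinite direct sums customary in the decomposition method there is absorption: F_infinity
  makes room for one further copy of VN(H).

  The difficulty is to move infinitely many cosets at once. Each single coset is cut out by a
  contraction, but adding such cuts over infinitely many cosets gives no control of the constant. In
  a free group the product g v t, with g a generator, has only two shapes, according to whether g
  cancels, so two cuts handle the whole union, with constant 2. The shift then comes for free: it is
  the restriction of an injective endomorphism that fixes H and maps the remaining generators
  injectively into themselves, missing exactly one.\<close>

text \<open>An operator norm bound in disguise: \<open>K\<close> has norm at most \<open>C\<close>
  between the two l2 spaces, tested on finite sections, so that the combinatorial half of the proof
  never meets convergence. The form is bilinear; conjugating \<open>\<eta>\<close> gives the same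
  supremum.\<close>

definition kernel_bounded :: "('s \<Rightarrow> 't \<Rightarrow> complex) \<Rightarrow> real \<Rightarrow> bool" where
  "kernel_bounded K C \<longleftrightarrow> 0 \<le> C \<and> (\<forall>F F' \<xi> \<eta>. finite F \<longrightarrow> finite F' \<longrightarrow>
     cmod (\<Sum>s\<in>F. \<Sum>t\<in>F'. K s t * \<xi> t * \<eta> s)
       \<le> C * L2_set (\<lambda>t. cmod (\<xi> t)) F' * L2_set (\<lambda>s. cmod (\<eta> s)) F)"

lemma kbdI:
  assumes "0 \<le> C"
    and "\<And>F F' \<xi> \<eta>. finite F \<Longrightarrow> finite F' \<Longrightarrow>
      cmod (\<Sum>s\<in>F. \<Sum>t\<in>F'. K s t * \<xi> t * \<eta> s)
       \<le> C * L2_set (\<lambda>t. cmod (\<xi> t)) F' * L2_set (\<lambda>s. cmod (\<eta> s)) F"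
  shows "kernel_bounded K C"
  using assms unfolding kernel_bounded_def by blast

lemma kbdD:
  assumes "kernel_bounded K C" "finite F" "finite F'"
  shows "cmod (\<Sum>s\<in>F. \<Sum>t\<in>F'. K s t * \<xi> t * \<eta> s)
       \<le> C * L2_set (\<lambda>t. cmod (\<xi> t)) F' * L2_set (\<lambda>s. cmod (\<eta> s)) F"
  using assms unfolding kernel_bounded_def by blast

lemma kernel_bounded_nonneg: "kernel_bounded K C \<Longrightarrow> 0 \<le> C"
  unfolding kernel_bounded_def by blast

lemma kernel_bounded_add:
  fixes K L :: "'s \<Rightarrow> 't \<Rightarrow> complex"
  assumes "kernel_bounded K C" "kernel_bounded L D"
  shows "kernel_bounded (\<lambda>s t. K s t + L s t) (C + D)"
proof (rule kbdI)
  show "0 \<le> C + D" using kernel_bounded_nonneg[OF assms(1)] kernel_bounded_nonneg[OF assms(2)] by simp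
  fix F :: "'s set" and F' :: "'t set" and \<xi> \<eta> assume F: "finite F" "finite F'"
  let ?a = "L2_set (\<lambda>t. cmod (\<xi> t)) F'" and ?b = "L2_set (\<lambda>s. cmod (\<eta> s)) F"
  have "cmod (\<Sum>s\<in>F. \<Sum>t\<in>F'. (K s t + L s t) * \<xi> t * \<eta> s)
     = cmod ((\<Sum>s\<in>F. \<Sum>t\<in>F'. K s t * \<xi> t * \<eta> s) + (\<Sum>s\<in>F. \<Sum>t\<in>F'. L s t * \<xi> t * \<eta> s))"
    by (simp add: sum.distrib algebra_simps)
  also have "\<dots> \<le> C * ?a * ?b + D * ?a * ?b"
    using kbdD[OF assms(1) F] kbdD[OF assms(2) F] by (intro norm_triangle_mono) auto
  finally show "cmod (\<Sum>s\<in>F. \<Sum>t\<in>F'. (K s t + L s t) * \<xi> t * \<eta> s) \<le> (C + D) * ?a * ?b"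
    by (simp add: algebra_simps)
qed

lemma kernel_bounded_uminus: "kernel_bounded K C \<Longrightarrow> kernel_bounded (\<lambda>s t. - K s t) C"
  unfolding kernel_bounded_def by (simp add: sum_negf)

lemma kernel_bounded_diff: "kernel_bounded K C \<Longrightarrow> kernel_bounded L D \<Longrightarrow> kernel_bounded (\<lambda>s t. K s t - L s t) (C + D)"
  using kernel_bounded_add[OF _ kernel_bounded_uminus] by fastforce

text \<open>\<open>L\<close> is \<open>K\<close> between two partial isometries that move basis
  vectors along \<open>p\<close> and \<open>q\<close>. Rows and columns may move differently, as a
  left translation by a group element acts on the rows alone.\<close>

lemma kernel_bounded_reindex:
  fixes K :: "'s \<Rightarrow> 't \<Rightarrow> complex" and L :: "'c \<Rightarrow> 'd \<Rightarrow> complex"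
  assumes K: "kernel_bounded K C" and p: "inj_on p S" and q: "inj_on q T"
    and L: "\<And>s t. s \<in> S \<Longrightarrow> t \<in> T \<Longrightarrow> L s t = K (p s) (q t)"
    and L0: "\<And>s t. s \<notin> S \<or> t \<notin> T \<Longrightarrow> L s t = 0"
  shows "kernel_bounded L C"
proof (rule kbdI[OF kernel_bounded_nonneg[OF K]])
  fix F :: "'c set" and F' :: "'d set" and \<xi> \<eta> assume F: "finite F" "finite F'"
  define p' where "p' = inv_into S p"
  define q' where "q' = inv_into T q"
  have p': "p' (p s) = s" if "s \<in> S" for s using that p by (simp add: p'_def)
  have q': "q' (q s) = s" if "s \<in> T" for s using that q by (simp add: q'_def)
  let ?F = "F \<inter> S" and ?F' = "F' \<inter> T"
  have ip: "inj_on p ?F" and iq: "inj_on q ?F'" using p q by (meson inj_on_subset inf_le2)+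
  have "(\<Sum>s\<in>F. \<Sum>t\<in>F'. L s t * \<xi> t * \<eta> s) = (\<Sum>s\<in>?F. \<Sum>t\<in>F'. L s t * \<xi> t * \<eta> s)"
    using F L0 by (intro sum.mono_neutral_right) (auto intro!: sum.neutral)
  also have "\<dots> = (\<Sum>s\<in>?F. \<Sum>t\<in>?F'. L s t * \<xi> t * \<eta> s)"
    using F L0 by (intro sum.cong sum.mono_neutral_right) auto
  also have "\<dots> = (\<Sum>s\<in>?F. \<Sum>t\<in>?F'. K (p s) (q t) * \<xi> (q' (q t)) * \<eta> (p' (p s)))"
    by (intro sum.cong refl) (auto simp: L p' q')
  also have "\<dots> = (\<Sum>s\<in>p ` ?F. \<Sum>t\<in>q ` ?F'. K s t * \<xi> (q' t) * \<eta> (p' s))"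
    by (simp add: sum.reindex[OF ip] sum.reindex[OF iq])
  finally have eq: "(\<Sum>s\<in>F. \<Sum>t\<in>F'. L s t * \<xi> t * \<eta> s)
     = (\<Sum>s\<in>p ` ?F. \<Sum>t\<in>q ` ?F'. K s t * \<xi> (q' t) * \<eta> (p' s))" .
  have 1: "L2_set (\<lambda>t. cmod (\<xi> (q' t))) (q ` ?F') \<le> L2_set (\<lambda>t. cmod (\<xi> t)) F'"
    unfolding L2_set_def using F
    by (simp add: sum.reindex[OF iq] q') (intro sum_mono2, auto)
  have 2: "L2_set (\<lambda>t. cmod (\<eta> (p' t))) (p ` ?F) \<le> L2_set (\<lambda>t. cmod (\<eta> t)) F"
    unfolding L2_set_def using F
    by (simp add: sum.reindex[OF ip] p') (intro sum_mono2, auto)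
  have "cmod (\<Sum>s\<in>F. \<Sum>t\<in>F'. L s t * \<xi> t * \<eta> s)
      \<le> C * L2_set (\<lambda>t. cmod (\<xi> (q' t))) (q ` ?F') * L2_set (\<lambda>s. cmod (\<eta> (p' s))) (p ` ?F)"
    unfolding eq using F by (intro kbdD[OF K]) auto
  also have "\<dots> \<le> C * L2_set (\<lambda>t. cmod (\<xi> t)) F' * L2_set (\<lambda>s. cmod (\<eta> s)) F"
    using 1 2 kernel_bounded_nonneg[OF K] by (intro mult_mono) (auto intro!: mult_nonneg_nonneg L2_set_nonneg)
  finally show "cmod (\<Sum>s\<in>F. \<Sum>t\<in>F'. L s t * \<xi> t * \<eta> s)
      \<le> C * L2_set (\<lambda>t. cmod (\<xi> t)) F' * L2_set (\<lambda>s. cmod (\<eta> s)) F" .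
qed

text \<open>The level sets of \<open>\<alpha>\<close> and \<open>\<beta>\<close> split rows and
  columns into matching blocks, and a block diagonal matrix has the norm of its largest block:
  Cauchy-Schwarz over the labels \<open>v\<close> reassembles the block estimates.\<close>

lemma kernel_bounded_blocks:
  fixes K :: "'a \<Rightarrow> 'b \<Rightarrow> complex"
  assumes C: "0 \<le> C" and supp: "\<And>s t. K s t \<noteq> 0 \<Longrightarrow> \<alpha> s = \<beta> t"
    and blk: "\<And>v. kernel_bounded (\<lambda>s t. if \<alpha> s = v \<and> \<beta> t = v then K s t else 0) C"
  shows "kernel_bounded K C"
proof (rule kbdI[OF C])
  fix F :: "'a set" and F' :: "'b set" and \<xi> \<eta> assume F: "finite F" "finite F'"
  define Fv where "Fv v = {s\<in>F. \<alpha> s = v}" for v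
  define Gv where "Gv v = {t\<in>F'. \<beta> t = v}" for v
  define a where "a v = L2_set (\<lambda>t. cmod (\<xi> t)) (Gv v)" for v
  define b where "b v = L2_set (\<lambda>s. cmod (\<eta> s)) (Fv v)" for v
  let ?V = "\<alpha> ` F \<union> \<beta> ` F'"
  have V: "finite ?V" using F by auto
  have "(\<Sum>s\<in>F. \<Sum>t\<in>F'. K s t * \<xi> t * \<eta> s) = (\<Sum>v\<in>?V. \<Sum>s\<in>Fv v. \<Sum>t\<in>F'. K s t * \<xi> t * \<eta> s)"
    unfolding Fv_def using F V by (intro sum.group[symmetric]) auto
  also have "\<dots> = (\<Sum>v\<in>?V. \<Sum>s\<in>Fv v. \<Sum>t\<in>Gv v. (if \<alpha> s = v \<and> \<beta> t = v then K s t else 0) * \<xi> t * \<eta> s)"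
  proof (rule sum.cong[OF refl], rule sum.cong[OF refl])
    fix v s assume s: "s \<in> Fv v"
    show "(\<Sum>t\<in>F'. K s t * \<xi> t * \<eta> s) = (\<Sum>t\<in>Gv v. (if \<alpha> s = v \<and> \<beta> t = v then K s t else 0) * \<xi> t * \<eta> s)"
      using s F supp unfolding Fv_def Gv_def
      by (intro sum.mono_neutral_cong_right) fastforce+
  qed
  finally have "cmod (\<Sum>s\<in>F. \<Sum>t\<in>F'. K s t * \<xi> t * \<eta> s)
     \<le> (\<Sum>v\<in>?V. cmod (\<Sum>s\<in>Fv v. \<Sum>t\<in>Gv v. (if \<alpha> s = v \<and> \<beta> t = v then K s t else 0) * \<xi> t * \<eta> s))"
    by (simp add: norm_sum)
  also have "\<dots> \<le> (\<Sum>v\<in>?V. C * a v * b v)"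
    unfolding a_def b_def using F by (intro sum_mono kbdD[OF blk]) (auto simp: Fv_def Gv_def)
  also have "\<dots> = C * (\<Sum>v\<in>?V. \<bar>a v\<bar> * \<bar>b v\<bar>)"
    by (simp add: sum_distrib_left mult.assoc a_def b_def)
  also have "\<dots> \<le> C * (L2_set a ?V * L2_set b ?V)"
    using C L2_set_mult_ineq by (intro mult_left_mono) auto
  also have "L2_set a ?V = L2_set (\<lambda>t. cmod (\<xi> t)) F'"
  proof -
    have "(\<Sum>v\<in>?V. (a v)\<^sup>2) = (\<Sum>v\<in>?V. \<Sum>t\<in>{t\<in>F'. \<beta> t = v}. (cmod (\<xi> t))\<^sup>2)"
      by (simp add: a_def L2_set_def Gv_def sum_nonneg)
    also have "\<dots> = (\<Sum>t\<in>F'. (cmod (\<xi> t))\<^sup>2)"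
      using F V by (intro sum.group) auto
    finally show ?thesis unfolding L2_set_def by simp
  qed
  also have "L2_set b ?V = L2_set (\<lambda>t. cmod (\<eta> t)) F"
  proof -
    have "(\<Sum>v\<in>?V. (b v)\<^sup>2) = (\<Sum>v\<in>?V. \<Sum>t\<in>{t\<in>F. \<alpha> t = v}. (cmod (\<eta> t))\<^sup>2)"
      by (simp add: b_def L2_set_def Fv_def sum_nonneg)
    also have "\<dots> = (\<Sum>t\<in>F. (cmod (\<eta> t))\<^sup>2)"
      using F V by (intro sum.group) auto
    finally show ?thesis unfolding L2_set_def by simp
  qed
  finally show "cmod (\<Sum>s\<in>F. \<Sum>t\<in>F'. K s t * \<xi> t * \<eta> s)
      \<le> C * L2_set (\<lambda>t. cmod (\<xi> t)) F' * L2_set (\<lambda>s. cmod (\<eta> s)) F"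
    by (simp add: mult.assoc)
qed

lemma kernel_bounded_schur:
  assumes K: "kernel_bounded K C"
  shows "kernel_bounded (\<lambda>s t. if \<alpha> s = \<beta> t then K s t else 0) C"
proof (rule kernel_bounded_blocks[where \<alpha>=\<alpha> and \<beta>=\<beta>])
  show "0 \<le> C" using K by (rule kernel_bounded_nonneg)
  show "\<alpha> s = \<beta> t" if "(if \<alpha> s = \<beta> t then K s t else 0) \<noteq> 0" for s t
    using that by (auto split: if_splits)
  \<comment> \<open>Inside one block the cut removes nothing more, so the block is a rectangular
    submatrix of \<open>K\<close>.\<close>
  show "kernel_bounded (\<lambda>s t. if \<alpha> s = v \<and> \<beta> t = v then if \<alpha> s = \<beta> t then K s t else 0 else 0) C" for v
    by (rule kernel_bounded_reindex[OF K, of id "{s. \<alpha> s = v}" id "{t. \<beta> t = v}"]) auto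
qed

section \<open>Subspaces of symbols and completely bounded reindexings\<close>

text \<open>The scalar matrix of an operator matrix whose entries are convolutions by
  \<open>X i j\<close>. It is extended by zero to all of \<open>nat \<times> 'a\<close>, so that
  every matrix size lives on the same index type.\<close>

definition matrix_kernel :: "('a, 'b) monoid_scheme \<Rightarrow> nat \<Rightarrow> (nat \<Rightarrow> nat \<Rightarrow> 'a \<Rightarrow> complex)
    \<Rightarrow> nat \<times> 'a \<Rightarrow> nat \<times> 'a \<Rightarrow> complex" where
  "matrix_kernel G k X p q = (if fst p < k \<and> fst q < k \<and> snd p \<in> carrier G \<and> snd q \<in> carrier G
     then X (fst p) (fst q) (snd p \<otimes>\<^bsub>G\<^esub> inv\<^bsub>G\<^esub> snd q) else 0)"

text \<open>The set \<open>A\<close> stands for the space of symbols supported on it, and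
  \<open>C\<close> is an upper bound for the norm of a matrix over that space; with bounds in place
  of norms, no supremum has to exist at this stage.\<close>

definition symbol_bounded :: "('a, 'b) monoid_scheme \<Rightarrow> 'a set \<Rightarrow> nat \<Rightarrow> (nat \<Rightarrow> nat \<Rightarrow> 'a \<Rightarrow> complex)
    \<Rightarrow> real \<Rightarrow> bool" where
  "symbol_bounded G A k X C \<longleftrightarrow> kernel_bounded (matrix_kernel G k (\<lambda>i j a. if a \<in> A then X i j a else 0)) C"

text \<open>Reindexing of symbols by \<open>\<theta>\<close>, from functions on \<open>B \<subseteq> H\<close> to functions on \<open>A \<subseteq> G\<close>, with one
  constant for all matrix sizes; this is complete boundedness at the level of symbols.\<close>
definition cb_map :: "('a, 'b) monoid_scheme \<Rightarrow> 'a set \<Rightarrow> ('c, 'd) monoid_scheme \<Rightarrow> 'c set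
    \<Rightarrow> ('a \<Rightarrow> 'c) \<Rightarrow> bool" where
  "cb_map G A H B \<theta> \<longleftrightarrow> (\<exists>D\<ge>0. \<forall>k X C. symbol_bounded H B k X C \<longrightarrow> symbol_bounded G A k (\<lambda>i j a. X i j (\<theta> a)) (D * C))"

text \<open>A complete isomorphism of two spaces of symbols that is induced by a bijection of their
  supports.\<close>

definition cb_equiv :: "('a, 'b) monoid_scheme \<Rightarrow> 'a set \<Rightarrow> ('c, 'd) monoid_scheme \<Rightarrow> 'c set \<Rightarrow> bool" where
  "cb_equiv G A H B \<longleftrightarrow> (\<exists>\<theta> \<theta>'. (\<forall>a\<in>A. \<theta> a \<in> B \<and> \<theta>' (\<theta> a) = a) \<and> (\<forall>b\<in>B. \<theta>' b \<in> A \<and> \<theta> (\<theta>' b) = b)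
     \<and> cb_map G A H B \<theta> \<and> cb_map H B G A \<theta>')"

text \<open>Reindexing along the identity of \<open>A1\<close> is truncation of symbols from
  \<open>A\<close> to \<open>A1\<close>. Its complete boundedness makes the space on
  \<open>A1\<close> the range of a completely bounded projection, with the space on
  \<open>A - A1\<close> as complement.\<close>

definition cb_complemented :: "('a, 'b) monoid_scheme \<Rightarrow> 'a set \<Rightarrow> 'a set \<Rightarrow> bool" where
  "cb_complemented G A A1 \<longleftrightarrow> A1 \<subseteq> A \<and> cb_map G A1 G A (\<lambda>a. a)"

lemma symbol_bounded_cong:
  assumes "\<And>i j a. i < k \<Longrightarrow> j < k \<Longrightarrow> a \<in> A \<Longrightarrow> X i j a = Y i j a"
  shows "symbol_bounded G A k X C \<longleftrightarrow> symbol_bounded G A k Y C"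
proof -
  have "matrix_kernel G k (\<lambda>i j a. if a \<in> A then X i j a else 0) = matrix_kernel G k (\<lambda>i j a. if a \<in> A then Y i j a else 0)"
    using assms by (auto simp: matrix_kernel_def fun_eq_iff)
  then show ?thesis by (simp add: symbol_bounded_def)
qed

lemma kernel_bounded_zero: "0 \<le> C \<Longrightarrow> kernel_bounded (\<lambda>s t. 0) C"
  unfolding kernel_bounded_def by (simp add: L2_set_nonneg)

lemma symbol_bounded_union:
  assumes "A1 \<inter> A2 = {}" "symbol_bounded G A1 k X C" "symbol_bounded G A2 k X D"
  shows "symbol_bounded G (A1 \<union> A2) k X (C + D)"
proof -
  have "matrix_kernel G k (\<lambda>i j a. if a \<in> A1 \<union> A2 then X i j a else 0) = (\<lambda>s t.
    matrix_kernel G k (\<lambda>i j a. if a \<in> A1 then X i j a else 0) s t + matrix_kernel G k (\<lambda>i j a. if a \<in> A2 then X i j a else 0) s t)"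
    using assms(1) by (auto simp: matrix_kernel_def fun_eq_iff)
  then show ?thesis using assms kernel_bounded_add unfolding symbol_bounded_def by force
qed

lemma symbol_bounded_Diff:
  assumes "A1 \<subseteq> A" "symbol_bounded G A1 k X C" "symbol_bounded G A k X D"
  shows "symbol_bounded G (A - A1) k X (D + C)"
proof -
  have "matrix_kernel G k (\<lambda>i j a. if a \<in> A - A1 then X i j a else 0) = (\<lambda>s t.
    matrix_kernel G k (\<lambda>i j a. if a \<in> A then X i j a else 0) s t - matrix_kernel G k (\<lambda>i j a. if a \<in> A1 then X i j a else 0) s t)"
    using assms(1) by (auto simp: matrix_kernel_def fun_eq_iff)
  then show ?thesis using assms kernel_bounded_diff unfolding symbol_bounded_def by force
qed

lemma nbmapI:
  assumes "0 \<le> D" "\<And>k X C. symbol_bounded H B k X C \<Longrightarrow> symbol_bounded G A k (\<lambda>i j a. X i j (\<theta> a)) (D * C)"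
  shows "cb_map G A H B \<theta>"
  using assms unfolding cb_map_def by blast

lemma cb_map_comp:
  assumes "cb_map G A H B \<theta>" "cb_map H B K D \<psi>"
  shows "cb_map G A K D (\<lambda>a. \<psi> (\<theta> a))"
proof -
  obtain c where c: "c \<ge> 0" "\<And>k X C. symbol_bounded H B k X C \<Longrightarrow> symbol_bounded G A k (\<lambda>i j a. X i j (\<theta> a)) (c * C)"
    using assms(1) unfolding cb_map_def by blast
  obtain d where d: "d \<ge> 0" "\<And>k X C. symbol_bounded K D k X C \<Longrightarrow> symbol_bounded H B k (\<lambda>i j a. X i j (\<psi> a)) (d * C)"
    using assms(2) unfolding cb_map_def by blast
  show ?thesis
    using c(2)[OF d(2)] c(1) d(1) by (intro nbmapI[of "c * d"]) (auto simp: mult.assoc)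
qed

lemma cb_map_cong:
  assumes "cb_map G A H B \<theta>" "\<And>a. a \<in> A \<Longrightarrow> \<theta> a = \<psi> a"
  shows "cb_map G A H B \<psi>"
proof -
  have "symbol_bounded G A k (\<lambda>i j a. X i j (\<theta> a)) C \<longleftrightarrow> symbol_bounded G A k (\<lambda>i j a. X i j (\<psi> a)) C" for k X C
    using assms(2) by (intro symbol_bounded_cong) auto
  then show ?thesis using assms(1) unfolding cb_map_def by simp
qed

lemma cb_map_id: "cb_map G A G A (\<lambda>a. a)"
  by (rule nbmapI[of 1]) auto

lemma cb_map_union:
  assumes dA: "A1 \<inter> A2 = {}"
    and 1: "cb_map G A1 H B \<theta>" and 2: "cb_map G A2 H B \<theta>"
  shows "cb_map G (A1 \<union> A2) H B \<theta>"
proof -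
  obtain c where c: "c \<ge> 0" "\<And>k X C. symbol_bounded H B k X C \<Longrightarrow> symbol_bounded G A1 k (\<lambda>i j a. X i j (\<theta> a)) (c * C)"
    using 1 unfolding cb_map_def by blast
  obtain d where d: "d \<ge> 0" "\<And>k X C. symbol_bounded H B k X C \<Longrightarrow> symbol_bounded G A2 k (\<lambda>i j a. X i j (\<theta> a)) (d * C)"
    using 2 unfolding cb_map_def by blast
  show ?thesis
  proof (rule nbmapI[of "c + d"])
    fix k X C assume "symbol_bounded H B k X C"
    from symbol_bounded_union[OF dA c(2)[OF this] d(2)[OF this]]
    show "symbol_bounded G (A1 \<union> A2) k (\<lambda>i j a. X i j (\<theta> a)) ((c + d) * C)" by (simp add: algebra_simps)
  qed (use c d in simp)
qed

lemma cb_complemented_trans: "cb_complemented G A B \<Longrightarrow> cb_complemented G B C \<Longrightarrow> cb_complemented G A C"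
  unfolding cb_complemented_def using cb_map_comp by blast

lemma cb_complemented_Diff:
  assumes "cb_complemented G A A1"
  shows "cb_complemented G A (A - A1)"
proof -
  obtain c where c: "c \<ge> 0" "\<And>k X C. symbol_bounded G A k X C \<Longrightarrow> symbol_bounded G A1 k X (c * C)"
    using assms unfolding cb_map_def cb_complemented_def by blast
  have "cb_map G (A - A1) G A (\<lambda>a. a)"
  proof (rule nbmapI[of "1 + c"])
    fix k X C assume "symbol_bounded G A k X C"
    then show "symbol_bounded G (A - A1) k X ((1 + c) * C)"
      using symbol_bounded_Diff[OF _ c(2), of A k X C C] assms unfolding cb_complemented_def by (simp add: algebra_simps)
  qed (use c in simp)
  then show ?thesis by (simp add: cb_complemented_def)
qed

text \<open>A symbol on \<open>B\<close>, extended by zero to \<open>A\<close>, has the same kernel,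
  so truncation to \<open>A1\<close> is bounded on \<open>B\<close> by the same constant.\<close>

lemma cb_complemented_subset:
  assumes "cb_complemented G A A1" "A1 \<subseteq> B" "cb_complemented G A B"
  shows "cb_complemented G B A1"
proof -
  obtain c where c: "c \<ge> 0" "\<And>k X C. symbol_bounded G A k X C \<Longrightarrow> symbol_bounded G A1 k X (c * C)"
    using assms unfolding cb_map_def cb_complemented_def by blast
  have BA: "B \<subseteq> A" using assms by (simp add: cb_complemented_def)
  have "cb_map G A1 G B (\<lambda>a. a)"
  proof (rule nbmapI[OF c(1)])
    fix k X C assume X: "symbol_bounded G B k X C"
    have "symbol_bounded G A k (\<lambda>i j a. if a \<in> B then X i j a else 0) C \<longleftrightarrow> symbol_bounded G B k X C"
    proof -
      have "matrix_kernel G k (\<lambda>i j a. if a \<in> A then if a \<in> B then X i j a else 0 else 0)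
        = matrix_kernel G k (\<lambda>i j a. if a \<in> B then X i j a else 0)"
        using BA by (auto simp: matrix_kernel_def fun_eq_iff)
      then show ?thesis by (simp add: symbol_bounded_def)
    qed
    with X have "symbol_bounded G A1 k (\<lambda>i j a. if a \<in> B then X i j a else 0) (c * C)" using c by blast
    then show "symbol_bounded G A1 k X (c * C)" using assms(2)
      by (subst symbol_bounded_cong[of k A1 X "\<lambda>i j a. if a \<in> B then X i j a else 0"]) auto
  qed
  then show ?thesis using assms by (simp add: cb_complemented_def)
qed

lemma cb_equiv_refl: "cb_equiv G A G A"
  unfolding cb_equiv_def using cb_map_id by (intro exI[of _ "\<lambda>a. a"]) blast

lemma cb_equiv_sym: "cb_equiv G A H B \<Longrightarrow> cb_equiv H B G A"
  unfolding cb_equiv_def by blast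

lemma cb_equiv_trans:
  assumes "cb_equiv G A H B" "cb_equiv H B K D"
  shows "cb_equiv G A K D"
proof -
  obtain \<theta> \<theta>' where 1: "\<forall>a\<in>A. \<theta> a \<in> B \<and> \<theta>' (\<theta> a) = a" "\<forall>b\<in>B. \<theta>' b \<in> A \<and> \<theta> (\<theta>' b) = b"
     "cb_map G A H B \<theta>" "cb_map H B G A \<theta>'" using assms(1) unfolding cb_equiv_def by blast
  obtain \<psi> \<psi>' where 2: "\<forall>a\<in>B. \<psi> a \<in> D \<and> \<psi>' (\<psi> a) = a" "\<forall>b\<in>D. \<psi>' b \<in> B \<and> \<psi> (\<psi>' b) = b"
     "cb_map H B K D \<psi>" "cb_map K D H B \<psi>'" using assms(2) unfolding cb_equiv_def by blast
  show ?thesis unfolding cb_equiv_def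
    using 1 2 cb_map_comp[OF 1(3) 2(3)] cb_map_comp[OF 2(4) 1(4)]
    by (intro exI[of _ "\<lambda>a. \<psi> (\<theta> a)"] exI[of _ "\<lambda>a. \<theta>' (\<psi>' a)"]) auto
qed

text \<open>The glued map truncates a symbol on the union to one piece and then reindexes that
  piece, which is where complementation of the pieces enters, on either side for one of the two
  directions; \<open>cb_map_union\<close> adds the results.\<close>

lemma cb_equiv_union:
  assumes A: "cb_complemented G (A1 \<union> A2) A1" "A1 \<inter> A2 = {}"
    and B: "cb_complemented H (B1 \<union> B2) B1" "B1 \<inter> B2 = {}"
    and e1: "cb_equiv G A1 H B1" and e2: "cb_equiv G A2 H B2"
  shows "cb_equiv G (A1 \<union> A2) H (B1 \<union> B2)"
proof -
  have A2: "cb_complemented G (A1 \<union> A2) A2" using cb_complemented_Diff[OF A(1)] A(2) by (simp add: Un_Diff Diff_triv Int_commute)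
  have B2: "cb_complemented H (B1 \<union> B2) B2" using cb_complemented_Diff[OF B(1)] B(2) by (simp add: Un_Diff Diff_triv Int_commute)
  obtain \<theta> \<theta>' where 1: "\<forall>a\<in>A1. \<theta> a \<in> B1 \<and> \<theta>' (\<theta> a) = a" "\<forall>b\<in>B1. \<theta>' b \<in> A1 \<and> \<theta> (\<theta>' b) = b"
     "cb_map G A1 H B1 \<theta>" "cb_map H B1 G A1 \<theta>'" using e1 unfolding cb_equiv_def by blast
  obtain \<psi> \<psi>' where 2: "\<forall>a\<in>A2. \<psi> a \<in> B2 \<and> \<psi>' (\<psi> a) = a" "\<forall>b\<in>B2. \<psi>' b \<in> A2 \<and> \<psi> (\<psi>' b) = b"
     "cb_map G A2 H B2 \<psi>" "cb_map H B2 G A2 \<psi>'" using e2 unfolding cb_equiv_def by blast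
  define f where "f a = (if a \<in> A1 then \<theta> a else \<psi> a)" for a
  define g where "g b = (if b \<in> B1 then \<theta>' b else \<psi>' b)" for b
  have f: "cb_map G (A1 \<union> A2) H (B1 \<union> B2) f"
  proof (rule cb_map_union[OF A(2)])
    show "cb_map G A1 H (B1 \<union> B2) f"
      using cb_map_comp[OF 1(3), of H "B1 \<union> B2" "\<lambda>a. a"] B(1) unfolding cb_complemented_def
      by (rule_tac cb_map_cong[of G A1 H _ \<theta>]) (auto simp: f_def)
    show "cb_map G A2 H (B1 \<union> B2) f"
      using cb_map_comp[OF 2(3), of H "B1 \<union> B2" "\<lambda>a. a"] B2 A(2) unfolding cb_complemented_def
      by (rule_tac cb_map_cong[of G A2 H _ \<psi>]) (auto simp: f_def)
  qed
  have g: "cb_map H (B1 \<union> B2) G (A1 \<union> A2) g"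
  proof (rule cb_map_union[OF B(2)])
    show "cb_map H B1 G (A1 \<union> A2) g"
      using cb_map_comp[OF 1(4), of G "A1 \<union> A2" "\<lambda>a. a"] A(1) unfolding cb_complemented_def
      by (rule_tac cb_map_cong[of H B1 G _ \<theta>']) (auto simp: g_def)
    show "cb_map H B2 G (A1 \<union> A2) g"
      using cb_map_comp[OF 2(4), of G "A1 \<union> A2" "\<lambda>a. a"] A2 B(2) unfolding cb_complemented_def
      by (rule_tac cb_map_cong[of H B2 G _ \<psi>']) (auto simp: g_def)
  qed
  show ?thesis unfolding cb_equiv_def
    using f g 1 2 A(2) B(2)
    by (intro exI[of _ f] exI[of _ g]) (auto simp: f_def g_def)
qed

section \<open>Cosets and group homomorphisms\<close>

text \<open>The cut looks only at the group components \<open>s\<close> and \<open>t\<close>, never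
  at the matrix indices, so a single cut serves every matrix size and the constant is 1.\<close>

lemma symbol_bounded_schur:
  assumes A: "A \<subseteq> carrier G"
    and ab: "\<And>s t. s \<in> carrier G \<Longrightarrow> t \<in> carrier G \<Longrightarrow> s \<otimes>\<^bsub>G\<^esub> inv\<^bsub>G\<^esub> t \<in> carrier G \<Longrightarrow>
       s \<otimes>\<^bsub>G\<^esub> inv\<^bsub>G\<^esub> t \<in> A \<longleftrightarrow> \<alpha> s = \<beta> t"
  shows "cb_complemented G (carrier G) A"
proof -
  have "cb_map G A G (carrier G) (\<lambda>a. a)"
  proof (rule nbmapI[of 1])
    fix k X C assume "symbol_bounded G (carrier G) k X C"
    then have "kernel_bounded (\<lambda>p q. if \<alpha> (snd p) = \<beta> (snd q)
        then matrix_kernel G k (\<lambda>i j a. if a \<in> carrier G then X i j a else 0) p q else 0) C"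
      unfolding symbol_bounded_def by (rule kernel_bounded_schur)
    also have "(\<lambda>p q. if \<alpha> (snd p) = \<beta> (snd q)
        then matrix_kernel G k (\<lambda>i j a. if a \<in> carrier G then X i j a else 0) p q else 0)
      = matrix_kernel G k (\<lambda>i j a. if a \<in> A then X i j a else 0)"
      using A ab by (auto simp: matrix_kernel_def fun_eq_iff)
    finally show "symbol_bounded G A k X (1 * C)" unfolding symbol_bounded_def by simp
  qed simp
  then show ?thesis using A by (simp add: cb_complemented_def)
qed

text \<open>At most one of the two equalities holds, so the indicator of \<open>A\<close> is the sum
  of two cuts; hence the constant 2.\<close>

lemma symbol_bounded_schur2:
  assumes A: "A \<subseteq> carrier G"
    and ab: "\<And>s t. s \<in> carrier G \<Longrightarrow> t \<in> carrier G \<Longrightarrow>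
       s \<otimes>\<^bsub>G\<^esub> inv\<^bsub>G\<^esub> t \<in> A \<longleftrightarrow> \<alpha> s = \<beta> t \<or> \<alpha>' s = \<beta>' t"
    and dj: "\<And>s t. s \<in> carrier G \<Longrightarrow> t \<in> carrier G \<Longrightarrow> \<not> (\<alpha> s = \<beta> t \<and> \<alpha>' s = \<beta>' t)"
  shows "cb_complemented G (carrier G) A"
proof -
  have "cb_map G A G (carrier G) (\<lambda>a. a)"
  proof (rule nbmapI[of 2])
    fix k X C assume "symbol_bounded G (carrier G) k X C"
    then have K: "kernel_bounded (matrix_kernel G k (\<lambda>i j a. if a \<in> carrier G then X i j a else 0)) C"
      (is "kernel_bounded ?K C") by (simp add: symbol_bounded_def)
    have "kernel_bounded (\<lambda>p q. (if \<alpha> (snd p) = \<beta> (snd q) then ?K p q else 0)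
        + (if \<alpha>' (snd p) = \<beta>' (snd q) then ?K p q else 0)) (C + C)"
      by (intro kernel_bounded_add kernel_bounded_schur K)
    also have "(\<lambda>p q. (if \<alpha> (snd p) = \<beta> (snd q) then ?K p q else 0)
        + (if \<alpha>' (snd p) = \<beta>' (snd q) then ?K p q else 0))
      = matrix_kernel G k (\<lambda>i j a. if a \<in> A then X i j a else 0)"
      using A ab dj by (auto simp: matrix_kernel_def fun_eq_iff)
    finally show "symbol_bounded G A k X (2 * C)" unfolding symbol_bounded_def by simp
  qed simp
  then show ?thesis using A by (simp add: cb_complemented_def)
qed

lemma (in group) rcoset_eq_iff:
  assumes "subgroup K G" "x \<in> carrier G" "y \<in> carrier G"
  shows "K #> x = K #> y \<longleftrightarrow> x \<otimes> inv y \<in> K"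
  using assms repr_independence repr_independenceD rcos_self subgroup.rcos_module[OF assms(1)] is_group
  by (metis)

text \<open>Brings a left coset into the form required for a cut: \<open>g\<close> is moved to the
  row variable, and the labels are right cosets of \<open>K\<close>.\<close>

lemma (in group) mem_translate_iff:
  assumes "subgroup K G" "g \<in> carrier G" "s \<in> carrier G" "t \<in> carrier G"
  shows "s \<otimes> inv t \<in> (\<lambda>k. g \<otimes> k) ` K \<longleftrightarrow> K #> (inv g \<otimes> s) = K #> t"
proof -
  have K: "K \<subseteq> carrier G" using assms(1) by (rule subgroup.subset)
  have "s \<otimes> inv t \<in> (\<lambda>k. g \<otimes> k) ` K \<longleftrightarrow> inv g \<otimes> (s \<otimes> inv t) \<in> K"
  proof
    assume "s \<otimes> inv t \<in> (\<lambda>k. g \<otimes> k) ` K"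
    then obtain k where k: "k \<in> K" "s \<otimes> inv t = g \<otimes> k" by auto
    then show "inv g \<otimes> (s \<otimes> inv t) \<in> K"
      using K assms inv_solve_left'[of k g "s \<otimes> inv t"] by (auto simp: m_assoc[symmetric])
  next
    assume "inv g \<otimes> (s \<otimes> inv t) \<in> K"
    moreover have "g \<otimes> (inv g \<otimes> (s \<otimes> inv t)) = s \<otimes> inv t"
      using assms by (simp add: m_assoc[symmetric])
    ultimately show "s \<otimes> inv t \<in> (\<lambda>k. g \<otimes> k) ` K" by force
  qed
  then show ?thesis using rcoset_eq_iff[OF assms(1), of "inv g \<otimes> s" t] assms by (simp add: m_assoc)
qed

lemma (in group) cb_complemented_translate:
  assumes K: "subgroup K G" and g: "g \<in> carrier G"
  shows "cb_complemented G (carrier G) ((\<lambda>k. g \<otimes> k) ` K)"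
  using subgroup.subset[OF K] g
  by (intro symbol_bounded_schur[of _ _ "\<lambda>s. K #> (inv g \<otimes> s)" "\<lambda>t. K #> t"]) (auto simp: mem_translate_iff[OF K])

text \<open>Pulling a symbol back to \<open>G\<close> takes a submatrix of the kernel over
  \<open>H\<close>. Pushing a symbol forward gives a kernel over \<open>H\<close> that is block
  diagonal along the right cosets of the image of \<open>G\<close>, and each of its blocks copies
  the kernel over \<open>G\<close>. Both directions therefore have constant 1.\<close>

lemma (in group_hom) cb_equiv_translate_hom:
  assumes inj: "inj_on h (carrier G)" and g: "g \<in> carrier H" and B: "B \<subseteq> carrier G"
  shows "cb_equiv G B H ((\<lambda>b. g \<otimes>\<^bsub>H\<^esub> h b) ` B)"
proof -
  define \<theta> where "\<theta> b = g \<otimes>\<^bsub>H\<^esub> h b" for b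
  define h' where "h' = inv_into (carrier G) h"
  define \<theta>' where "\<theta>' a = h' (inv\<^bsub>H\<^esub> g \<otimes>\<^bsub>H\<^esub> a)" for a
  let ?K = "h ` carrier G"
  have K: "subgroup ?K H" by (rule img_is_subgroup)
  have h': "h' (h x) = x" if "x \<in> carrier G" for x
    using that inj by (simp add: h'_def)
  have hh': "h (h' y) = y" "h' y \<in> carrier G" if "y \<in> ?K" for y
    using that h' by auto
  have \<theta>': "\<theta>' (\<theta> b) = b" if "b \<in> carrier G" for b
    using that g h' by (simp add: \<theta>_def \<theta>'_def H.m_assoc[symmetric])
  have \<theta>B: "\<theta> b \<in> \<theta> ` B \<longleftrightarrow> b \<in> B" if "b \<in> carrier G" for b
    using that \<theta>' B by (metis image_iff subsetD)
  have 1: "cb_map G B H (\<theta> ` B) \<theta>"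
  proof (rule nbmapI[of 1])
    fix k X C assume "symbol_bounded H (\<theta> ` B) k X C"
    then have "kernel_bounded (matrix_kernel H k (\<lambda>i j a. if a \<in> \<theta> ` B then X i j a else 0)) C" by (simp add: symbol_bounded_def)
    then have "kernel_bounded (matrix_kernel G k (\<lambda>i j a. if a \<in> B then X i j (\<theta> a) else 0)) C"
    \<comment> \<open>Only the rows are translated by \<open>g\<close>, because (g h(s)) h(t)^-1 = g
      h(s t^-1).\<close>
    proof (rule kernel_bounded_reindex[where p="\<lambda>(i,s). (i, g \<otimes>\<^bsub>H\<^esub> h s)" and q="\<lambda>(j,t). (j, h t)"
          and S="{..<k} \<times> carrier G" and T="{..<k} \<times> carrier G"])
      show "inj_on (\<lambda>(i,s). (i, g \<otimes>\<^bsub>H\<^esub> h s)) ({..<k} \<times> carrier G)"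
        using \<theta>' unfolding \<theta>_def by (intro inj_on_inverseI[of _ "\<lambda>(i,s). (i, \<theta>' s)"]) auto
      show "inj_on (\<lambda>(j,t). (j, h t)) ({..<k} \<times> carrier G)"
        using inj by (auto simp: inj_on_def)
      fix s t :: "nat \<times> 'a" assume s: "s \<in> {..<k} \<times> carrier G" and t: "t \<in> {..<k} \<times> carrier G"
      obtain i s' where s': "s = (i, s')" "i < k" "s' \<in> carrier G" using s by auto
      obtain j t' where t': "t = (j, t')" "j < k" "t' \<in> carrier G" using t by auto
      have "g \<otimes>\<^bsub>H\<^esub> h s' \<otimes>\<^bsub>H\<^esub> inv\<^bsub>H\<^esub> h t' = \<theta> (s' \<otimes> inv t')"
        using s' t' g by (simp add: \<theta>_def H.m_assoc)
      then show "matrix_kernel G k (\<lambda>i j a. if a \<in> B then X i j (\<theta> a) else 0) s t =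
          matrix_kernel H k (\<lambda>i j a. if a \<in> \<theta> ` B then X i j a else 0)
            ((\<lambda>(i,s). (i, g \<otimes>\<^bsub>H\<^esub> h s)) s) ((\<lambda>(j,t). (j, h t)) t)"
        using s' t' g \<theta>B[of "s' \<otimes> inv t'"] by (simp add: matrix_kernel_def)
    next
      fix s t :: "nat \<times> 'a" assume "s \<notin> {..<k} \<times> carrier G \<or> t \<notin> {..<k} \<times> carrier G"
      then show "matrix_kernel G k (\<lambda>i j a. if a \<in> B then X i j (\<theta> a) else 0) s t = 0"
        by (cases s; cases t) (auto simp: matrix_kernel_def)
    qed
    then show "symbol_bounded G B k (\<lambda>i j a. X i j (\<theta> a)) (1 * C)" by (simp add: symbol_bounded_def)
  qed simp
  have 2: "cb_map H (\<theta> ` B) G B \<theta>'"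
  proof (rule nbmapI[of 1])
    fix k X C assume "symbol_bounded G B k X C"
    then have X: "kernel_bounded (matrix_kernel G k (\<lambda>i j a. if a \<in> B then X i j a else 0)) C" by (simp add: symbol_bounded_def)
    let ?L = "matrix_kernel H k (\<lambda>i j a. if a \<in> \<theta> ` B then X i j (\<theta>' a) else 0)"
    let ?a = "\<lambda>p :: nat \<times> 'c. ?K #>\<^bsub>H\<^esub> (inv\<^bsub>H\<^esub> g \<otimes>\<^bsub>H\<^esub> snd p)" and ?b = "\<lambda>q :: nat \<times> 'c. ?K #>\<^bsub>H\<^esub> snd q"
    have sub: "\<theta> ` B \<subseteq> (\<lambda>k. g \<otimes>\<^bsub>H\<^esub> k) ` ?K" using B by (auto simp: \<theta>_def)
    have "kernel_bounded ?L C"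
    proof (rule kernel_bounded_blocks[where \<alpha>="?a" and \<beta>="?b"])
      show "0 \<le> C" using X by (rule kernel_bounded_nonneg)
      show "?a s = ?b t" if "?L s t \<noteq> 0" for s t
        using that sub H.mem_translate_iff[OF K g, of "snd s" "snd t"] by (auto simp: matrix_kernel_def split: if_splits)
      fix v
      let ?Lv = "\<lambda>s t. if ?a s = v \<and> ?b t = v then ?L s t else 0"
      show "kernel_bounded ?Lv C"
      proof (cases "\<exists>r\<in>carrier H. v = ?K #>\<^bsub>H\<^esub> r")
        case False
        then have "?Lv = (\<lambda>s t. 0)" by (auto simp: matrix_kernel_def fun_eq_iff)
        then show ?thesis using kernel_bounded_zero[OF kernel_bounded_nonneg[OF X]] by simp
      next
        case True
        then obtain r where r: "r \<in> carrier H" "v = ?K #>\<^bsub>H\<^esub> r" by blast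
        let ?S = "{p. fst p < k \<and> snd p \<in> carrier H \<and> ?a p = v}"
        let ?T = "{p. fst p < k \<and> snd p \<in> carrier H \<and> ?b p = v}"
        \<comment> \<open>Rows of the block have the form g h(x) r and columns the form h(y) r, so s
          t^-1 = g h(x y^-1) and the representative \<open>r\<close> cancels; the two maps read off
          x and y.\<close>
        let ?p = "\<lambda>p :: nat \<times> 'c. (fst p, h' (inv\<^bsub>H\<^esub> g \<otimes>\<^bsub>H\<^esub> snd p \<otimes>\<^bsub>H\<^esub> inv\<^bsub>H\<^esub> r))"
        let ?q = "\<lambda>p :: nat \<times> 'c. (fst p, h' (snd p \<otimes>\<^bsub>H\<^esub> inv\<^bsub>H\<^esub> r))"
        have memS: "inv\<^bsub>H\<^esub> g \<otimes>\<^bsub>H\<^esub> snd p \<otimes>\<^bsub>H\<^esub> inv\<^bsub>H\<^esub> r \<in> ?K" if "p \<in> ?S" for p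
          using that r g H.rcoset_eq_iff[OF K, of "inv\<^bsub>H\<^esub> g \<otimes>\<^bsub>H\<^esub> snd p" r] by simp
        have memT: "snd p \<otimes>\<^bsub>H\<^esub> inv\<^bsub>H\<^esub> r \<in> ?K" if "p \<in> ?T" for p
          using that r g H.rcoset_eq_iff[OF K, of "snd p" r] by simp
        show ?thesis
        proof (rule kernel_bounded_reindex[OF X, of ?p ?S ?q ?T])
          show "inj_on ?p ?S"
          proof (rule inj_on_inverseI[where g="\<lambda>(i,x). (i, g \<otimes>\<^bsub>H\<^esub> (h x \<otimes>\<^bsub>H\<^esub> r))"])
            fix p assume p: "p \<in> ?S"
            show "(\<lambda>(i,x). (i, g \<otimes>\<^bsub>H\<^esub> (h x \<otimes>\<^bsub>H\<^esub> r))) (?p p) = p"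
              using p hh'(1)[OF memS[OF p]] g r
              by (auto simp: prod_eq_iff H.m_assoc) (simp add: H.m_assoc[symmetric])
          qed
          show "inj_on ?q ?T"
          proof (rule inj_on_inverseI[where g="\<lambda>(i,x). (i, h x \<otimes>\<^bsub>H\<^esub> r)"])
            fix p assume p: "p \<in> ?T"
            show "(\<lambda>(i,x). (i, h x \<otimes>\<^bsub>H\<^esub> r)) (?q p) = p"
              using p hh'(1)[OF memT[OF p]] g r by (auto simp: prod_eq_iff H.m_assoc)
          qed
          show "?Lv s t = 0" if "s \<notin> ?S \<or> t \<notin> ?T" for s t
            using that by (auto simp: matrix_kernel_def)
          fix s t assume s: "s \<in> ?S" and t: "t \<in> ?T"
          let ?x = "inv\<^bsub>H\<^esub> g \<otimes>\<^bsub>H\<^esub> snd s \<otimes>\<^bsub>H\<^esub> inv\<^bsub>H\<^esub> r" and ?y = "snd t \<otimes>\<^bsub>H\<^esub> inv\<^bsub>H\<^esub> r"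
          let ?z = "h' ?x \<otimes> inv (h' ?y)"
          have x: "h (h' ?x) = ?x" "h' ?x \<in> carrier G" using hh' memS[OF s] by auto
          have y: "h (h' ?y) = ?y" "h' ?y \<in> carrier G" using hh' memT[OF t] by auto
          have z: "?z \<in> carrier G" using x(2) y(2) by simp
          have cscale: "snd s \<in> carrier H" "snd t \<in> carrier H" using s t by auto
          have "h ?z = ?x \<otimes>\<^bsub>H\<^esub> inv\<^bsub>H\<^esub> ?y" using x y by simp
          also have "\<dots> = inv\<^bsub>H\<^esub> g \<otimes>\<^bsub>H\<^esub> (snd s \<otimes>\<^bsub>H\<^esub> inv\<^bsub>H\<^esub> snd t)"
          proof -
            have "inv\<^bsub>H\<^esub> r \<otimes>\<^bsub>H\<^esub> (r \<otimes>\<^bsub>H\<^esub> inv\<^bsub>H\<^esub> snd t) = inv\<^bsub>H\<^esub> snd t"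
              using cscale r by (simp add: H.m_assoc[symmetric])
            then show ?thesis using cscale r g by (simp add: H.inv_mult_group H.m_assoc)
          qed
          finally have hz: "h ?z = inv\<^bsub>H\<^esub> g \<otimes>\<^bsub>H\<^esub> (snd s \<otimes>\<^bsub>H\<^esub> inv\<^bsub>H\<^esub> snd t)" .
          have \<theta>z: "\<theta> ?z = snd s \<otimes>\<^bsub>H\<^esub> inv\<^bsub>H\<^esub> snd t"
            unfolding \<theta>_def hz using cscale g by (simp add: H.m_assoc[symmetric])
          show "?Lv s t = matrix_kernel G k (\<lambda>i j a. if a \<in> B then X i j a else 0) (?p s) (?q t)"
            using s t \<theta>B[OF z] \<theta>'[OF z] x(2) y(2) by (auto simp: matrix_kernel_def \<theta>z)
        qed
      qed
    qed
    then show "symbol_bounded H (\<theta> ` B) k (\<lambda>i j a. X i j (\<theta>' a)) (1 * C)" by (simp add: symbol_bounded_def)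
  qed simp
  have "cb_equiv G B H (\<theta> ` B)"
    unfolding cb_equiv_def using 1 2 \<theta>' B by (intro exI[of _ \<theta>] exI[of _ \<theta>']) auto
  then show ?thesis by (simp add: \<theta>_def)
qed

section \<open>The Hilbert space of square-summable families\<close>

text \<open>Families on a whole type, so that the type classes supply closures and limits;
  \<open>l2 G\<close> embeds as the families that vanish off the carrier. The inner product of the
  instance is the real part of \<open>cinner\<close>, and complex scalars act through
  \<open>cscale\<close>.\<close>

typedef 'a ell2 = "{f :: 'a \<Rightarrow> complex. (\<lambda>x. (cmod (f x))\<^sup>2) summable_on UNIV}"
  morphisms coef Ell2
  by (intro exI[of _ "\<lambda>_. 0"]) simp

lemma coef_summable: "(\<lambda>x. (cmod (coef f x))\<^sup>2) summable_on UNIV"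
  using coef[of f] by simp

lemma coef_Ell2: "(\<lambda>x. (cmod (f x))\<^sup>2) summable_on UNIV \<Longrightarrow> coef (Ell2 f) = f"
  by (simp add: Ell2_inverse)

lemma ell2_eqI: "(\<And>x. coef f x = coef g x) \<Longrightarrow> f = g"
  using coef_inject by blast

lemma sqsum_scale:
  assumes "(\<lambda>x. (cmod (f x))\<^sup>2) summable_on A"
  shows "(\<lambda>x. (cmod (c * f x))\<^sup>2) summable_on A"
  using summable_on_cmult_right[OF assms, of "(cmod c)\<^sup>2"] by (simp add: norm_mult power_mult_distrib)

lemma sqsum_add:
  assumes "(\<lambda>x. (cmod (f x))\<^sup>2) summable_on A" "(\<lambda>x. (cmod (g x))\<^sup>2) summable_on A"
  shows "(\<lambda>x. (cmod (f x + g x))\<^sup>2) summable_on A"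
proof (rule summable_on_comparison_test)
  show "(\<lambda>x. 2 * (cmod (f x))\<^sup>2 + 2 * (cmod (g x))\<^sup>2) summable_on A"
    using assms by (intro summable_on_add summable_on_cmult_right)
  fix x
  have "(cmod (f x + g x))\<^sup>2 \<le> (cmod (f x) + cmod (g x))\<^sup>2"
    by (intro power_mono norm_triangle_ineq norm_ge_zero)
  also have "\<dots> \<le> 2 * (cmod (f x))\<^sup>2 + 2 * (cmod (g x))\<^sup>2"
    using sum_squares_bound[of "cmod (f x)" "cmod (g x)"] by (simp add: power2_sum)
  finally show "(cmod (f x + g x))\<^sup>2 \<le> 2 * (cmod (f x))\<^sup>2 + 2 * (cmod (g x))\<^sup>2" .
qed simp

lemma sqsum_mult:
  assumes "(\<lambda>x. (cmod (f x))\<^sup>2) summable_on A" "(\<lambda>x. (cmod (g x))\<^sup>2) summable_on A"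
  shows "(\<lambda>x. cmod (f x * g x)) summable_on A"
proof (rule Infinite_Sum.abs_summable_product)
  show "(\<lambda>i. cmod (f i * f i)) summable_on A" "(\<lambda>i. cmod (g i * g i)) summable_on A"
    using assms by (simp_all add: norm_mult power2_eq_square)
qed

definition cinner :: "'a ell2 \<Rightarrow> 'a ell2 \<Rightarrow> complex" where
  "cinner f g = (\<Sum>\<^sub>\<infinity>x. coef f x * cnj (coef g x))"

lemma cinner_summable: "(\<lambda>x. coef f x * cnj (coef g x)) summable_on UNIV"
proof (rule abs_summable_summable, rule sqsum_mult)
  show "(\<lambda>x. (cmod (coef f x))\<^sup>2) summable_on UNIV" "(\<lambda>x. (cmod (cnj (coef g x)))\<^sup>2) summable_on UNIV"
    using coef_summable by simp_all
qed

instantiation ell2 :: (type) real_inner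
begin

definition "0 = Ell2 (\<lambda>_. 0)"
definition "f + g = Ell2 (\<lambda>x. coef f x + coef g x)"
definition "f - g = Ell2 (\<lambda>x. coef f x - coef g x)"
definition "- f = Ell2 (\<lambda>x. - coef f x)"
definition "scaleR r f = Ell2 (\<lambda>x. of_real r * coef f x)"
definition "inner f g = Re (cinner f g)" for f g :: "'a ell2"
definition "norm f = sqrt (inner f f)" for f :: "'a ell2"
definition "dist f g = norm (f - g)" for f g :: "'a ell2"
definition "sgn f = inverse (norm f) *\<^sub>R f" for f :: "'a ell2"
definition "uniformity = (INF e\<in>{0<..}. principal {(x, y :: 'a ell2). dist x y < e})"
definition "open U \<longleftrightarrow> (\<forall>x\<in>U. eventually (\<lambda>(x', y). x' = x \<longrightarrow> y \<in> U) uniformity)"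
  for U :: "'a ell2 set"

lemma coef_zero: "coef 0 x = 0"
  by (simp add: zero_ell2_def coef_Ell2)
lemma coef_add: "coef (f + g) x = coef f x + coef g x"
  by (simp add: plus_ell2_def coef_Ell2 sqsum_add coef_summable)
lemma coef_uminus: "coef (- f) x = - coef f x"
  using sqsum_scale[OF coef_summable, of "-1" f] by (simp add: uminus_ell2_def coef_Ell2)
lemma coef_diff: "coef (f - g) x = coef f x - coef g x"
  using sqsum_add[OF coef_summable[of f] sqsum_scale[OF coef_summable, of "-1" g]]
  by (simp add: minus_ell2_def coef_Ell2)
lemma coef_scaleR: "coef (r *\<^sub>R f) x = of_real r * coef f x"
  by (simp add: scaleR_ell2_def coef_Ell2 sqsum_scale coef_summable)

lemma inner_self: "inner f f = (\<Sum>\<^sub>\<infinity>x. (cmod (coef f x))\<^sup>2)" for f :: "'a ell2"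
proof -
  have "coef f x * cnj (coef f x) = of_real ((cmod (coef f x))\<^sup>2)" for x
    by (metis complex_norm_square)
  then have "inner f f = (\<Sum>\<^sub>\<infinity>x. Re (of_real ((cmod (coef f x))\<^sup>2)))"
    using infsum_Re[OF cinner_summable[of f f]] by (simp add: inner_ell2_def cinner_def)
  then show ?thesis by simp
qed

instance
proof
  fix f g h :: "'a ell2" and r s :: real
  show "f + g + h = f + (g + h)" "f + g = g + f" "0 + f = f" "- f + f = 0" "f - g = f + - g"
    "r *\<^sub>R (f + g) = r *\<^sub>R f + r *\<^sub>R g" "(r + s) *\<^sub>R f = r *\<^sub>R f + s *\<^sub>R f"
    "r *\<^sub>R s *\<^sub>R f = (r * s) *\<^sub>R f" "1 *\<^sub>R f = f"
    by (auto intro!: ell2_eqI simp: coef_add coef_zero coef_uminus coef_diff coef_scaleR algebra_simps)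
  show "inner f g = inner g f"
  proof -
    have "cinner g f = cnj (cinner f g)" unfolding cinner_def by (subst infsum_cnj[symmetric]) (simp add: mult.commute)
    then show ?thesis by (simp add: inner_ell2_def)
  qed
  show "inner (f + g) h = inner f h + inner g h"
    unfolding inner_ell2_def cinner_def
    by (simp add: coef_add distrib_right infsum_add cinner_summable)
  show "inner (r *\<^sub>R f) g = r * inner f g"
    unfolding inner_ell2_def cinner_def
    by (simp add: coef_scaleR mult.assoc infsum_cmult_right')
  show "0 \<le> inner f f" unfolding inner_self by (rule infsum_nonneg) simp
  show "(inner f f = 0) = (f = 0)"
  proof
    assume "inner f f = 0"
    then have "(cmod (coef f x))\<^sup>2 = 0" for x
      using nonneg_infsum_le_0D[OF _ coef_summable, of f x] unfolding inner_self by simp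
    then show "f = 0" by (intro ell2_eqI) (simp add: coef_zero)
  qed (simp add: inner_self coef_zero)
qed (rule dist_ell2_def sgn_ell2_def uniformity_ell2_def open_ell2_def norm_ell2_def)+

end

lemma norm_ell2_sq: "(norm f)\<^sup>2 = (\<Sum>\<^sub>\<infinity>x. (cmod (coef f x))\<^sup>2)" for f :: "'a ell2"
  by (simp add: power2_norm_eq_inner inner_self)

lemma norm_ell2_finite: "finite F \<Longrightarrow> (\<Sum>x\<in>F. (cmod (coef f x))\<^sup>2) \<le> (norm f)\<^sup>2"
  unfolding norm_ell2_sq by (intro finite_sum_le_infsum coef_summable) auto

lemma coef_le_norm: "cmod (coef f x) \<le> norm f"
  using norm_ell2_finite[of "{x}" f] by (simp add: power2_le_iff_abs_le)

lemma sqsum_bounded: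
  assumes "\<And>F. finite F \<Longrightarrow> (\<Sum>x\<in>F. (cmod (f x))\<^sup>2) \<le> B"
  shows "(\<lambda>x. (cmod (f x))\<^sup>2) summable_on A"
proof (rule nonneg_bdd_above_summable_on)
  show "bdd_above (sum (\<lambda>x. (cmod (f x))\<^sup>2) ` {F. F \<subseteq> A \<and> finite F})"
    by (rule bdd_aboveI2[where M=B]) (simp add: assms)
qed simp

lemma ell2_bounded:
  assumes "\<And>F. finite F \<Longrightarrow> (\<Sum>x\<in>F. (cmod (f x))\<^sup>2) \<le> B\<^sup>2" "0 \<le> B"
  shows "coef (Ell2 f) = f" "norm (Ell2 f) \<le> B"
proof -
  have s: "(\<lambda>x. (cmod (f x))\<^sup>2) summable_on UNIV" using assms(1) by (rule sqsum_bounded)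
  show c: "coef (Ell2 f) = f" using s by (rule coef_Ell2)
  have "(norm (Ell2 f))\<^sup>2 \<le> B\<^sup>2"
    unfolding norm_ell2_sq c using s assms(1) by (intro infsum_le_finite_sums) auto
  then show "norm (Ell2 f) \<le> B" using assms(2) by (rule power2_le_imp_le)
qed

instance ell2 :: (type) complete_space
proof
  fix X :: "nat \<Rightarrow> 'a ell2" assume X: "Cauchy X"
  have "Cauchy (\<lambda>n. coef (X n) x)" for x
  proof (rule CauchyI)
    fix e :: real assume "0 < e"
    from CauchyD[OF X this] obtain M where M: "\<forall>m\<ge>M. \<forall>n\<ge>M. norm (X m - X n) < e" ..
    have "cmod (coef (X m) x - coef (X n) x) < e" if "m \<ge> M" "n \<ge> M" for m n
    proof -
      have "norm (X m - X n) < e" using M that by blast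
      then show ?thesis using coef_le_norm[of "X m - X n" x] by (simp add: coef_diff)
    qed
    then show "\<exists>M. \<forall>m\<ge>M. \<forall>n\<ge>M. cmod (coef (X m) x - coef (X n) x) < e" by blast
  qed
  then have "\<exists>l. (\<lambda>n. coef (X n) x) \<longlonglongrightarrow> l" for x
    using Cauchy_convergent_iff convergent_def by blast
  then obtain f where f: "\<And>x. (\<lambda>n. coef (X n) x) \<longlonglongrightarrow> f x" by metis
  \<comment> \<open>The Cauchy estimate, restricted to finitely many coordinates, survives the
    coordinatewise limit; this yields square-summability and the norm bound at once.\<close>
  have main: "coef (Ell2 (\<lambda>x. coef (X n) x - f x)) = (\<lambda>x. coef (X n) x - f x) \<and>
      norm (Ell2 (\<lambda>x. coef (X n) x - f x)) \<le> e"
    if e: "e > 0" and M: "\<forall>m\<ge>M. \<forall>n\<ge>M. norm (X m - X n) < e" and n: "n \<ge> M" for e M n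
  proof -
    have "(\<Sum>x\<in>F. (cmod (coef (X n) x - f x))\<^sup>2) \<le> e\<^sup>2" if F: "finite F" for F
    proof (rule tendsto_upperbound)
      show "((\<lambda>m. \<Sum>x\<in>F. (cmod (coef (X n) x - coef (X m) x))\<^sup>2) \<longlonglongrightarrow> (\<Sum>x\<in>F. (cmod (coef (X n) x - f x))\<^sup>2))"
        using f by (intro tendsto_intros)
      show "\<forall>\<^sub>F m in sequentially. (\<Sum>x\<in>F. (cmod (coef (X n) x - coef (X m) x))\<^sup>2) \<le> e\<^sup>2"
        using eventually_ge_at_top[of M]
      proof eventually_elim
        case (elim m)
        have "(\<Sum>x\<in>F. (cmod (coef (X n) x - coef (X m) x))\<^sup>2) \<le> (norm (X n - X m))\<^sup>2"
          using norm_ell2_finite[OF F, of "X n - X m"] by (simp add: coef_diff)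
        also have "\<dots> \<le> e\<^sup>2" using M n elim by (intro power_mono) (auto simp: less_imp_le)
        finally show ?case .
      qed
    qed simp
    then show ?thesis using ell2_bounded[of "\<lambda>x. coef (X n) x - f x" e] e by auto
  qed
  obtain M where M: "\<forall>m\<ge>M. \<forall>n\<ge>M. norm (X m - X n) < 1" using X CauchyD[of X 1] by auto
  \<comment> \<open>Square-summability is known for \<open>X M - f\<close> and not yet for
    \<open>f\<close>, so the limit is obtained by subtraction.\<close>
  define L where "L = X M - Ell2 (\<lambda>x. coef (X M) x - f x)"
  have cL: "coef L x = f x" for x
    using main[OF _ M, of M] by (simp add: L_def coef_diff)
  have "X \<longlonglongrightarrow> L"
  proof (rule LIMSEQ_I)
    fix r :: real assume r: "0 < r"
    then obtain M where M: "\<forall>m\<ge>M. \<forall>n\<ge>M. norm (X m - X n) < r / 2" using X CauchyD[of X "r / 2"] by auto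
    have "norm (X n - L) < r" if "n \<ge> M" for n
    proof -
      have "X n - L = Ell2 (\<lambda>x. coef (X n) x - f x)"
        using main[OF _ M that] r by (intro ell2_eqI) (simp add: coef_diff cL)
      then show ?thesis using main[OF _ M that] r by simp
    qed
    then show "\<exists>no. \<forall>n\<ge>no. norm (X n - L) < r" by blast
  qed
  then show "convergent X" by (auto simp: convergent_def)
qed

section \<open>Orthogonal projection onto a closed subspace\<close>

text \<open>The nearest point of \<open>S\<close> does it: completeness makes a minimising sequence
  converge, and minimality along every line in \<open>S\<close> forces orthogonality.\<close>

lemma orthogonal_decomposition:
  fixes x :: "'a :: {real_inner, complete_space}"
  assumes S: "subspace S" "closed S"
  obtains p where "p \<in> S" "\<And>z. z \<in> S \<Longrightarrow> inner (x - p) z = 0"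
proof -
  have ne: "S \<noteq> {}" using S(1) subspace_0 by blast
  define d where "d = infdist x S"
  have d0: "0 \<le> d" by (simp add: d_def infdist_nonneg)
  have dle: "d \<le> norm (x - s)" if "s \<in> S" for s
    using infdist_le[OF that, of x] by (simp add: d_def dist_norm)
  \<comment> \<open>The slack is put on the squared distance, the quantity that occurs in the
    parallelogram law.\<close>
  have "\<exists>s\<in>S. (norm (x - s))\<^sup>2 < d\<^sup>2 + inverse (real (Suc n))" for n
  proof -
    have "d < sqrt (d\<^sup>2 + inverse (real (Suc n)))"
      using d0 by (intro real_less_rsqrt) auto
    then obtain s where s: "s \<in> S" "dist x s < sqrt (d\<^sup>2 + inverse (real (Suc n)))"
      using ne cINF_less_iff[of S "dist x"] unfolding d_def infdist_def
      by (auto simp: bdd_below_def intro: zero_le_dist)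
    then have "(norm (x - s))\<^sup>2 < (sqrt (d\<^sup>2 + inverse (real (Suc n))))\<^sup>2"
      by (intro power_strict_mono) (auto simp: dist_norm)
    then show ?thesis using s(1) d0 by (intro bexI[of _ s]) (auto simp: add_nonneg_nonneg)
  qed
  then obtain s where s: "\<And>n. s n \<in> S" "\<And>n. (norm (x - s n))\<^sup>2 < d\<^sup>2 + inverse (real (Suc n))" by metis
  \<comment> \<open>Parallelogram law: the midpoint of \<open>s m\<close> and \<open>s n\<close>
    lies in \<open>S\<close>, so its distance to \<open>x\<close> is at least
    \<open>d\<close>.\<close>
  have par: "(norm (s m - s n))\<^sup>2 \<le> 2 * inverse (real (Suc m)) + 2 * inverse (real (Suc n))" for m n
  proof -
    have "(1/2) *\<^sub>R (s m + s n) \<in> S" using S(1) s(1) by (simp add: subspace_add subspace_scale)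
    then have "d\<^sup>2 \<le> (norm (x - (1/2) *\<^sub>R (s m + s n)))\<^sup>2" using dle d0 by (simp add: power_mono)
    moreover have "(norm (s m - s n))\<^sup>2 + 4 * (norm (x - (1/2) *\<^sub>R (s m + s n)))\<^sup>2
       = 2 * (norm (x - s m))\<^sup>2 + 2 * (norm (x - s n))\<^sup>2"
      by (simp add: power2_norm_eq_inner algebra_simps inner_commute)
    ultimately show ?thesis using s(2)[of m] s(2)[of n] by linarith
  qed
  have "Cauchy s"
  proof (rule CauchyI)
    fix e :: real assume e: "0 < e"
    obtain M where M: "inverse (real (Suc M)) < e\<^sup>2 / 4" using reals_Archimedean[of "e\<^sup>2 / 4"] e by auto
    have "norm (s m - s n) < e" if "m \<ge> M" "n \<ge> M" for m n
    proof -
      have "inverse (real (Suc m)) \<le> inverse (real (Suc M))" "inverse (real (Suc n)) \<le> inverse (real (Suc M))"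
        using that by (auto intro!: le_imp_inverse_le)
      then have "(norm (s m - s n))\<^sup>2 < e\<^sup>2" using par[of m n] M by linarith
      then show ?thesis using e by (simp add: power_less_imp_less_base)
    qed
    then show "\<exists>M. \<forall>m\<ge>M. \<forall>n\<ge>M. norm (s m - s n) < e" by blast
  qed
  then obtain p where p: "s \<longlonglongrightarrow> p" using Cauchy_convergent_iff convergent_def by blast
  have pS: "p \<in> S" using S(2) s(1) p closed_sequentially by blast
  have "(norm (x - p))\<^sup>2 \<le> d\<^sup>2"
  proof (rule LIMSEQ_le)
    show "(\<lambda>n. (norm (x - s n))\<^sup>2) \<longlonglongrightarrow> (norm (x - p))\<^sup>2" using p by (intro tendsto_intros)
    show "(\<lambda>n. d\<^sup>2 + inverse (real (Suc n))) \<longlonglongrightarrow> d\<^sup>2"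
      using tendsto_add[OF tendsto_const LIMSEQ_inverse_real_of_nat, of "d\<^sup>2"] by simp
    show "\<exists>N. \<forall>n\<ge>N. (norm (x - s n))\<^sup>2 \<le> d\<^sup>2 + inverse (real (Suc n))" using s(2) less_imp_le by blast
  qed
  then have pmin: "norm (x - p) \<le> norm (x - z)" if "z \<in> S" for z
    using dle[OF that] d0 power2_le_imp_le by fastforce
  have "inner (x - p) z = 0" if z: "z \<in> S" for z
  proof (cases "z = 0")
    case False
    \<comment> \<open>The minimiser of the quadratic function t -> |x - p - t z|^2.\<close>
    define t where "t = inner (x - p) z / inner z z"
    have "p + t *\<^sub>R z \<in> S" using S(1) pS z by (simp add: subspace_add subspace_scale)
    then have "(norm (x - p))\<^sup>2 \<le> (norm (x - (p + t *\<^sub>R z)))\<^sup>2" using pmin by (simp add: power_mono)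
    also have "\<dots> = (norm (x - p))\<^sup>2 - 2 * t * inner (x - p) z + t\<^sup>2 * inner z z"
      by (simp only: power2_norm_eq_inner) (simp add: algebra_simps inner_commute power2_eq_square)
    also have "\<dots> = (norm (x - p))\<^sup>2 - (inner (x - p) z)\<^sup>2 / inner z z"
      using False by (simp add: t_def field_simps power2_eq_square)
    finally have "(inner (x - p) z)\<^sup>2 / inner z z \<le> 0" by simp
    then have "(inner (x - p) z)\<^sup>2 \<le> 0" using False
      by (metis inner_gt_zero_iff divide_le_0_iff less_le_not_le)
    then show ?thesis by simp
  qed simp
  then show thesis using pS that by blast
qed

section \<open>Complex scalars, basis vectors and the complex inner product\<close>

definition cscale :: "complex \<Rightarrow> 'a ell2 \<Rightarrow> 'a ell2" where
  "cscale c f = Ell2 (\<lambda>x. c * coef f x)"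

definition delta :: "'a \<Rightarrow> 'a ell2" where
  "delta a = Ell2 (\<lambda>x. if x = a then 1 else 0)"

lemma coef_cscale: "coef (cscale c f) x = c * coef f x"
  by (simp add: cscale_def coef_Ell2 sqsum_scale coef_summable)

lemma sqsum_finite:
  assumes "finite S" "\<And>x. x \<notin> S \<Longrightarrow> f x = 0"
  shows "(\<lambda>x. (cmod (f x))\<^sup>2) summable_on A"
proof -
  have "(\<lambda>x. (cmod (f x))\<^sup>2) summable_on S \<inter> A" using assms(1) by simp
  moreover have "(\<lambda>x. (cmod (f x))\<^sup>2) summable_on S \<inter> A \<longleftrightarrow> (\<lambda>x. (cmod (f x))\<^sup>2) summable_on A"
    using assms(2) by (intro summable_on_cong_neutral) auto
  ultimately show ?thesis by blast
qed

lemma coef_delta: "coef (delta a) x = (if x = a then 1 else 0)"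
  unfolding delta_def by (subst coef_Ell2) (auto intro!: sqsum_finite[of "{a}"] split: if_splits)

lemma cinner_delta: "cinner f (delta a) = coef f a"
proof -
  have "cinner f (delta a) = (\<Sum>\<^sub>\<infinity>x\<in>{a}. coef f x)"
    unfolding cinner_def by (rule infsum_cong_neutral) (auto simp: coef_delta)
  then show ?thesis by simp
qed

lemma cinner_commute: "cinner g f = cnj (cinner f g)"
  unfolding cinner_def by (subst infsum_cnj[symmetric]) (simp add: mult.commute)

lemma cinner_add: "cinner (f + g) h = cinner f h + cinner g h"
  unfolding cinner_def by (simp add: coef_add distrib_right infsum_add cinner_summable)

lemma cinner_cscale: "cinner (cscale c f) h = c * cinner f h"
  unfolding cinner_def by (simp add: coef_cscale mult.assoc infsum_cmult_right')

lemma cinner_diff: "cinner (f - g) h = cinner f h - cinner g h"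
  using cinner_add[of "f - g" g h] by simp

text \<open>Upgrades the real orthogonality of \<open>orthogonal_decomposition\<close> to complex
  orthogonality, for subspaces closed under multiplication by \<open>\<i>\<close>.\<close>

lemma cinner_eq_0_iff:
  "cinner f g = 0 \<longleftrightarrow> inner f g = 0 \<and> inner f (cscale \<i> g) = 0"
proof -
  have "cinner f (cscale \<i> g) = - \<i> * cinner f g"
    using cinner_cscale[of \<i> g f] by (simp add: cinner_commute[of f])
  then show ?thesis by (auto simp: inner_ell2_def complex_eq_iff)
qed

section \<open>Operators given by bounded kernels\<close>

text \<open>Testing the form against the conjugate of v = K \<xi> gives |v|^2 \<le> C |\<xi>| |v|,
  and |v| cancels.\<close>

lemma kernel_bounded_finite:
  assumes K: "kernel_bounded K C" and F: "finite F" "finite F'"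
  shows "(\<Sum>s\<in>F. (cmod (\<Sum>t\<in>F'. K s t * \<xi> t))\<^sup>2) \<le> (C * L2_set (\<lambda>t. cmod (\<xi> t)) F')\<^sup>2"
proof -
  define v where "v s = (\<Sum>t\<in>F'. K s t * \<xi> t)" for s
  define S where "S = (\<Sum>s\<in>F. (cmod (v s))\<^sup>2)"
  have S0: "0 \<le> S" by (simp add: S_def sum_nonneg)
  have "(\<Sum>s\<in>F. \<Sum>t\<in>F'. K s t * \<xi> t * cnj (v s)) = (\<Sum>s\<in>F. v s * cnj (v s))"
    by (simp add: v_def sum_distrib_right)
  also have "\<dots> = of_real S"
    by (simp add: S_def complex_norm_square del: of_real_power)
  finally have "cmod (of_real S) \<le> C * L2_set (\<lambda>t. cmod (\<xi> t)) F' * L2_set (\<lambda>s. cmod (cnj (v s))) F"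
    using kbdD[OF K F, of \<xi> "\<lambda>s. cnj (v s)"] by simp
  moreover have "L2_set (\<lambda>s. cmod (cnj (v s))) F = sqrt S" by (simp add: S_def L2_set_def)
  ultimately have "S \<le> C * L2_set (\<lambda>t. cmod (\<xi> t)) F' * sqrt S"
    using S0 by (simp only: norm_of_real abs_of_nonneg)
  then have "sqrt S * sqrt S \<le> C * L2_set (\<lambda>t. cmod (\<xi> t)) F' * sqrt S" using S0 by simp
  then have "sqrt S \<le> C * L2_set (\<lambda>t. cmod (\<xi> t)) F'"
  proof (cases "S = 0")
    case False
    then have "0 < sqrt S" using S0 by simp
    with \<open>sqrt S * sqrt S \<le> _\<close> show ?thesis by (rule mult_right_le_imp_le)
  qed (use kernel_bounded_nonneg[OF K] in \<open>simp add: L2_set_nonneg\<close>)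
  then have "(sqrt S)\<^sup>2 \<le> (C * L2_set (\<lambda>t. cmod (\<xi> t)) F')\<^sup>2" using S0 by (intro power_mono) auto
  then show ?thesis using S0 by (simp add: S_def v_def)
qed

text \<open>Applying row \<open>s\<close> to its own conjugate gives S^2 \<le> C^2 S for each finite
  part S of its square sum. Square-summable rows make the series in \<open>kernel_op\<close>
  converge.\<close>

lemma kernel_bounded_row:
  fixes K :: "'s \<Rightarrow> 't \<Rightarrow> complex"
  assumes K: "kernel_bounded K C"
  shows "(\<lambda>t. (cmod (K s t))\<^sup>2) summable_on UNIV"
proof (rule sqsum_bounded)
  fix F :: "'t set" assume F: "finite F"
  define S where "S = (\<Sum>t\<in>F. (cmod (K s t))\<^sup>2)"
  have S0: "0 \<le> S" by (simp add: S_def sum_nonneg)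
  have "(\<Sum>r\<in>{s}. (cmod (\<Sum>t\<in>F. K r t * cnj (K s t)))\<^sup>2) \<le> (C * L2_set (\<lambda>t. cmod (cnj (K s t))) F)\<^sup>2"
    by (rule kernel_bounded_finite[OF K _ F]) simp
  moreover have "(\<Sum>t\<in>F. K s t * cnj (K s t)) = of_real S"
    by (simp add: S_def complex_norm_square del: of_real_power)
  ultimately have "S * S \<le> C\<^sup>2 * S" using S0
    by (simp add: power2_eq_square[of S, symmetric] power_mult_distrib L2_set_def S_def[symmetric])
  then show "S \<le> C\<^sup>2" using S0 by (cases "S = 0") auto
qed

definition kernel_op :: "('s \<Rightarrow> 't \<Rightarrow> complex) \<Rightarrow> 't ell2 \<Rightarrow> 's ell2" where
  "kernel_op K f = Ell2 (\<lambda>s. \<Sum>\<^sub>\<infinity>t. K s t * coef f t)"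

lemma kernel_op_summable:
  assumes "kernel_bounded K C"
  shows "(\<lambda>t. K s t * coef f t) summable_on UNIV"
  using sqsum_mult[OF kernel_bounded_row[OF assms] coef_summable] by (rule abs_summable_summable)

text \<open>With the finite set of rows held fixed, the estimate over finite sets of columns passes
  to the limit.\<close>

lemma kernel_op_bound:
  assumes K: "kernel_bounded K C" and F: "finite F"
  shows "(\<Sum>s\<in>F. (cmod (\<Sum>\<^sub>\<infinity>t. K s t * coef f t))\<^sup>2) \<le> (C * norm f)\<^sup>2"
proof (rule tendsto_upperbound)
  show "((\<lambda>F'. \<Sum>s\<in>F. (cmod (\<Sum>t\<in>F'. K s t * coef f t))\<^sup>2) \<longlongrightarrow>
      (\<Sum>s\<in>F. (cmod (\<Sum>\<^sub>\<infinity>t. K s t * coef f t))\<^sup>2)) (finite_subsets_at_top UNIV)"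
    by (intro tendsto_intros infsum_tendsto kernel_op_summable[OF K])
  show "\<forall>\<^sub>F F' in finite_subsets_at_top UNIV. (\<Sum>s\<in>F. (cmod (\<Sum>t\<in>F'. K s t * coef f t))\<^sup>2) \<le> (C * norm f)\<^sup>2"
  proof (rule eventually_mono[of finite])
    show "eventually finite (finite_subsets_at_top UNIV)"
      by (rule eventually_finite_subsets_at_top_weakI) simp
    fix F' :: "'b set" assume F': "finite F'"
    have "(\<Sum>s\<in>F. (cmod (\<Sum>t\<in>F'. K s t * coef f t))\<^sup>2) \<le> (C * L2_set (\<lambda>t. cmod (coef f t)) F')\<^sup>2"
      by (rule kernel_bounded_finite[OF K F F'])
    also have "\<dots> \<le> (C * norm f)\<^sup>2"
    proof -
      have "L2_set (\<lambda>t. cmod (coef f t)) F' \<le> norm f"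
        using norm_ell2_finite[OF F', of f] unfolding L2_set_def
        by (intro real_le_lsqrt) (auto intro: sum_nonneg)
      then show ?thesis using kernel_bounded_nonneg[OF K]
        by (simp add: power_mono mult_left_mono)
    qed
    finally show "(\<Sum>s\<in>F. (cmod (\<Sum>t\<in>F'. K s t * coef f t))\<^sup>2) \<le> (C * norm f)\<^sup>2" .
  qed
qed simp

lemma kernel_op:
  assumes K: "kernel_bounded K C"
  shows coef_kernel_op: "coef (kernel_op K f) s = (\<Sum>\<^sub>\<infinity>t. K s t * coef f t)"
    and norm_kernel_op: "norm (kernel_op K f) \<le> C * norm f"
  using ell2_bounded[of "\<lambda>s. \<Sum>\<^sub>\<infinity>t. K s t * coef f t" "C * norm f"] kernel_op_bound[OF K] kernel_bounded_nonneg[OF K]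
  by (auto simp: kernel_op_def)

lemma kernel_op_bounded_linear:
  fixes K :: "'s \<Rightarrow> 't \<Rightarrow> complex"
  assumes K: "kernel_bounded K C"
  shows "bounded_linear (kernel_op K)"
proof (rule bounded_linear_intro[where K=C])
  fix f g :: "'t ell2" and r :: real
  show "kernel_op K (f + g) = kernel_op K f + kernel_op K g"
    by (rule ell2_eqI) (simp add: coef_kernel_op[OF K] coef_add distrib_left infsum_add kernel_op_summable[OF K])
  show "kernel_op K (r *\<^sub>R f) = r *\<^sub>R kernel_op K f"
    by (rule ell2_eqI) (simp add: coef_kernel_op[OF K] coef_scaleR mult.left_commute infsum_cmult_right')
  show "norm (kernel_op K f) \<le> norm f * C" using norm_kernel_op[OF K, of f] by (simp add: mult.commute)
qed

lemma kernel_op_cscale: "kernel_bounded K C \<Longrightarrow> kernel_op K (cscale c f) = cscale c (kernel_op K f)"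
  by (rule ell2_eqI) (simp add: coef_kernel_op coef_cscale mult.left_commute infsum_cmult_right')

lemma infsum_single:
  fixes f :: "'a \<Rightarrow> 'b :: {comm_monoid_add, t2_space}"
  assumes "\<And>x. x \<noteq> a \<Longrightarrow> f x = 0"
  shows "infsum f UNIV = f a"
proof -
  have "infsum f UNIV = infsum f {a}" by (rule infsum_cong_neutral) (auto simp: assms)
  then show ?thesis by simp
qed

lemma coef_kernel_op_delta: "kernel_bounded K C \<Longrightarrow> coef (kernel_op K (delta t)) s = K s t"
  by (subst coef_kernel_op) (auto simp: coef_delta infsum_single[of t])

lemma norm_cscale: "norm (cscale c f) = cmod c * norm f"
proof -
  have "(norm (cscale c f))\<^sup>2 = (cmod c * norm f)\<^sup>2"
    unfolding power_mult_distrib norm_ell2_sq coef_cscale norm_mult by (rule infsum_cmult_right')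
  then show ?thesis by simp
qed

lemma bounded_linear_cscale: "bounded_linear (cscale c)"
  by (rule bounded_linear_intro[where K="cmod c"])
    (auto intro!: ell2_eqI simp: coef_cscale coef_add coef_scaleR algebra_simps norm_cscale)

lemma coef_bounded_linear: "bounded_linear (\<lambda>f. coef f x)"
proof (rule bounded_linear_intro[where K=1])
  show "cmod (coef f x) \<le> norm f * 1" for f using coef_le_norm[of f x] by simp
qed (auto simp: coef_add coef_scaleR scaleR_conv_of_real)

lemma coef_sum: "coef (\<Sum>i\<in>I. f i) x = (\<Sum>i\<in>I. coef (f i) x)"
  by (induction I rule: infinite_finite_induct) (auto simp: coef_zero coef_add)

lemma ell2_has_sum: "((\<lambda>t. cscale (coef f t) (delta t)) has_sum f) UNIV"
  unfolding has_sum_def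
proof (rule tendstoI)
  fix e :: real assume e: "0 < e"
  let ?n = "\<lambda>x. (cmod (coef f x))\<^sup>2"
  have "\<forall>\<^sub>F F in finite_subsets_at_top UNIV. dist (sum ?n F) (infsum ?n UNIV) < e\<^sup>2"
    using infsum_tendsto[OF coef_summable[of f]] e by (intro tendstoD) auto
  moreover have "\<forall>\<^sub>F F in finite_subsets_at_top UNIV. finite (F :: 'a set)"
    by (rule eventually_finite_subsets_at_top_weakI) simp
  ultimately show "\<forall>\<^sub>F F in finite_subsets_at_top UNIV. dist (\<Sum>t\<in>F. cscale (coef f t) (delta t)) f < e"
  proof eventually_elim
    case (elim F)
    let ?d = "f - (\<Sum>t\<in>F. cscale (coef f t) (delta t))"
    have c: "coef ?d x = (if x \<in> F then 0 else coef f x)" for x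
      using elim(2) by (simp add: coef_diff coef_sum coef_cscale coef_delta if_distrib cong: if_cong)
    have "(norm ?d)\<^sup>2 = infsum ?n (- F)"
      unfolding norm_ell2_sq c by (rule infsum_cong_neutral) auto
    moreover have "infsum ?n UNIV = infsum ?n F + infsum ?n (- F)"
      using infsum_Un_disjoint[of ?n F "- F"] summable_on_subset_banach[OF coef_summable[of f]] by auto
    ultimately have "(norm ?d)\<^sup>2 < e\<^sup>2" using elim by (simp add: dist_real_def)
    then have "norm ?d < e" using e by (simp add: power_less_imp_less_base)
    then show ?case by (simp add: dist_norm norm_minus_commute)
  qed
qed

text \<open>The expansion in basis vectors converges in norm. As \<open>bounded_linear\<close>
  speaks of real scalars only, compatibility with \<open>cscale\<close> is a separate
  assumption.\<close>

lemma bounded_linear_eq_on_support: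
  assumes "bounded_linear A" "bounded_linear B"
    and "\<And>c f. A (cscale c f) = cscale c (A f)" "\<And>c f. B (cscale c f) = cscale c (B f)"
    and delta: "\<And>t. t \<in> I \<Longrightarrow> A (delta t) = B (delta t)" and f: "\<And>t. t \<notin> I \<Longrightarrow> coef f t = 0"
  shows "A f = B f"
proof -
  have "A (cscale (coef f t) (delta t)) = B (cscale (coef f t) (delta t))" for t
    using assms(3,4) delta f[of t] linear_0[OF bounded_linear.linear[OF assms(1)]]
      linear_0[OF bounded_linear.linear[OF assms(2)]]
    by (cases "t \<in> I") (auto simp: cscale_def zero_ell2_def[symmetric])
  then show ?thesis
    using has_sum_bounded_linear[OF assms(1) ell2_has_sum[of f]]
      has_sum_bounded_linear[OF assms(2) ell2_has_sum[of f]] has_sum_unique by auto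
qed

text \<open>The source of the translations: moving the columns of the identity along
  \<open>t \<mapsto> g t\<close> gives their permutation matrices.\<close>

lemma kernel_bounded_one: "kernel_bounded (\<lambda>s t. if s = t then 1 else 0) 1"
proof (rule kbdI)
  fix F F' :: "'a set" and \<xi> \<eta> :: "'a \<Rightarrow> complex" assume F: "finite F" "finite F'"
  have "(\<Sum>s\<in>F. \<Sum>t\<in>F'. (if s = t then 1 else 0) * \<xi> t * \<eta> s) = (\<Sum>s\<in>F. if s \<in> F' then \<xi> s * \<eta> s else 0)"
    using F by (intro sum.cong refl) (simp add: if_distrib[of "\<lambda>x. x * _"] cong: if_cong)
  also have "\<dots> = (\<Sum>s\<in>F \<inter> F'. \<xi> s * \<eta> s)"
    using F by (simp add: sum.inter_restrict)
  finally have "cmod (\<Sum>s\<in>F. \<Sum>t\<in>F'. (if s = t then 1 else 0) * \<xi> t * \<eta> s)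
      \<le> (\<Sum>s\<in>F \<inter> F'. \<bar>cmod (\<xi> s)\<bar> * \<bar>cmod (\<eta> s)\<bar>)"
    by (simp add: norm_sum[THEN order_trans] norm_mult sum_norm_le)
  also have "\<dots> \<le> L2_set (\<lambda>t. cmod (\<xi> t)) (F \<inter> F') * L2_set (\<lambda>t. cmod (\<eta> t)) (F \<inter> F')"
    by (rule L2_set_mult_ineq)
  also have "\<dots> \<le> L2_set (\<lambda>t. cmod (\<xi> t)) F' * L2_set (\<lambda>t. cmod (\<eta> t)) F"
    using F unfolding L2_set_def
    by (intro mult_mono real_sqrt_le_mono sum_mono2) (auto intro: sum_nonneg)
  finally show "cmod (\<Sum>s\<in>F. \<Sum>t\<in>F'. (if s = t then 1 else 0) * \<xi> t * \<eta> s)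
      \<le> 1 * L2_set (\<lambda>t. cmod (\<xi> t)) F' * L2_set (\<lambda>s. cmod (\<eta> s)) F" by simp
qed simp

section \<open>Bounded convolvers lie in the strong closure of the translations\<close>

definition conv_kernel :: "('a, 'b) monoid_scheme \<Rightarrow> ('a \<Rightarrow> complex) \<Rightarrow> 'a \<Rightarrow> 'a \<Rightarrow> complex" where
  "conv_kernel G x s t = (if s \<in> carrier G \<and> t \<in> carrier G then x (s \<otimes>\<^bsub>G\<^esub> inv\<^bsub>G\<^esub> t) else 0)"

text \<open>The convolver acting on each member of a family indexed by \<open>'i\<close>. A strong
  neighbourhood tests finitely many vectors, and amplification turns them into one vector.\<close>

definition ampl_kernel :: "('a, 'b) monoid_scheme \<Rightarrow> ('a \<Rightarrow> complex) \<Rightarrow> 'i \<times> 'a \<Rightarrow> 'i \<times> 'a \<Rightarrow> complex" where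
  "ampl_kernel G x p q = (if fst p = fst q then conv_kernel G x (snd p) (snd q) else 0)"

lemma kernel_bounded_ampl_kernel:
  assumes "kernel_bounded (conv_kernel G x) C"
  shows "kernel_bounded (ampl_kernel G x) C"
proof (rule kernel_bounded_blocks[where \<alpha>=fst and \<beta>=fst])
  show "fst s = fst t" if "ampl_kernel G x s t \<noteq> 0" for s t :: "'c \<times> 'a"
    using that by (auto simp: ampl_kernel_def split: if_splits)
  show "kernel_bounded (\<lambda>s t. if fst s = v \<and> fst t = v then ampl_kernel G x s t else 0) C" for v :: 'c
    by (rule kernel_bounded_reindex[OF assms, of snd "{p. fst p = v}" snd "{p. fst p = v}"])
      (auto simp: inj_on_def ampl_kernel_def)
qed (use kernel_bounded_nonneg[OF assms] in simp)

definition ampl_trans :: "('a, 'b) monoid_scheme \<Rightarrow> 'a \<Rightarrow> ('i \<times> 'a) ell2 \<Rightarrow> ('i \<times> 'a) ell2" where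
  "ampl_trans G g = kernel_op (ampl_kernel G (\<lambda>y. if y = g then 1 else 0))"

context group
begin

lemma inv_mult_cancel:
  assumes "x \<in> carrier G" "y \<in> carrier G"
  shows "inv x \<otimes> (x \<otimes> y) = y" "x \<otimes> (inv x \<otimes> y) = y"
  using assms by (simp_all add: m_assoc[symmetric])

lemma mult_inv_eq_iff: "x \<in> carrier G \<Longrightarrow> y \<in> carrier G \<Longrightarrow> g \<in> carrier G \<Longrightarrow> x \<otimes> inv y = g \<longleftrightarrow> x = g \<otimes> y"
  using inv_solve_right by metis

lemma kernel_bounded_translation: "g \<in> carrier G \<Longrightarrow> kernel_bounded (ampl_kernel G (\<lambda>y. if y = g then 1 else 0)) 1"
  by (intro kernel_bounded_ampl_kernel kernel_bounded_reindex[OF kernel_bounded_one, of id "carrier G" "\<lambda>t. g \<otimes> t" "carrier G"])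
    (auto simp: conv_kernel_def mult_inv_eq_iff inj_on_def)

lemma coef_ampl_trans:
  assumes "g \<in> carrier G"
  shows "coef (ampl_trans G g f) (i, s) = (if s \<in> carrier G then coef f (i, inv g \<otimes> s) else 0)"
proof -
  have "s \<otimes> inv t = g \<longleftrightarrow> t = inv g \<otimes> s" if "s \<in> carrier G" "t \<in> carrier G" for t
    using that assms mult_inv_eq_iff inv_solve_left by metis
  then have "coef (ampl_trans G g f) (i, s) = (\<Sum>\<^sub>\<infinity>q. if s \<in> carrier G \<and> q = (i, inv g \<otimes> s) then coef f q else 0)"
    unfolding ampl_trans_def coef_kernel_op[OF kernel_bounded_translation[OF assms]]
    using assms by (intro infsum_cong) (auto simp: ampl_kernel_def conv_kernel_def)
  also have "\<dots> = (if s \<in> carrier G then coef f (i, inv g \<otimes> s) else 0)"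
    by (subst infsum_single[of "(i, inv g \<otimes> s)"]) auto
  finally show ?thesis .
qed

lemma bounded_linear_ampl_trans: "g \<in> carrier G \<Longrightarrow> bounded_linear (ampl_trans G g)"
  unfolding ampl_trans_def by (rule kernel_op_bounded_linear[OF kernel_bounded_translation])

lemma ampl_trans_cscale: "g \<in> carrier G \<Longrightarrow> ampl_trans G g (cscale c f) = cscale c (ampl_trans G g f)"
  unfolding ampl_trans_def by (rule kernel_op_cscale[OF kernel_bounded_translation])

lemma ampl_trans_ampl_trans: "g \<in> carrier G \<Longrightarrow> h \<in> carrier G \<Longrightarrow> ampl_trans G g (ampl_trans G h f) = ampl_trans G (g \<otimes> h) f"
  by (intro ell2_eqI) (auto simp: coef_ampl_trans inv_mult_group m_assoc)

lemma ampl_trans_delta: "g \<in> carrier G \<Longrightarrow> t \<in> carrier G \<Longrightarrow> ampl_trans G g (delta (j, t)) = delta (j, g \<otimes> t)"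
  by (intro ell2_eqI) (auto simp: coef_ampl_trans coef_delta inv_solve_left' m_assoc[symmetric] split: if_splits)

text \<open>Translations permute the coordinates over the carrier and annihilate all others, so the
  substitution \<open>s \<mapsto> g s\<close> is carried out over the carrier only.\<close>

lemma cinner_ampl_trans:
  assumes g: "g \<in> carrier G"
  shows "cinner (ampl_trans G g f) h = cinner f (ampl_trans G (inv g) h)"
proof -
  let ?C = "UNIV \<times> carrier G" and ?\<theta> = "\<lambda>(i, s). (i, g \<otimes> s)"
  have b: "bij_betw ?\<theta> ?C ?C"
    using g by (intro bij_betwI[where g="\<lambda>(i, s). (i, inv g \<otimes> s)"]) (auto simp: m_assoc[symmetric])
  have "cinner (ampl_trans G g f) h = (\<Sum>\<^sub>\<infinity>p\<in>?C. coef (ampl_trans G g f) p * cnj (coef h p))"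
    unfolding cinner_def using g by (intro infsum_cong_neutral) (auto simp: coef_ampl_trans split: if_splits)
  also have "\<dots> = (\<Sum>\<^sub>\<infinity>p\<in>?C. coef (ampl_trans G g f) (?\<theta> p) * cnj (coef h (?\<theta> p)))"
    by (rule infsum_reindex_bij_betw[OF b, symmetric])
  also have "\<dots> = (\<Sum>\<^sub>\<infinity>p\<in>?C. coef f p * cnj (coef (ampl_trans G (inv g) h) p))"
    using g by (intro infsum_cong) (auto simp: coef_ampl_trans m_assoc[symmetric])
  also have "\<dots> = cinner f (ampl_trans G (inv g) h)"
    unfolding cinner_def using g by (intro infsum_cong_neutral) (auto simp: coef_ampl_trans split: if_splits)
  finally show ?thesis .
qed

text \<open>The projection \<open>P\<close> onto the closed span \<open>M\<close> of the translates of \<open>\<Xi>\<close> commutes with translations, so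
  its matrix is that of a right convolver and it commutes with the left convolution \<open>T\<close>; then
  \<open>T \<Xi> = T (P \<Xi>) = P (T \<Xi>) \<in> M\<close>.\<close>
theorem convolver_in_closure:
  fixes \<Xi> :: "('i \<times> 'a) ell2"
  assumes x: "kernel_bounded (conv_kernel G x) C" and \<Xi>: "\<And>i s. s \<notin> carrier G \<Longrightarrow> coef \<Xi> (i, s) = 0"
  shows "kernel_op (ampl_kernel G x) \<Xi> \<in> closure {\<Sum>g\<in>F. cscale (c g) (ampl_trans G g \<Xi>) | F c. finite F \<and> F \<subseteq> carrier G}"
    (is "_ \<in> closure ?W")
proof -
  define W where "W = ?W"
  have WI: "(\<Sum>g\<in>F. cscale (c g) (ampl_trans G g \<Xi>)) \<in> W" if "finite F" "F \<subseteq> carrier G" for F c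
    using that unfolding W_def by blast
  have W_cscale: "cscale a w \<in> W" if w: "w \<in> W" for a w
  proof -
    obtain F c where F: "finite F" "F \<subseteq> carrier G" and w: "w = (\<Sum>g\<in>F. cscale (c g) (ampl_trans G g \<Xi>))"
      using w unfolding W_def by blast
    have "cscale a w = (\<Sum>g\<in>F. cscale (a * c g) (ampl_trans G g \<Xi>))"
      by (rule ell2_eqI) (simp add: w coef_cscale coef_sum sum_distrib_left mult.assoc)
    then show ?thesis using WI[OF F] by simp
  qed
  have W_add: "v + w \<in> W" if v: "v \<in> W" and w: "w \<in> W" for v w
  proof -
    obtain F c where F: "finite F" "F \<subseteq> carrier G" and v: "v = (\<Sum>g\<in>F. cscale (c g) (ampl_trans G g \<Xi>))"
      using v unfolding W_def by blast
    obtain F' c' where F': "finite F'" "F' \<subseteq> carrier G" and w: "w = (\<Sum>g\<in>F'. cscale (c' g) (ampl_trans G g \<Xi>))"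
      using w unfolding W_def by blast
    let ?c = "\<lambda>g. (if g \<in> F then c g else 0) + (if g \<in> F' then c' g else 0)"
    have "v + w = (\<Sum>g\<in>F \<union> F'. cscale (?c g) (ampl_trans G g \<Xi>))"
    proof (rule ell2_eqI)
      fix p
      have 1: "(\<Sum>g\<in>F. c g * coef (ampl_trans G g \<Xi>) p) = (\<Sum>g\<in>F \<union> F'. (if g \<in> F then c g else 0) * coef (ampl_trans G g \<Xi>) p)"
        using F F' by (intro sum.mono_neutral_cong_left) auto
      have 2: "(\<Sum>g\<in>F'. c' g * coef (ampl_trans G g \<Xi>) p) = (\<Sum>g\<in>F \<union> F'. (if g \<in> F' then c' g else 0) * coef (ampl_trans G g \<Xi>) p)"
        using F F' by (intro sum.mono_neutral_cong_left) auto
      show "coef (v + w) p = coef (\<Sum>g\<in>F \<union> F'. cscale (?c g) (ampl_trans G g \<Xi>)) p"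
        by (simp add: v w coef_cscale coef_sum coef_add 1 2 distrib_right sum.distrib)
    qed
    then show ?thesis using WI[of "F \<union> F'" ?c] F F' by simp
  qed
  have W_ampl_trans: "ampl_trans G h w \<in> W" if h: "h \<in> carrier G" and w: "w \<in> W" for h w
  proof -
    obtain F c where F: "finite F" "F \<subseteq> carrier G" and w: "w = (\<Sum>g\<in>F. cscale (c g) (ampl_trans G g \<Xi>))"
      using w unfolding W_def by blast
    have "ampl_trans G h w = (\<Sum>g\<in>F. cscale (c g) (ampl_trans G (h \<otimes> g) \<Xi>))"
      unfolding w linear_sum[OF bounded_linear.linear[OF bounded_linear_ampl_trans[OF h]]]
      using F h by (intro sum.cong) (auto simp: ampl_trans_cscale ampl_trans_ampl_trans)
    also have "\<dots> = (\<Sum>g\<in>(\<lambda>g. h \<otimes> g) ` F. cscale (c (inv h \<otimes> g)) (ampl_trans G g \<Xi>))"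
      using F h by (subst sum.reindex) (auto simp: inj_on_def m_assoc[symmetric] subsetD intro!: sum.cong)
    finally show ?thesis using WI[of "(\<lambda>g. h \<otimes> g) ` F" "\<lambda>g. c (inv h \<otimes> g)"] F h by auto
  qed
  have W_supp: "coef w (i, s) = 0" if "w \<in> W" "s \<notin> carrier G" for w i s
    using that unfolding W_def by (auto simp: coef_sum coef_cscale coef_ampl_trans subset_iff intro!: sum.neutral)
  have \<Xi>W: "\<Xi> \<in> W"
  proof -
    have "\<Xi> = (\<Sum>g\<in>{\<one>}. cscale 1 (ampl_trans G g \<Xi>))"
      using \<Xi> by (intro ell2_eqI) (auto simp: coef_cscale coef_ampl_trans)
    then show ?thesis using WI[of "{\<one>}" "\<lambda>_. 1"] by simp
  qed
  define M where "M = closure W"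
  have M_image: "L f \<in> M" if "bounded_linear L" "\<And>w. w \<in> W \<Longrightarrow> L w \<in> W" "f \<in> M" for L f
    using closure_bounded_linear_image_subset[OF that(1), of W] closure_mono[of "L ` W" W] that(2,3)
    unfolding M_def by blast
  have M_cscale: "cscale a f \<in> M" if "f \<in> M" for a f
    using M_image[OF bounded_linear_cscale] W_cscale that by blast
  have M_ampl_trans: "ampl_trans G h f \<in> M" if "h \<in> carrier G" "f \<in> M" for h f
    using M_image[OF bounded_linear_ampl_trans] W_ampl_trans that by blast
  have M_supp: "coef f (i, s) = 0" if "f \<in> M" "s \<notin> carrier G" for f i s
  proof -
    obtain w where w: "\<And>n. w n \<in> W" "w \<longlonglongrightarrow> f" using \<open>f \<in> M\<close> unfolding M_def closure_sequential by blast
    have "(\<lambda>n. coef (w n) (i, s)) \<longlonglongrightarrow> coef f (i, s)"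
      by (rule bounded_linear.tendsto[OF coef_bounded_linear w(2)])
    then show ?thesis using W_supp[OF w(1) that(2)] by (simp add: LIMSEQ_const_iff)
  qed
  have subM: "subspace M"
  proof (rule subspaceI)
    show "0 \<in> M" using WI[of "{}"] closure_subset unfolding M_def by auto
    show "f + g \<in> M" if f: "f \<in> M" and g: "g \<in> M" for f g
    proof -
      obtain v where v: "\<And>n. v n \<in> W" "v \<longlonglongrightarrow> f" using f unfolding M_def closure_sequential by blast
      obtain w where w: "\<And>n. w n \<in> W" "w \<longlonglongrightarrow> g" using g unfolding M_def closure_sequential by blast
      show ?thesis unfolding M_def closure_sequential
        using W_add[OF v(1) w(1)] tendsto_add[OF v(2) w(2)] by (intro exI[of _ "\<lambda>n. v n + w n"]) auto
    qed
    show "r *\<^sub>R f \<in> M" if "f \<in> M" for r f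
    proof -
      have "r *\<^sub>R f = cscale (of_real r) f" by (rule ell2_eqI) (simp add: coef_scaleR coef_cscale)
      then show ?thesis using M_cscale[OF that] by simp
    qed
  qed
  have "\<exists>p. p \<in> M \<and> (\<forall>z\<in>M. inner (f - p) z = 0)" for f
    using orthogonal_decomposition[OF subM, of f] unfolding M_def by (metis closed_closure)
  then obtain P where P: "\<And>f. P f \<in> M" "\<And>f z. z \<in> M \<Longrightarrow> inner (f - P f) z = 0" by metis
  have P_uniq: "P f = p" if "p \<in> M" "\<And>z. z \<in> M \<Longrightarrow> inner (f - p) z = 0" for f p
  proof -
    let ?z = "p - P f"
    have z: "?z \<in> M" using subM that(1) P(1) by (simp add: subspace_diff)
    have "inner ?z ?z = inner (f - P f) ?z - inner (f - p) ?z" by (simp add: inner_diff_left)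
    then have "inner ?z ?z = 0" using P(2)[OF z] that(2)[OF z] by simp
    then show ?thesis by simp
  qed
  \<comment> \<open>\<open>M\<close> is invariant under complex scalars, so the real orthogonality
    becomes complex.\<close>
  have P_cinner: "cinner (f - P f) z = 0" if "z \<in> M" for f z
    using P(2)[OF that] P(2)[OF M_cscale[OF that]] by (simp add: cinner_eq_0_iff)
  have P_add: "P (f + g) = P f + P g" for f g
  proof (rule P_uniq)
    show "P f + P g \<in> M" using subM P(1) by (simp add: subspace_add)
    have "f + g - (P f + P g) = (f - P f) + (g - P g)" by simp
    then show "inner (f + g - (P f + P g)) z = 0" if "z \<in> M" for z
      by (simp only: inner_add_left P(2)[OF that] add_0)
  qed
  have P_scale: "P (r *\<^sub>R f) = r *\<^sub>R P f" for r f
  proof (rule P_uniq)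
    show "r *\<^sub>R P f \<in> M" using subM P(1) by (simp add: subspace_scale)
    show "inner (r *\<^sub>R f - r *\<^sub>R P f) z = 0" if "z \<in> M" for z
      by (simp only: scaleR_diff_right[symmetric] inner_scaleR_left P(2)[OF that] mult_zero_right)
  qed
  have P_norm: "norm (P f) \<le> norm f * 1" for f
  proof -
    have "(norm f)\<^sup>2 = (norm (f - P f))\<^sup>2 + (norm (P f))\<^sup>2"
      using P(2)[OF P(1), of f f] by (simp only: power2_norm_eq_inner) (simp add: inner_diff_left inner_diff_right inner_commute)
    then have "(norm (P f))\<^sup>2 \<le> (norm f)\<^sup>2" by simp
    then have "norm (P f) \<le> norm f" by (rule power2_le_imp_le) simp
    then show ?thesis by simp
  qed
  have P_bl: "bounded_linear P" by (rule bounded_linear_intro[OF P_add P_scale P_norm])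
  have P_cscale: "P (cscale a f) = cscale a (P f)" for a f
  proof (rule P_uniq)
    show "cscale a (P f) \<in> M" by (rule M_cscale[OF P(1)])
    fix z assume "z \<in> M"
    have "cscale a f - cscale a (P f) = cscale a (f - P f)"
      by (rule ell2_eqI) (simp add: coef_cscale coef_diff algebra_simps)
    then show "inner (cscale a f - cscale a (P f)) z = 0"
      by (simp add: inner_ell2_def cinner_cscale P_cinner[OF \<open>z \<in> M\<close>])
  qed
  have P_ampl_trans: "P (ampl_trans G g f) = ampl_trans G g (P f)" if g: "g \<in> carrier G" for g f
  proof (rule P_uniq)
    show "ampl_trans G g (P f) \<in> M" by (rule M_ampl_trans[OF g P(1)])
    fix z assume "z \<in> M"
    have "ampl_trans G g f - ampl_trans G g (P f) = ampl_trans G g (f - P f)"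
      by (simp add: linear_diff[OF bounded_linear.linear[OF bounded_linear_ampl_trans[OF g]]])
    then show "inner (ampl_trans G g f - ampl_trans G g (P f)) z = 0"
      using g M_ampl_trans[OF _ \<open>z \<in> M\<close>] by (simp add: inner_ell2_def cinner_ampl_trans P_cinner)
  qed
  have P_self: "cinner (P f) h = cinner f (P h)" for f h
  proof -
    have "cinner f (P h) = cinner (P f) (P h)" using P_cinner[OF P(1), of f h] by (simp add: cinner_diff)
    moreover have "cinner h (P f) = cinner (P h) (P f)" using P_cinner[OF P(1), of h f] by (simp add: cinner_diff)
    then have "cinner (P f) h = cinner (P f) (P h)" by (metis cinner_commute)
    ultimately show ?thesis by simp
  qed
  let ?T = "kernel_op (ampl_kernel G x) :: ('i \<times> 'a) ell2 \<Rightarrow> _"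
  have xk: "kernel_bounded (ampl_kernel G x :: 'i \<times> 'a \<Rightarrow> 'i \<times> 'a \<Rightarrow> complex) C" by (rule kernel_bounded_ampl_kernel[OF x])
  have row: "(\<Sum>\<^sub>\<infinity>q. ampl_kernel G x (i, s) q * v q) = (\<Sum>\<^sub>\<infinity>u\<in>carrier G. x (s \<otimes> inv u) * v (i, u))"
    if "s \<in> carrier G" for i :: 'i and s v
  proof -
    have "(\<Sum>\<^sub>\<infinity>q. ampl_kernel G x (i, s) q * v q) = (\<Sum>\<^sub>\<infinity>q\<in>Pair i ` carrier G. ampl_kernel G x (i, s) q * v q)"
      by (rule infsum_cong_neutral) (auto simp: ampl_kernel_def conv_kernel_def)
    also have "\<dots> = (\<Sum>\<^sub>\<infinity>u\<in>carrier G. ampl_kernel G x (i, s) (i, u) * v (i, u))"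
      by (subst infsum_reindex) (auto simp: inj_on_def o_def)
    also have "\<dots> = (\<Sum>\<^sub>\<infinity>u\<in>carrier G. x (s \<otimes> inv u) * v (i, u))"
      using that by (intro infsum_cong) (auto simp: ampl_kernel_def conv_kernel_def)
    finally show ?thesis .
  qed
  have col: "(\<Sum>\<^sub>\<infinity>q. ampl_kernel G x q (j, t) * v q) = (\<Sum>\<^sub>\<infinity>u\<in>carrier G. x (u \<otimes> inv t) * v (j, u))"
    if "t \<in> carrier G" for j :: 'i and t v
  proof -
    have "(\<Sum>\<^sub>\<infinity>q. ampl_kernel G x q (j, t) * v q) = (\<Sum>\<^sub>\<infinity>q\<in>Pair j ` carrier G. ampl_kernel G x q (j, t) * v q)"
      by (rule infsum_cong_neutral) (auto simp: ampl_kernel_def conv_kernel_def)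
    also have "\<dots> = (\<Sum>\<^sub>\<infinity>u\<in>carrier G. ampl_kernel G x (j, u) (j, t) * v (j, u))"
      by (subst infsum_reindex) (auto simp: inj_on_def o_def)
    also have "\<dots> = (\<Sum>\<^sub>\<infinity>u\<in>carrier G. x (u \<otimes> inv t) * v (j, u))"
      using that by (intro infsum_cong) (auto simp: ampl_kernel_def conv_kernel_def)
    finally show ?thesis .
  qed
  have comm_delta: "?T (P (delta (j, t))) = P (?T (delta (j, t)))" if t: "t \<in> carrier G" for j t
  proof (rule ell2_eqI)
    fix q :: "'i \<times> 'a" obtain i s where q: "q = (i, s)" by (cases q)
    show "coef (?T (P (delta (j, t)))) q = coef (P (?T (delta (j, t)))) q"
    proof (cases "s \<in> carrier G")
      case False
      have "coef (?T (P (delta (j, t)))) (i, s) = 0"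
        unfolding coef_kernel_op[OF xk] using False by (intro infsum_0) (simp add: ampl_kernel_def conv_kernel_def)
      then show ?thesis using M_supp[OF P(1) False] by (simp add: q)
    next
      case s: True
      \<comment> \<open>The coefficient of P T sums x(u t^-1) against the entry of P at row s,
        column u. Substituting s u^-1 t for u turns this into x(s u^-1) against the entry at row s,
        column s u^-1 t. Translation by u s^-1 takes that position to row u, column t, and P
        commutes with translations; what results is the coefficient of T P.\<close>
      have b: "bij_betw (\<lambda>u. s \<otimes> inv u \<otimes> t) (carrier G) (carrier G)"
      proof (rule bij_betwI[where g="\<lambda>u. t \<otimes> inv u \<otimes> s"])
        fix u assume u: "u \<in> carrier G"
        have "inv (s \<otimes> inv u \<otimes> t) = inv t \<otimes> (u \<otimes> inv s)"
          using s t u by (simp add: inv_mult_group m_assoc)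
        then show "t \<otimes> inv (s \<otimes> inv u \<otimes> t) \<otimes> s = u"
          using s t u by (simp add: m_assoc) (simp add: m_assoc[symmetric])
        have "inv (t \<otimes> inv u \<otimes> s) = inv s \<otimes> (u \<otimes> inv t)"
          using s t u by (simp add: inv_mult_group m_assoc)
        then show "s \<otimes> inv (t \<otimes> inv u \<otimes> s) \<otimes> t = u"
          using s t u by (simp add: m_assoc) (simp add: m_assoc[symmetric])
      qed (use s t in auto)
      have "coef (P (?T (delta (j, t)))) (i, s) = cinner (?T (delta (j, t))) (P (delta (i, s)))"
        by (simp add: cinner_delta[symmetric] P_self)
      also have "\<dots> = (\<Sum>\<^sub>\<infinity>u\<in>carrier G. x (u \<otimes> inv t) * cnj (coef (P (delta (i, s))) (j, u)))"
        unfolding cinner_def coef_kernel_op_delta[OF xk] by (rule col[OF t])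
      also have "\<dots> = (\<Sum>\<^sub>\<infinity>u\<in>carrier G. x (u \<otimes> inv t) * coef (P (delta (j, u))) (i, s))"
      proof -
        \<comment> \<open>Self-adjointness of \<open>P\<close> in coordinates: its matrix is
          Hermitian.\<close>
        have "cnj (coef (P (delta (i, s))) (j, u)) = coef (P (delta (j, u))) (i, s)" for u
          by (metis cinner_delta P_self cinner_commute)
        then show ?thesis by simp
      qed
      also have "\<dots> = (\<Sum>\<^sub>\<infinity>u\<in>carrier G. x (s \<otimes> inv u \<otimes> t \<otimes> inv t) * coef (P (delta (j, s \<otimes> inv u \<otimes> t))) (i, s))"
        by (rule infsum_reindex_bij_betw[OF b, symmetric])
      also have "\<dots> = (\<Sum>\<^sub>\<infinity>u\<in>carrier G. x (s \<otimes> inv u) * coef (P (delta (j, t))) (i, u))"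
      proof (rule infsum_cong)
        fix u assume u: "u \<in> carrier G"
        let ?g = "u \<otimes> inv s"
        have g: "?g \<in> carrier G" using u s by simp
        have "?g \<otimes> (s \<otimes> inv u \<otimes> t) = t"
          using s t u by (simp add: m_assoc inv_mult_cancel)
        then have "delta (j, t) = ampl_trans G ?g (delta (j, s \<otimes> inv u \<otimes> t))"
          using ampl_trans_delta[OF g, of "s \<otimes> inv u \<otimes> t" j] s t u by simp
        then have "coef (P (delta (j, t))) (i, u) = coef (P (delta (j, s \<otimes> inv u \<otimes> t))) (i, inv ?g \<otimes> u)"
          using u by (simp add: P_ampl_trans[OF g] coef_ampl_trans[OF g])
        also have "inv ?g \<otimes> u = s" using u s by (simp add: inv_mult_group m_assoc)
        finally show "x (s \<otimes> inv u \<otimes> t \<otimes> inv t) * coef (P (delta (j, s \<otimes> inv u \<otimes> t))) (i, s)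
            = x (s \<otimes> inv u) * coef (P (delta (j, t))) (i, u)"
          using s t u by (simp add: m_assoc)
      qed
      also have "\<dots> = coef (?T (P (delta (j, t)))) (i, s)"
        unfolding coef_kernel_op[OF xk] by (rule row[OF s, symmetric])
      finally show ?thesis by (simp add: q)
    qed
  qed
  have "?T (P \<Xi>) = P (?T \<Xi>)"
    using bounded_linear_eq_on_support[of "\<lambda>f. ?T (P f)" "\<lambda>f. P (?T f)" "UNIV \<times> carrier G" \<Xi>]
      bounded_linear_compose[OF kernel_op_bounded_linear[OF xk] P_bl] bounded_linear_compose[OF P_bl kernel_op_bounded_linear[OF xk]]
      kernel_op_cscale[OF xk] P_cscale comm_delta \<Xi>
    by force
  moreover have "P \<Xi> = \<Xi>"
    using \<Xi>W closure_subset[of W] unfolding M_def[symmetric] by (intro P_uniq) auto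
  ultimately have "?T \<Xi> \<in> M" using P(1)[of "?T \<Xi>"] by simp
  then show ?thesis by (simp add: M_def W_def)
qed

end

section \<open>Symbols of elements of the group von Neumann algebra\<close>

lemma l2_iff: "f \<in> l2 G \<longleftrightarrow> (\<forall>x. x \<notin> carrier G \<longrightarrow> f x = 0) \<and> (\<lambda>x. (cmod (f x))\<^sup>2) summable_on UNIV"
proof -
  have "(\<lambda>x. (cmod (f x))\<^sup>2) summable_on carrier G \<longleftrightarrow> (\<lambda>x. (cmod (f x))\<^sup>2) summable_on UNIV"
    if "\<forall>x. x \<notin> carrier G \<longrightarrow> f x = 0"
    using that by (intro summable_on_cong_neutral) auto
  then show ?thesis by (auto simp: l2_def)
qed

lemma l2_zero_outside: "f \<in> l2 G \<Longrightarrow> x \<notin> carrier G \<Longrightarrow> f x = 0"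
  by (simp add: l2_iff)

lemma coef_l2: "f \<in> l2 G \<Longrightarrow> coef (Ell2 f) = f"
  by (simp add: l2_iff coef_Ell2)

lemma l2norm_eq: "f \<in> l2 G \<Longrightarrow> l2norm G f = norm (Ell2 f)"
proof -
  assume f: "f \<in> l2 G"
  have "infsum (\<lambda>x. (cmod (f x))\<^sup>2) (carrier G) = infsum (\<lambda>x. (cmod (f x))\<^sup>2) UNIV"
    using l2_zero_outside[OF f] by (intro infsum_cong_neutral) auto
  then have "l2norm G f = sqrt ((norm (Ell2 f))\<^sup>2)"
    unfolding norm_ell2_sq coef_l2[OF f] by (simp add: l2norm_def)
  then show ?thesis by simp
qed

lemma coef_in_l2: "(\<And>x. x \<notin> carrier G \<Longrightarrow> coef v x = 0) \<Longrightarrow> coef v \<in> l2 G"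
  by (simp add: l2_iff coef_summable)

lemma l2_lincomb:
  assumes "f \<in> l2 G" "g \<in> l2 G"
  shows "(\<lambda>x. a * f x + b * g x) \<in> l2 G"
    and "Ell2 (\<lambda>x. a * f x + b * g x) = cscale a (Ell2 f) + cscale b (Ell2 g)"
proof -
  have eq: "(\<lambda>x. a * f x + b * g x) = coef (cscale a (Ell2 f) + cscale b (Ell2 g))"
    using assms by (simp add: fun_eq_iff coef_add coef_cscale coef_l2)
  show "(\<lambda>x. a * f x + b * g x) \<in> l2 G"
    unfolding eq using assms by (intro coef_in_l2) (simp add: coef_add coef_cscale coef_l2 l2_zero_outside)
  show "Ell2 (\<lambda>x. a * f x + b * g x) = cscale a (Ell2 f) + cscale b (Ell2 g)"
    unfolding eq by (rule coef_inverse)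
qed

lemma l2_zero: "(\<lambda>_. 0) \<in> l2 G"
  by (simp add: l2_iff)

lemma l2_scale: "f \<in> l2 G \<Longrightarrow> (\<lambda>x. a * f x) \<in> l2 G"
  using l2_lincomb(1)[of f G f a 0] by simp

lemma l2_diff: "f \<in> l2 G \<Longrightarrow> g \<in> l2 G \<Longrightarrow> (\<lambda>x. f x - g x) \<in> l2 G"
  using l2_lincomb(1)[of f G g 1 "-1"] by simp

lemma l2_sum: "(\<And>i. i \<in> I \<Longrightarrow> f i \<in> l2 G) \<Longrightarrow> (\<lambda>x. \<Sum>i\<in>I. f i x) \<in> l2 G"
proof (induction I rule: infinite_finite_induct)
  case (insert i I)
  then show ?case using l2_lincomb(1)[of "f i" G "\<lambda>x. \<Sum>i\<in>I. f i x" 1 1] by simp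
qed (auto intro: l2_zero)

lemma l2norm_coord: "f \<in> l2 G \<Longrightarrow> cmod (f x) \<le> l2norm G f"
  using coef_le_norm[of "Ell2 f" x] by (simp add: l2norm_eq coef_l2)

definition dirac :: "'a \<Rightarrow> 'a \<Rightarrow> complex" where
  "dirac t = (\<lambda>x. if x = t then 1 else 0)"

lemma dirac_l2: "t \<in> carrier G \<Longrightarrow> dirac t \<in> l2 G"
  unfolding l2_iff dirac_def by (auto intro!: sqsum_finite[of "{t}"] split: if_splits)

lemma bounded_opsD:
  assumes "T \<in> bounded_ops G"
  shows "f \<in> l2 G \<Longrightarrow> T f \<in> l2 G" and "f \<notin> l2 G \<Longrightarrow> T f = (\<lambda>_. 0)"
    and "f \<in> l2 G \<Longrightarrow> g \<in> l2 G \<Longrightarrow> T (\<lambda>x. a * f x + b * g x) = (\<lambda>x. a * T f x + b * T g x)"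
    and "\<exists>C>0. \<forall>f\<in>l2 G. l2norm G (T f) \<le> C * l2norm G f"
proof -
  obtain C where C: "\<forall>f\<in>l2 G. l2norm G (T f) \<le> C * l2norm G f"
    using assms unfolding bounded_ops_def by blast
  have "l2norm G (T f) \<le> (\<bar>C\<bar> + 1) * l2norm G f" if "f \<in> l2 G" for f
  proof -
    have "0 \<le> l2norm G f" using that by (simp add: l2norm_eq)
    then have "C * l2norm G f \<le> (\<bar>C\<bar> + 1) * l2norm G f" by (intro mult_right_mono) auto
    then show ?thesis using C that by force
  qed
  then show "\<exists>C>0. \<forall>f\<in>l2 G. l2norm G (T f) \<le> C * l2norm G f"
    by (intro exI[of _ "\<bar>C\<bar> + 1"]) auto
qed (use assms in \<open>unfold bounded_ops_def, blast\<close>)+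

text \<open>The basis expansion of \<open>f\<close> converges in norm, \<open>T\<close> is bounded
  and evaluation at \<open>s\<close> is continuous, so the entries \<open>T (dirac t) s\<close>
  determine \<open>T\<close>.\<close>

lemma bounded_ops_matrix:
  assumes T: "T \<in> bounded_ops G" and f: "f \<in> l2 G"
  shows "((\<lambda>t. T (dirac t) s * f t) has_sum T f s) UNIV"
  unfolding has_sum_def
proof (rule tendstoI)
  fix e :: real assume e: "0 < e"
  obtain C where C: "C > 0" "\<And>f. f \<in> l2 G \<Longrightarrow> l2norm G (T f) \<le> C * l2norm G f"
    using bounded_opsD(4)[OF T] by blast
  have fin: "(\<Sum>t\<in>F. cscale (f t) (delta t)) = Ell2 (\<lambda>x. \<Sum>t\<in>F. f t * dirac t x) \<and>
      (\<lambda>x. \<Sum>t\<in>F. f t * dirac t x) \<in> l2 G \<and>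
      T (\<lambda>x. \<Sum>t\<in>F. f t * dirac t x) s = (\<Sum>t\<in>F. T (dirac t) s * f t)" if "finite F" for F
    using that
  proof (induction F)
    case empty
    have "T (\<lambda>x. 0) = (\<lambda>x. 0)" using bounded_opsD(3)[OF T f f, of 0 0] by simp
    then show ?case by (simp add: l2_zero zero_ell2_def)
  next
    case (insert t F)
    let ?g = "\<lambda>x. \<Sum>t\<in>F. f t * dirac t x"
    show ?case
    proof (cases "t \<in> carrier G")
      case False
      then have "f t = 0" using f by (simp add: l2_zero_outside)
      moreover have "cscale 0 (delta t) = 0" by (rule ell2_eqI) (simp add: coef_cscale coef_zero)
      ultimately show ?thesis using insert by simp
    next
      case True
      have 1: "(\<lambda>x. f t * dirac t x + 1 * ?g x) \<in> l2 G"
        and 2: "Ell2 (\<lambda>x. f t * dirac t x + 1 * ?g x) = cscale (f t) (Ell2 (dirac t)) + cscale 1 (Ell2 ?g)"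
        using l2_lincomb[OF dirac_l2[OF True], of ?g "f t" 1] insert by auto
      have 3: "T (\<lambda>x. f t * dirac t x + 1 * ?g x) = (\<lambda>x. f t * T (dirac t) x + 1 * T ?g x)"
        using bounded_opsD(3)[OF T dirac_l2[OF True]] insert by blast
      have "cscale 1 (Ell2 ?g) = Ell2 ?g" by (rule ell2_eqI) (simp add: coef_cscale)
      moreover have "Ell2 (dirac t) = delta t" by (simp add: delta_def dirac_def)
      ultimately show ?thesis using 1 2 3 insert by (simp add: mult.commute)
    qed
  qed
  have "((\<lambda>F. \<Sum>t\<in>F. cscale (f t) (delta t)) \<longlongrightarrow> Ell2 f) (finite_subsets_at_top UNIV)"
    using ell2_has_sum[of "Ell2 f"] by (simp add: has_sum_def coef_l2[OF f])
  then have "\<forall>\<^sub>F F in finite_subsets_at_top UNIV. dist (\<Sum>t\<in>F. cscale (f t) (delta t)) (Ell2 f) < e / C"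
    using e C by (intro tendstoD) auto
  moreover have "\<forall>\<^sub>F F in finite_subsets_at_top UNIV. finite (F :: 'a set)"
    by (rule eventually_finite_subsets_at_top_weakI) simp
  ultimately show "\<forall>\<^sub>F F in finite_subsets_at_top UNIV. dist (\<Sum>t\<in>F. T (dirac t) s * f t) (T f s) < e"
  proof eventually_elim
    case (elim F)
    let ?g = "\<lambda>x. \<Sum>t\<in>F. f t * dirac t x"
    have g: "?g \<in> l2 G" using fin[OF elim(2)] by blast
    have d: "(\<lambda>x. 1 * f x + (- 1) * ?g x) \<in> l2 G" by (rule l2_lincomb[OF f g])
    have "Ell2 (\<lambda>x. 1 * f x + (- 1) * ?g x) = Ell2 f - Ell2 ?g"
      unfolding l2_lincomb(2)[OF f g] by (rule ell2_eqI) (simp add: coef_cscale coef_add coef_diff)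
    then have n: "l2norm G (\<lambda>x. 1 * f x + (- 1) * ?g x) < e / C"
      using elim(1) fin[OF elim(2)] by (simp only: l2norm_eq[OF d] dist_norm norm_minus_commute)
    have "dist (\<Sum>t\<in>F. T (dirac t) s * f t) (T f s) = cmod (T (\<lambda>x. 1 * f x + (- 1) * ?g x) s)"
      unfolding bounded_opsD(3)[OF T f g] using fin[OF elim(2)] by (simp add: dist_norm norm_minus_commute)
    also have "\<dots> \<le> l2norm G (T (\<lambda>x. 1 * f x + (- 1) * ?g x))"
      by (rule l2norm_coord[OF bounded_opsD(1)[OF T d]])
    also have "\<dots> \<le> C * l2norm G (\<lambda>x. 1 * f x + (- 1) * ?g x)" by (rule C(2)[OF d])
    also have "\<dots> < C * (e / C)" using n C(1) by (rule mult_strict_left_mono)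
    finally show ?case using C(1) by simp
  qed
qed

definition symbol :: "('a, 'b) monoid_scheme \<Rightarrow> 'a op \<Rightarrow> 'a \<Rightarrow> complex" where
  "symbol G T = T (dirac \<one>\<^bsub>G\<^esub>)"

text \<open>The value 0 off \<open>l2 G\<close> matches the convention in
  \<open>bounded_ops\<close>, so that \<open>conv_op_symbol\<close> is an equation between total
  functions.\<close>

definition conv_op :: "('a, 'b) monoid_scheme \<Rightarrow> ('a \<Rightarrow> complex) \<Rightarrow> 'a op" where
  "conv_op G x = (\<lambda>f. if f \<in> l2 G then coef (kernel_op (conv_kernel G x) (Ell2 f)) else (\<lambda>_. 0))"

lemma VN_bounded: "T \<in> VN G \<Longrightarrow> T \<in> bounded_ops G"
  by (simp add: VN_def)

text \<open>The index type is left open on purpose: matrices use \<open>nat\<close>, whereas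
  \<open>conv_op_VN\<close> indexes a finite set of vectors by the vectors themselves.\<close>

definition tuple :: "'i set \<Rightarrow> ('i \<Rightarrow> 'a \<Rightarrow> complex) \<Rightarrow> ('i \<times> 'a) ell2" where
  "tuple I \<xi> = Ell2 (\<lambda>p. if fst p \<in> I then \<xi> (fst p) (snd p) else 0)"

lemma infsum_prod_finite:
  fixes f :: "'i \<times> 'a \<Rightarrow> 'b :: banach"
  assumes I: "finite I" and f0: "\<And>p. fst p \<notin> I \<Longrightarrow> f p = 0"
    and s: "\<And>i. i \<in> I \<Longrightarrow> (\<lambda>a. f (i, a)) summable_on UNIV"
  shows "f summable_on UNIV" and "infsum f UNIV = (\<Sum>i\<in>I. \<Sum>\<^sub>\<infinity>a. f (i, a))"
proof -
  have s': "f summable_on range (Pair i)" if "i \<in> I" for i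
    using s[OF that] by (subst summable_on_reindex) (auto simp: inj_on_def o_def)
  have U: "(\<Union>i\<in>I. range (Pair i)) = I \<times> (UNIV :: 'a set)" by auto
  have "f summable_on (\<Union>i\<in>I. range (Pair i))"
    using I s' by (intro summable_on_finite_union_disjoint) auto
  also have "?this \<longleftrightarrow> f summable_on UNIV"
    unfolding U by (intro summable_on_cong_neutral f0) auto
  finally show "f summable_on UNIV" .
  have "infsum f UNIV = infsum f (\<Union>i\<in>I. range (Pair i))"
    unfolding U by (intro infsum_cong_neutral f0) auto
  also have "\<dots> = (\<Sum>i\<in>I. infsum f (range (Pair i)))"
    using I s' by (intro sum_infsum[symmetric]) auto
  also have "\<dots> = (\<Sum>i\<in>I. \<Sum>\<^sub>\<infinity>a. f (i, a))"
    by (intro sum.cong refl, subst infsum_reindex) (auto simp: inj_on_def o_def)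
  finally show "infsum f UNIV = (\<Sum>i\<in>I. \<Sum>\<^sub>\<infinity>a. f (i, a))" .
qed

lemma tuple:
  assumes I: "finite I" and \<xi>: "\<And>i. i \<in> I \<Longrightarrow> \<xi> i \<in> l2 G"
  shows coef_tuple: "coef (tuple I \<xi>) (i, a) = (if i \<in> I then \<xi> i a else 0)"
    and norm_tuple: "(norm (tuple I \<xi>))\<^sup>2 = (\<Sum>i\<in>I. (l2norm G (\<xi> i))\<^sup>2)"
proof -
  let ?f = "\<lambda>p. if fst p \<in> I then \<xi> (fst p) (snd p) else 0"
  have s: "(\<lambda>a. (cmod (?f (i, a)))\<^sup>2) summable_on UNIV" if "i \<in> I" for i
    using \<xi>[OF that] that by (simp add: l2_iff)
  have *: "(\<lambda>p. (cmod (?f p))\<^sup>2) summable_on UNIV"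
    "infsum (\<lambda>p. (cmod (?f p))\<^sup>2) UNIV = (\<Sum>i\<in>I. \<Sum>\<^sub>\<infinity>a. (cmod (?f (i, a)))\<^sup>2)"
    using infsum_prod_finite[OF I, of "\<lambda>p. (cmod (?f p))\<^sup>2"] s by auto
  have c: "coef (tuple I \<xi>) = ?f" unfolding tuple_def using *(1) by (rule coef_Ell2)
  show "coef (tuple I \<xi>) (i, a) = (if i \<in> I then \<xi> i a else 0)" by (simp add: c)
  have "(norm (tuple I \<xi>))\<^sup>2 = (\<Sum>i\<in>I. \<Sum>\<^sub>\<infinity>a. (cmod (?f (i, a)))\<^sup>2)"
    unfolding norm_ell2_sq c by (rule *(2))
  also have "\<dots> = (\<Sum>i\<in>I. (l2norm G (\<xi> i))\<^sup>2)"
    by (intro sum.cong refl) (simp add: l2norm_eq[OF \<xi>] norm_ell2_sq coef_l2[OF \<xi>])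
  finally show "(norm (tuple I \<xi>))\<^sup>2 = (\<Sum>i\<in>I. (l2norm G (\<xi> i))\<^sup>2)" .
qed

context group
begin

lemma lreg_l2:
  assumes "g \<in> carrier G" "f \<in> l2 G"
  shows "lreg G g f \<in> l2 G"
proof -
  have b: "bij_betw (\<lambda>y. inv g \<otimes> y) (carrier G) (carrier G)"
    using assms by (intro bij_betwI[where g="\<lambda>y. g \<otimes> y"]) (auto simp: m_assoc[symmetric])
  have "(\<lambda>y. (cmod (f y))\<^sup>2) summable_on carrier G" using assms by (simp add: l2_def)
  then have "(\<lambda>y. (cmod (f (inv g \<otimes> y)))\<^sup>2) summable_on carrier G"
    using summable_on_reindex_bij_betw[OF b, of "\<lambda>y. (cmod (f y))\<^sup>2"] by simp
  then have "(\<lambda>y. (cmod (if y \<in> carrier G then f (inv g \<otimes> y) else 0))\<^sup>2) summable_on carrier G"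
    by (rule summable_on_cong[THEN iffD1, rotated]) simp
  then show ?thesis using assms by (simp add: lreg_def l2_def)
qed

text \<open>For a combination of translations the entry at (s, t) depends on s t^-1 only. Strong
  approximation at the two vectors \<open>dirac t\<close> and \<open>dirac \<one>\<close> hands this
  down to \<open>T\<close>.\<close>

lemma VN_dirac:
  assumes T: "T \<in> VN G" and t: "t \<in> carrier G"
  shows "T (dirac t) s = conv_kernel G (symbol G T) s t"
proof (cases "s \<in> carrier G")
  case False
  then show ?thesis
    using bounded_opsD(1)[OF VN_bounded[OF T] dirac_l2[OF t]] by (simp add: conv_kernel_def l2_zero_outside)
next
  case s: True
  let ?s = "s \<otimes> inv t"
  have st: "?s \<in> carrier G" using s t by simp
  note d = dirac_l2[OF t] dirac_l2[OF one_closed]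
  have "cmod (T (dirac t) s - T (dirac \<one>) ?s) \<le> 0"
  proof (rule field_le_epsilon)
    fix e :: real assume e: "0 < e"
    have "finite {dirac t, dirac \<one>} \<and> {dirac t, dirac \<one>} \<subseteq> l2 G \<and> e / 2 > 0" using e d by auto
    then obtain S where S: "S \<in> lspan G" "\<forall>\<xi>\<in>{dirac t, dirac \<one>}. l2norm G (\<lambda>y. T \<xi> y - S \<xi> y) < e / 2"
      using T unfolding VN_def by blast
    obtain F c where F: "finite F" "F \<subseteq> carrier G" and S_def: "S = (\<lambda>f y. \<Sum>x\<in>F. c x * lreg G x f y)"
      using S(1) unfolding lspan_def by blast
    have Sl2: "S f \<in> l2 G" if "f \<in> l2 G" for f
      unfolding S_def using F that by (intro l2_sum l2_scale lreg_l2) auto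
    have Seq: "S (dirac t) s = S (dirac \<one>) ?s"
      unfolding S_def
    proof (rule sum.cong[OF refl])
      fix g assume "g \<in> F"
      then have g: "g \<in> carrier G" using F by blast
      have "inv g \<otimes> s = t \<longleftrightarrow> inv g \<otimes> ?s = \<one>"
        using g s t m_assoc[of "inv g" s "inv t"] mult_inv_eq_iff[of "inv g \<otimes> s" t \<one>] by simp
      then show "c g * lreg G g (dirac t) s = c g * lreg G g (dirac \<one>) ?s"
        using s st d by (simp add: lreg_def) (simp add: dirac_def)
    qed
    have bd: "cmod (T \<xi> y - S \<xi> y) < e / 2" if "\<xi> \<in> {dirac t, dirac \<one>}" for \<xi> y
    proof -
      have "\<xi> \<in> l2 G" using that d by auto
      then have "(\<lambda>y. T \<xi> y - S \<xi> y) \<in> l2 G"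
        using Sl2 bounded_opsD(1)[OF VN_bounded[OF T]] by (intro l2_diff) auto
      then show ?thesis using l2norm_coord S(2) that by (metis (no_types, lifting) le_less_trans)
    qed
    have "T (dirac t) s - T (dirac \<one>) ?s = (T (dirac t) s - S (dirac t) s) - (T (dirac \<one>) ?s - S (dirac \<one>) ?s)"
      by (simp add: Seq)
    also have "cmod \<dots> \<le> e / 2 + e / 2"
      using bd[of "dirac t" s] bd[of "dirac \<one>" ?s] norm_triangle_ineq4 by (smt (verit) insertCI)
    finally show "cmod (T (dirac t) s - T (dirac \<one>) ?s) \<le> 0 + e" by simp
  qed
  then show ?thesis using s t by (simp add: conv_kernel_def symbol_def)
qed

lemma symbol_zero_outside: "T \<in> VN G \<Longrightarrow> s \<notin> carrier G \<Longrightarrow> symbol G T s = 0"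
  unfolding symbol_def by (rule l2_zero_outside[OF bounded_opsD(1)[OF VN_bounded dirac_l2[OF one_closed]]])

lemma VN_has_sum:
  assumes T: "T \<in> VN G" and f: "f \<in> l2 G"
  shows "((\<lambda>t. conv_kernel G (symbol G T) s t * f t) has_sum T f s) UNIV"
proof -
  have "T (dirac t) s * f t = conv_kernel G (symbol G T) s t * f t" for t
    using VN_dirac[OF T, of t s] f by (cases "t \<in> carrier G") (auto simp: l2_zero_outside)
  then show ?thesis using bounded_ops_matrix[OF VN_bounded[OF T] f, of s] by (simp only:)
qed

end

section \<open>Norms of operator matrices and bounds of their kernels\<close>

lemma l2norm_slice: "l2norm G (\<lambda>y. coef v (i, y)) \<le> norm v"
proof -
  have b: "(\<Sum>y\<in>A. (cmod (coef v (i, y)))\<^sup>2) \<le> (norm v)\<^sup>2" if "finite A" for A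
    using norm_ell2_finite[of "Pair i ` A" v] that by (simp add: sum.reindex inj_on_def)
  then have "infsum (\<lambda>y. (cmod (coef v (i, y)))\<^sup>2) (carrier G) \<le> (norm v)\<^sup>2"
    by (intro infsum_le_finite_sums sqsum_bounded) auto
  then show ?thesis unfolding l2norm_def by (simp add: real_le_lsqrt infsum_nonneg)
qed

definition mat_apply :: "nat \<Rightarrow> (nat \<Rightarrow> nat \<Rightarrow> 'a op) \<Rightarrow> (nat \<Rightarrow> 'a \<Rightarrow> complex) \<Rightarrow> nat \<Rightarrow> 'a \<Rightarrow> complex" where
  "mat_apply k X \<xi> i = (\<lambda>y. \<Sum>j<k. X i j (\<xi> j) y)"

lemma mat_apply_l2:
  assumes "\<And>j. j < k \<Longrightarrow> X i j \<in> VN G" "\<And>j. j < k \<Longrightarrow> \<xi> j \<in> l2 G"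
  shows "mat_apply k X \<xi> i \<in> l2 G"
  unfolding mat_apply_def
proof (rule l2_sum)
  fix j assume "j \<in> {..<k}"
  then show "X i j (\<xi> j) \<in> l2 G"
    using bounded_opsD(1)[OF VN_bounded[OF assms(1)] assms(2)] by simp
qed

lemma norm_tuple_sqrt:
  assumes "finite I" "\<And>i. i \<in> I \<Longrightarrow> \<xi> i \<in> l2 G"
  shows "sqrt (\<Sum>i\<in>I. (l2norm G (\<xi> i))\<^sup>2) = norm (tuple I \<xi>)"
  by (rule real_sqrt_unique) (simp_all add: norm_tuple[OF assms])

context group
begin

lemma matrix_kernel_apply:
  assumes X: "\<And>i j. i < k \<Longrightarrow> j < k \<Longrightarrow> X i j \<in> VN G" and \<xi>: "\<And>j. j < k \<Longrightarrow> \<xi> j \<in> l2 G" and i: "i < k"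
  shows "(\<Sum>\<^sub>\<infinity>q. matrix_kernel G k (\<lambda>i j. symbol G (X i j)) (i, s) q * coef (tuple {..<k} \<xi>) q) = mat_apply k X \<xi> i s"
proof -
  let ?f = "\<lambda>q. matrix_kernel G k (\<lambda>i j. symbol G (X i j)) (i, s) q * coef (tuple {..<k} \<xi>) q"
  have c: "coef (tuple {..<k} \<xi>) (j, a) = (if j \<in> {..<k} then \<xi> j a else 0)" for j a
    using \<xi> by (intro coef_tuple[where G=G]) auto
  have f: "?f (j, t) = conv_kernel G (symbol G (X i j)) s t * \<xi> j t" if "j < k" for j t
    using i that by (auto simp: matrix_kernel_def conv_kernel_def c)
  have hs: "((\<lambda>t. ?f (j, t)) has_sum X i j (\<xi> j) s) UNIV" if "j < k" for j
    unfolding f[OF that] using VN_has_sum[OF X[OF i that] \<xi>[OF that]] .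
  have "infsum ?f UNIV = (\<Sum>j<k. \<Sum>\<^sub>\<infinity>t. ?f (j, t))"
    using hs by (intro infsum_prod_finite(2)) (auto simp: c summable_on_def)
  also have "\<dots> = (\<Sum>j<k. X i j (\<xi> j) s)"
    using hs by (intro sum.cong refl infsumI) auto
  finally show ?thesis by (simp add: mat_apply_def)
qed

lemma tuple_mat_apply:
  assumes X: "\<And>i j. i < k \<Longrightarrow> j < k \<Longrightarrow> X i j \<in> VN G" and \<xi>: "\<And>j. j < k \<Longrightarrow> \<xi> j \<in> l2 G"
  shows "coef (tuple {..<k} (mat_apply k X \<xi>)) p = (\<Sum>\<^sub>\<infinity>q. matrix_kernel G k (\<lambda>i j. symbol G (X i j)) p q * coef (tuple {..<k} \<xi>) q)"
proof -
  obtain i s where p: "p = (i, s)" by (cases p)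
  have "coef (tuple {..<k} (mat_apply k X \<xi>)) (i, s) = (if i \<in> {..<k} then mat_apply k X \<xi> i s else 0)"
    using X \<xi> by (intro coef_tuple[where G=G] mat_apply_l2) auto
  also have "\<dots> = (\<Sum>\<^sub>\<infinity>q. matrix_kernel G k (\<lambda>i j. symbol G (X i j)) (i, s) q * coef (tuple {..<k} \<xi>) q)"
  proof (cases "i < k")
    case True
    then show ?thesis by (simp add: matrix_kernel_apply[OF X \<xi>])
  next
    case False
    have "(\<Sum>\<^sub>\<infinity>q. matrix_kernel G k (\<lambda>i j. symbol G (X i j)) (i, s) q * coef (tuple {..<k} \<xi>) q) = 0"
      using False by (intro infsum_0) (simp add: matrix_kernel_def)
    then show ?thesis using False by simp
  qed
  finally show ?thesis by (simp add: p)
qed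

lemma norm_mat_apply_le:
  assumes X: "\<And>i j. i < k \<Longrightarrow> j < k \<Longrightarrow> X i j \<in> VN G" and \<xi>: "\<And>j. j < k \<Longrightarrow> \<xi> j \<in> l2 G"
    and K: "kernel_bounded (matrix_kernel G k (\<lambda>i j. symbol G (X i j))) C"
  shows "norm (tuple {..<k} (mat_apply k X \<xi>)) \<le> C * norm (tuple {..<k} \<xi>)"
proof -
  have "tuple {..<k} (mat_apply k X \<xi>) = kernel_op (matrix_kernel G k (\<lambda>i j. symbol G (X i j))) (tuple {..<k} \<xi>)"
    by (rule ell2_eqI) (simp add: coef_kernel_op[OF K] tuple_mat_apply[OF X \<xi>])
  then show ?thesis using norm_kernel_op[OF K] by simp
qed

text \<open>Finitely supported test vectors, cut down to the carrier, are admissible tuples, and the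
  kernel vanishes on what is cut away. Cauchy-Schwarz then turns the norm estimate into the estimate
  of the form.\<close>

lemma kernel_bounded_gkerI:
  assumes X: "\<And>i j. i < k \<Longrightarrow> j < k \<Longrightarrow> X i j \<in> VN G" and C: "0 \<le> C"
    and bd: "\<And>\<xi>. (\<And>j. j < k \<Longrightarrow> \<xi> j \<in> l2 G) \<Longrightarrow> norm (tuple {..<k} (mat_apply k X \<xi>)) \<le> C * norm (tuple {..<k} \<xi>)"
  shows "kernel_bounded (matrix_kernel G k (\<lambda>i j. symbol G (X i j))) C"
proof (rule kbdI[OF C])
  fix F F' :: "(nat \<times> 'a) set" and \<xi> \<eta> :: "nat \<times> 'a \<Rightarrow> complex" assume F: "finite F" "finite F'"
  let ?K = "matrix_kernel G k (\<lambda>i j. symbol G (X i j))"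
  define \<xi>' where "\<xi>' j t = (if (j, t) \<in> F' \<and> t \<in> carrier G then \<xi> (j, t) else 0)" for j t
  have \<xi>': "\<xi>' j \<in> l2 G" for j
    unfolding l2_iff
  proof
    show "(\<lambda>t. (cmod (\<xi>' j t))\<^sup>2) summable_on UNIV"
      using F by (intro sqsum_finite[of "snd ` F'"]) (auto simp: \<xi>'_def image_iff)
  qed (simp add: \<xi>'_def)
  have c: "coef (tuple {..<k} \<xi>') (j, a) = (if j \<in> {..<k} then \<xi>' j a else 0)" for j a
    using \<xi>' by (intro coef_tuple[where G=G]) auto
  let ?v = "tuple {..<k} (mat_apply k X \<xi>')"
  have v: "coef ?v p = (\<Sum>q\<in>F'. ?K p q * \<xi> q)" for p
  proof -
    have "coef ?v p = (\<Sum>\<^sub>\<infinity>q. ?K p q * coef (tuple {..<k} \<xi>') q)"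
      using X \<xi>' by (intro tuple_mat_apply)
    also have "\<dots> = (\<Sum>\<^sub>\<infinity>q\<in>F'. ?K p q * \<xi> q)"
      by (rule infsum_cong_neutral) (auto simp: c \<xi>'_def matrix_kernel_def)
    finally have "coef ?v p = (\<Sum>\<^sub>\<infinity>q\<in>F'. ?K p q * \<xi> q)" .
    then show ?thesis using F by simp
  qed
  have n: "norm (tuple {..<k} \<xi>') \<le> L2_set (\<lambda>t. cmod (\<xi> t)) F'"
  proof -
    have "(norm (tuple {..<k} \<xi>'))\<^sup>2 = (\<Sum>\<^sub>\<infinity>q\<in>F'. (cmod (coef (tuple {..<k} \<xi>') q))\<^sup>2)"
      unfolding norm_ell2_sq by (rule infsum_cong_neutral) (auto simp: c \<xi>'_def)
    also have "\<dots> \<le> (\<Sum>q\<in>F'. (cmod (\<xi> q))\<^sup>2)"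
      using F by (auto simp: c \<xi>'_def intro!: sum_mono)
    finally show ?thesis unfolding L2_set_def by (rule real_le_rsqrt)
  qed
  have "cmod (\<Sum>p\<in>F. \<Sum>q\<in>F'. ?K p q * \<xi> q * \<eta> p) = cmod (\<Sum>p\<in>F. coef ?v p * \<eta> p)"
    by (simp add: v sum_distrib_right)
  also have "\<dots> \<le> (\<Sum>p\<in>F. \<bar>cmod (coef ?v p)\<bar> * \<bar>cmod (\<eta> p)\<bar>)"
    by (rule sum_norm_le) (simp add: norm_mult)
  also have "\<dots> \<le> L2_set (\<lambda>p. cmod (coef ?v p)) F * L2_set (\<lambda>p. cmod (\<eta> p)) F"
    by (rule L2_set_mult_ineq)
  also have "\<dots> \<le> (C * L2_set (\<lambda>t. cmod (\<xi> t)) F') * L2_set (\<lambda>p. cmod (\<eta> p)) F"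
  proof (intro mult_right_mono L2_set_nonneg)
    have "L2_set (\<lambda>p. cmod (coef ?v p)) F \<le> norm ?v"
      unfolding L2_set_def using norm_ell2_finite[OF F(1), of ?v] by (intro real_le_lsqrt) (auto intro: sum_nonneg)
    also have "\<dots> \<le> C * norm (tuple {..<k} \<xi>')" by (rule bd[OF \<xi>'])
    also have "\<dots> \<le> C * L2_set (\<lambda>t. cmod (\<xi> t)) F'" using n C by (rule mult_left_mono)
    finally show "L2_set (\<lambda>p. cmod (coef ?v p)) F \<le> C * L2_set (\<lambda>t. cmod (\<xi> t)) F'" .
  qed
  finally show "cmod (\<Sum>p\<in>F. \<Sum>q\<in>F'. ?K p q * \<xi> q * \<eta> p)
      \<le> C * L2_set (\<lambda>t. cmod (\<xi> t)) F' * L2_set (\<lambda>s. cmod (\<eta> s)) F" .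
qed

lemma mat_apply_scale:
  assumes X: "\<And>j. j < k \<Longrightarrow> X i j \<in> VN G" and \<xi>: "\<And>j. j < k \<Longrightarrow> \<xi> j \<in> l2 G"
  shows "mat_apply k X (\<lambda>j y. a * \<xi> j y) i = (\<lambda>y. a * mat_apply k X \<xi> i y)"
proof -
  have "X i j (\<lambda>y. a * \<xi> j y) = (\<lambda>y. a * X i j (\<xi> j) y)" if "j < k" for j
    using bounded_opsD(3)[OF VN_bounded[OF X[OF that]] \<xi>[OF that] \<xi>[OF that], of a 0] by simp
  then show ?thesis by (simp add: mat_apply_def sum_distrib_left)
qed

lemma tuple_scale:
  assumes "finite I" "\<And>i. i \<in> I \<Longrightarrow> \<xi> i \<in> l2 G"
  shows "tuple I (\<lambda>i y. a * \<xi> i y) = cscale a (tuple I \<xi>)"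
proof (rule ell2_eqI)
  fix p :: "'c \<times> 'a"
  obtain i y where p: "p = (i, y)" by (cases p)
  have s: "(\<lambda>y. a * \<xi> i y) \<in> l2 G" if "i \<in> I" for i
    using assms(2)[OF that] by (rule l2_scale)
  have "coef (tuple I (\<lambda>i y. a * \<xi> i y)) (i, y) = (if i \<in> I then a * \<xi> i y else 0)"
    using assms(1) s by (rule coef_tuple)
  moreover have "coef (tuple I \<xi>) (i, y) = (if i \<in> I then \<xi> i y else 0)"
    using assms by (rule coef_tuple)
  ultimately show "coef (tuple I (\<lambda>i y. a * \<xi> i y)) p = coef (cscale a (tuple I \<xi>)) p"
    by (simp add: coef_cscale p)
qed

lemma matnorm_alt:
  assumes X: "\<And>i j. i < k \<Longrightarrow> j < k \<Longrightarrow> X i j \<in> VN G"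
  shows "matnorm G k X = Sup {norm (tuple {..<k} (mat_apply k X \<xi>)) | \<xi>.
    (\<forall>j<k. \<xi> j \<in> l2 G) \<and> norm (tuple {..<k} \<xi>) \<le> 1}"
proof -
  have "(sqrt (\<Sum>i<k. (l2norm G (\<lambda>y. \<Sum>j<k. X i j (\<xi> j) y))\<^sup>2) = norm (tuple {..<k} (mat_apply k X \<xi>)))
     \<and> ((\<Sum>j<k. (l2norm G (\<xi> j))\<^sup>2) \<le> 1 \<longleftrightarrow> norm (tuple {..<k} \<xi>) \<le> 1)"
    if \<xi>: "\<forall>j<k. \<xi> j \<in> l2 G" for \<xi>
  proof -
    have 1: "sqrt (\<Sum>i<k. (l2norm G (mat_apply k X \<xi> i))\<^sup>2) = norm (tuple {..<k} (mat_apply k X \<xi>))"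
      using X \<xi> by (intro norm_tuple_sqrt mat_apply_l2) auto
    have 2: "sqrt (\<Sum>i<k. (l2norm G (\<xi> i))\<^sup>2) = norm (tuple {..<k} \<xi>)"
      using \<xi> by (intro norm_tuple_sqrt) auto
    show ?thesis
      using 1 unfolding 2[symmetric] real_sqrt_le_1_iff by (simp only: mat_apply_def)
  qed
  then have "{sqrt (\<Sum>i<k. (l2norm G (\<lambda>y. \<Sum>j<k. X i j (\<xi> j) y))\<^sup>2) | \<xi>.
       (\<forall>j<k. \<xi> j \<in> l2 G) \<and> (\<Sum>j<k. (l2norm G (\<xi> j))\<^sup>2) \<le> 1}
    = {norm (tuple {..<k} (mat_apply k X \<xi>)) | \<xi>. (\<forall>j<k. \<xi> j \<in> l2 G) \<and> norm (tuple {..<k} \<xi>) \<le> 1}"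
    by (intro Collect_cong ex_cong1) auto
  then show ?thesis by (simp add: matnorm_def)
qed

lemma matnorm_le:
  assumes X: "\<And>i j. i < k \<Longrightarrow> j < k \<Longrightarrow> X i j \<in> VN G"
    and K: "kernel_bounded (matrix_kernel G k (\<lambda>i j. symbol G (X i j))) C"
  shows "matnorm G k X \<le> C"
proof (subst matnorm_alt)
  show "X i j \<in> VN G" if "i < k" "j < k" for i j using X[OF that] .
  show "Sup {norm (tuple {..<k} (mat_apply k X \<xi>)) | \<xi>. (\<forall>j<k. \<xi> j \<in> l2 G) \<and> norm (tuple {..<k} \<xi>) \<le> 1} \<le> C"
  proof (rule cSup_least)
  have z: "\<forall>j<k. (\<lambda>_. 0) \<in> l2 G" by (simp add: l2_zero)
  have "tuple {..<k} (\<lambda>j y. 0) = (0 :: (nat \<times> 'a) ell2)" by (simp add: tuple_def zero_ell2_def cong: if_cong)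
  then show "{norm (tuple {..<k} (mat_apply k X \<xi>)) | \<xi>. (\<forall>j<k. \<xi> j \<in> l2 G) \<and> norm (tuple {..<k} \<xi>) \<le> 1} \<noteq> {}"
    using z by (auto intro!: exI[of _ "\<lambda>j y. 0"])
next
  fix r assume "r \<in> {norm (tuple {..<k} (mat_apply k X \<xi>)) | \<xi>. (\<forall>j<k. \<xi> j \<in> l2 G) \<and> norm (tuple {..<k} \<xi>) \<le> 1}"
  then obtain \<xi> where \<xi>: "\<forall>j<k. \<xi> j \<in> l2 G" "norm (tuple {..<k} \<xi>) \<le> 1" "r = norm (tuple {..<k} (mat_apply k X \<xi>))"
    by blast
  have "r \<le> C * norm (tuple {..<k} \<xi>)" unfolding \<xi>(3) using \<xi>(1) by (intro norm_mat_apply_le[OF X _ K]) auto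
  also have "\<dots> \<le> C * 1" using \<xi>(2) kernel_bounded_nonneg[OF K] by (rule mult_left_mono)
  finally show "r \<le> C" by simp
  qed
qed

text \<open>\<open>matnorm\<close> is a supremum of reals and dominates the members of its set only
  if that set is bounded; bounds for the individual entries provide a crude one.\<close>

lemma matnorm_bdd:
  assumes X: "\<And>i j. i < k \<Longrightarrow> j < k \<Longrightarrow> X i j \<in> VN G"
  shows "bdd_above {norm (tuple {..<k} (mat_apply k X \<xi>)) | \<xi>. (\<forall>j<k. \<xi> j \<in> l2 G) \<and> norm (tuple {..<k} \<xi>) \<le> 1}"
proof -
  have "\<exists>C>0. \<forall>f\<in>l2 G. l2norm G (X i j f) \<le> C * l2norm G f" if "i < k" "j < k" for i j
    using bounded_opsD(4)[OF VN_bounded[OF X[OF that]]] .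
  then obtain C where C: "\<And>i j. i < k \<Longrightarrow> j < k \<Longrightarrow> C i j > 0"
    "\<And>i j f. i < k \<Longrightarrow> j < k \<Longrightarrow> f \<in> l2 G \<Longrightarrow> l2norm G (X i j f) \<le> C i j * l2norm G f" by metis
  show ?thesis
  proof (rule bdd_aboveI, clarify)
    fix \<xi> assume \<xi>: "\<forall>j<k. \<xi> j \<in> l2 G" and n1: "norm (tuple {..<k} \<xi>) \<le> 1"
    have l1: "l2norm G (\<xi> j) \<le> 1" if "j < k" for j
    proof -
      have "(l2norm G (\<xi> j))\<^sup>2 \<le> (\<Sum>j<k. (l2norm G (\<xi> j))\<^sup>2)"
        using that by (intro member_le_sum) auto
      also have "\<dots> = (norm (tuple {..<k} \<xi>))\<^sup>2" using \<xi> by (intro norm_tuple[symmetric]) auto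
      also have "\<dots> \<le> 1\<^sup>2" using n1 by (intro power_mono) auto
      finally show ?thesis by (rule power2_le_imp_le) simp
    qed
    have l2: "l2norm G (mat_apply k X \<xi> i) \<le> (\<Sum>j<k. C i j)" if i: "i < k" for i
    proof -
      have m: "X i j (\<xi> j) \<in> l2 G" if "j < k" for j
        using bounded_opsD(1)[OF VN_bounded[OF X[OF i that]]] \<xi> that by blast
      have "Ell2 (mat_apply k X \<xi> i) = (\<Sum>j<k. Ell2 (X i j (\<xi> j)))"
        using mat_apply_l2[of k X i G \<xi>] X \<xi> i m
        by (intro ell2_eqI) (auto simp: coef_sum mat_apply_def coef_l2[OF mat_apply_l2[of k X i G \<xi>], unfolded mat_apply_def] coef_l2[OF m])
      then have "l2norm G (mat_apply k X \<xi> i) = norm (\<Sum>j<k. Ell2 (X i j (\<xi> j)))"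
        using mat_apply_l2[of k X i G \<xi>] X \<xi> i by (simp add: l2norm_eq)
      also have "\<dots> \<le> (\<Sum>j<k. C i j)"
      proof (rule sum_norm_le)
        fix j assume "j \<in> {..<k}"
        then have j: "j < k" by simp
        have "norm (Ell2 (X i j (\<xi> j))) \<le> C i j * l2norm G (\<xi> j)"
          using C(2)[OF i j, of "\<xi> j"] \<xi> j l2norm_eq[OF m[OF j]] by simp
        also have "\<dots> \<le> C i j * 1" using l1[OF j] C(1)[OF i j] by (intro mult_left_mono) auto
        finally show "norm (Ell2 (X i j (\<xi> j))) \<le> C i j" by simp
      qed
      finally show ?thesis .
    qed
    have "norm (tuple {..<k} (mat_apply k X \<xi>)) = sqrt (\<Sum>i<k. (l2norm G (mat_apply k X \<xi> i))\<^sup>2)"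
      using X \<xi> by (intro norm_tuple_sqrt[symmetric] mat_apply_l2) auto
    also have "\<dots> \<le> sqrt (\<Sum>i<k. (\<Sum>j<k. C i j)\<^sup>2)"
      using l2 X \<xi> by (intro real_sqrt_le_mono sum_mono power_mono)
        (auto simp: l2norm_eq[OF mat_apply_l2[of k X _ G \<xi>]])
    finally show "norm (tuple {..<k} (mat_apply k X \<xi>)) \<le> sqrt (\<Sum>i<k. (\<Sum>j<k. C i j)\<^sup>2)" .
  qed
qed

text \<open>\<open>matnorm\<close> controls the unit ball; homogeneity extends the estimate to all
  tuples. Together with \<open>matnorm_le\<close> this makes \<open>matnorm\<close> the least kernel
  bound.\<close>

lemma kernel_bounded_matnorm:
  assumes X: "\<And>i j. i < k \<Longrightarrow> j < k \<Longrightarrow> X i j \<in> VN G"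
  shows "kernel_bounded (matrix_kernel G k (\<lambda>i j. symbol G (X i j))) (matnorm G k X)"
proof -
  have le: "norm (tuple {..<k} (mat_apply k X \<xi>)) \<le> matnorm G k X"
    if "\<And>j. j < k \<Longrightarrow> \<xi> j \<in> l2 G" "norm (tuple {..<k} \<xi>) \<le> 1" for \<xi>
  proof -
    have "norm (tuple {..<k} (mat_apply k X \<xi>)) \<le> Sup {norm (tuple {..<k} (mat_apply k X \<xi>)) | \<xi>.
        (\<forall>j<k. \<xi> j \<in> l2 G) \<and> norm (tuple {..<k} \<xi>) \<le> 1}"
      using that X by (intro cSup_upper matnorm_bdd) auto
    also have "\<dots> = matnorm G k X" using X by (intro matnorm_alt[symmetric])
    finally show ?thesis .
  qed
  show ?thesis
  proof (rule kernel_bounded_gkerI[OF X])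
    have "tuple {..<k} (\<lambda>j y. 0) = (0 :: (nat \<times> 'a) ell2)" by (simp add: tuple_def zero_ell2_def cong: if_cong)
    then have "0 \<le> norm (tuple {..<k} (mat_apply k X (\<lambda>j y. 0)))" "norm (tuple {..<k} (mat_apply k X (\<lambda>j y. 0))) \<le> matnorm G k X"
      by (auto intro!: le simp: l2_zero)
    then show "0 \<le> matnorm G k X" by linarith
    fix \<xi> assume \<xi>: "\<And>j. j < k \<Longrightarrow> \<xi> j \<in> l2 G"
    let ?n = "norm (tuple {..<k} \<xi>)"
    have jx: "tuple {..<k} (\<lambda>j y. a * \<xi> j y) = cscale a (tuple {..<k} \<xi>)" for a
      using \<xi> by (intro tuple_scale) auto
    have jm: "tuple {..<k} (mat_apply k X (\<lambda>j y. a * \<xi> j y)) = cscale a (tuple {..<k} (mat_apply k X \<xi>))" for a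
    proof -
      have "tuple {..<k} (mat_apply k X (\<lambda>j y. a * \<xi> j y)) = tuple {..<k} (\<lambda>i y. a * mat_apply k X \<xi> i y)"
        unfolding tuple_def using X \<xi> by (intro arg_cong[where f=Ell2] ext) (simp add: mat_apply_scale)
      also have "\<dots> = cscale a (tuple {..<k} (mat_apply k X \<xi>))"
        using X \<xi> by (intro tuple_scale mat_apply_l2) auto
      finally show ?thesis .
    qed
    show "norm (tuple {..<k} (mat_apply k X \<xi>)) \<le> matnorm G k X * ?n"
    proof (cases "?n = 0")
      case True
      have "norm (tuple {..<k} (mat_apply k X \<xi>)) \<le> e" if e: "0 < e" for e
      proof -
        \<comment> \<open>All multiples of a tuple of norm zero stay in the unit ball. The multiple
          by N / e, with N positive and at least \<open>matnorm G k X\<close>, forces the norm of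
          the image below e.\<close>
        define N where "N = \<bar>matnorm G k X\<bar> + 1"
        have "N > 0" by (simp add: N_def)
        have "norm (tuple {..<k} (mat_apply k X (\<lambda>j y. complex_of_real (N / e) * \<xi> j y))) \<le> matnorm G k X"
          using \<xi> True by (intro le l2_scale) (auto simp only: jx norm_cscale)
        then have "N / e * norm (tuple {..<k} (mat_apply k X \<xi>)) \<le> matnorm G k X"
          using \<open>N > 0\<close> e by (simp add: jm norm_cscale del: of_real_divide)
        also have "\<dots> \<le> N" by (simp add: N_def)
        finally show ?thesis using \<open>N > 0\<close> e by (simp add: field_simps)
      qed
      then show ?thesis using True field_le_epsilon[of "norm (tuple {..<k} (mat_apply k X \<xi>))" 0] by simp
    next
      case False
      then have n: "?n > 0" by simp
      have "norm (tuple {..<k} (mat_apply k X (\<lambda>j y. complex_of_real (1 / ?n) * \<xi> j y))) \<le> matnorm G k X"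
        using \<xi> n by (intro le l2_scale) (auto simp: jx norm_cscale simp del: of_real_divide)
      then have "1 / ?n * norm (tuple {..<k} (mat_apply k X \<xi>)) \<le> matnorm G k X"
        using n by (simp add: jm norm_cscale del: of_real_divide)
      then show ?thesis using n by (simp add: field_simps)
    qed
  qed
qed

end

section \<open>Bounded convolvers as elements of the group von Neumann algebra\<close>

lemma kernel_bounded_matrix_kernel_1: "kernel_bounded (matrix_kernel G 1 (\<lambda>i j. x)) C \<longleftrightarrow> kernel_bounded (conv_kernel G x) C"
proof
  assume "kernel_bounded (matrix_kernel G 1 (\<lambda>i j. x)) C"
  then show "kernel_bounded (conv_kernel G x) C"
    by (rule kernel_bounded_reindex[where p="Pair 0" and S=UNIV and q="Pair 0" and T=UNIV])
      (auto simp: matrix_kernel_def conv_kernel_def inj_on_def)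
next
  assume "kernel_bounded (conv_kernel G x) C"
  then show "kernel_bounded (matrix_kernel G 1 (\<lambda>i j. x)) C"
    by (rule kernel_bounded_reindex[where p=snd and S="{p. fst p = 0}" and q=snd and T="{p. fst p = 0}"])
      (auto simp: matrix_kernel_def conv_kernel_def inj_on_def)
qed

context group
begin

lemma coef_conv_outside:
  assumes "kernel_bounded (conv_kernel G x) C" "s \<notin> carrier G"
  shows "coef (kernel_op (conv_kernel G x) v) s = 0"
  unfolding coef_kernel_op[OF assms(1)] using assms(2) by (intro infsum_0) (simp add: conv_kernel_def)

lemma conv_op_bounded:
  assumes x: "kernel_bounded (conv_kernel G x) C"
  shows "conv_op G x \<in> bounded_ops G"
proof -
  let ?T = "kernel_op (conv_kernel G x)"
  have l2: "coef (?T v) \<in> l2 G" for v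
    by (rule coef_in_l2) (rule coef_conv_outside[OF x])
  have lin: "?T (f + g) = ?T f + ?T g" for f g
    using linear_add[OF bounded_linear.linear[OF kernel_op_bounded_linear[OF x]]] .
  have "conv_op G x (\<lambda>y. a * f y + b * g y) = (\<lambda>y. a * conv_op G x f y + b * conv_op G x g y)"
    if "f \<in> l2 G" "g \<in> l2 G" for f g a b
    using that l2_lincomb[OF that, of a b] by (simp add: conv_op_def lin kernel_op_cscale[OF x] fun_eq_iff coef_add coef_cscale)
  moreover have "conv_op G x f \<in> l2 G" if "f \<in> l2 G" for f
    using that l2 by (simp add: conv_op_def)
  moreover have "conv_op G x f = (\<lambda>_. 0)" if "f \<notin> l2 G" for f
    using that by (simp add: conv_op_def)
  moreover have "l2norm G (conv_op G x f) \<le> C * l2norm G f" if "f \<in> l2 G" for f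
    using that norm_kernel_op[OF x, of "Ell2 f"] by (simp add: conv_op_def l2norm_eq[OF l2] l2norm_eq[OF that] coef_inverse)
  ultimately show ?thesis unfolding bounded_ops_def by blast
qed

lemma symbol_conv_op:
  assumes x: "kernel_bounded (conv_kernel G x) C" and x0: "\<And>s. s \<notin> carrier G \<Longrightarrow> x s = 0"
  shows "symbol G (conv_op G x) = x"
proof
  fix s
  have "Ell2 (dirac \<one>) = delta \<one>" by (simp add: dirac_def delta_def)
  then have "symbol G (conv_op G x) s = conv_kernel G x s \<one>"
    using dirac_l2[OF one_closed] by (simp add: symbol_def conv_op_def coef_kernel_op_delta[OF x])
  then show "symbol G (conv_op G x) s = x s" using x0 by (simp add: conv_kernel_def)
qed

text \<open>The members of \<open>F\<close> form one tuple. A single approximation of its image by a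
  combination of its translates, from \<open>convolver_in_closure\<close>, approximates the
  convolver on every member of \<open>F\<close> with the same coefficients.\<close>

lemma conv_op_VN:
  assumes x: "kernel_bounded (conv_kernel G x) C"
  shows "conv_op G x \<in> VN G"
  unfolding VN_def
proof (intro CollectI conjI allI impI conv_op_bounded[OF x])
  fix F :: "('a \<Rightarrow> complex) set" and e :: real assume "finite F \<and> F \<subseteq> l2 G \<and> e > 0"
  then have F: "finite F" "F \<subseteq> l2 G" and e: "e > 0" by auto
  define \<Xi> where "\<Xi> = tuple F (\<lambda>\<xi>. \<xi>)"
  have c: "coef \<Xi> (\<xi>, s) = (if \<xi> \<in> F then \<xi> s else 0)" for \<xi> s
    unfolding \<Xi>_def using F by (intro coef_tuple[where G=G]) auto
  have "coef \<Xi> (\<xi>, s) = 0" if "s \<notin> carrier G" for \<xi> s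
    using F that by (auto simp: c l2_zero_outside)
  from convolver_in_closure[OF x, of \<Xi>, OF this]
  obtain w where w: "w \<in> {\<Sum>g\<in>A. cscale (c g) (ampl_trans G g \<Xi>) | A c. finite A \<and> A \<subseteq> carrier G}"
    and d: "dist w (kernel_op (ampl_kernel G x) \<Xi>) < e"
    using e unfolding closure_approachable by blast
  obtain A a where A: "finite A" "A \<subseteq> carrier G" and w: "w = (\<Sum>g\<in>A. cscale (a g) (ampl_trans G g \<Xi>))"
    using w by blast
  define S where "S = (\<lambda>f y. \<Sum>g\<in>A. a g * lreg G g f y)"
  have S: "S \<in> lspan G" unfolding lspan_def S_def using A by blast
  have lk: "kernel_bounded (ampl_kernel G x :: ('a \<Rightarrow> complex) \<times> 'a \<Rightarrow> _ \<Rightarrow> complex) C" by (rule kernel_bounded_ampl_kernel[OF x])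
  have "l2norm G (\<lambda>y. conv_op G x \<xi> y - S \<xi> y) < e" if \<xi>: "\<xi> \<in> F" for \<xi>
  proof -
    have l2: "\<xi> \<in> l2 G" using F \<xi> by blast
    have "coef w (\<xi>, y) = S \<xi> y" for y
      unfolding w S_def coef_sum coef_cscale using A \<xi> l2
      by (intro sum.cong refl) (auto simp: coef_ampl_trans lreg_def c subset_iff)
    moreover have "coef (kernel_op (ampl_kernel G x) \<Xi>) (\<xi>, y) = conv_op G x \<xi> y" for y
    proof -
      have "coef (kernel_op (ampl_kernel G x) \<Xi>) (\<xi>, y) = (\<Sum>\<^sub>\<infinity>q. ampl_kernel G x (\<xi>, y) q * coef \<Xi> q)"
        by (rule coef_kernel_op[OF lk])
      also have "\<dots> = (\<Sum>\<^sub>\<infinity>q\<in>range (Pair \<xi>). ampl_kernel G x (\<xi>, y) q * coef \<Xi> q)"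
        by (rule infsum_cong_neutral) (auto simp: ampl_kernel_def)
      also have "\<dots> = (\<Sum>\<^sub>\<infinity>t. conv_kernel G x y t * \<xi> t)"
        by (subst infsum_reindex) (auto simp: inj_on_def o_def ampl_kernel_def c \<xi>)
      also have "\<dots> = conv_op G x \<xi> y"
        using l2 by (simp add: conv_op_def coef_kernel_op[OF x] coef_l2[OF l2])
      finally show ?thesis .
    qed
    ultimately have "(\<lambda>y. conv_op G x \<xi> y - S \<xi> y) = (\<lambda>y. coef (kernel_op (ampl_kernel G x) \<Xi> - w) (\<xi>, y))"
      by (simp add: coef_diff)
    then have "l2norm G (\<lambda>y. conv_op G x \<xi> y - S \<xi> y) \<le> norm (kernel_op (ampl_kernel G x) \<Xi> - w)"
      using l2norm_slice by simp
    also have "\<dots> < e" using d by (simp add: dist_norm norm_minus_commute)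
    finally show ?thesis .
  qed
  then show "\<exists>S\<in>lspan G. \<forall>\<xi>\<in>F. l2norm G (\<lambda>y. conv_op G x \<xi> y - S \<xi> y) < e" using S by blast
qed

lemma kernel_bounded_symbol:
  assumes T: "T \<in> VN G"
  shows "kernel_bounded (conv_kernel G (symbol G T)) (matnorm G 1 (\<lambda>i j. T))"
  using kernel_bounded_matnorm[of 1 "\<lambda>i j. T"] T by (simp add: kernel_bounded_matrix_kernel_1[unfolded One_nat_def])

lemma conv_op_symbol:
  assumes T: "T \<in> VN G"
  shows "conv_op G (symbol G T) = T"
proof
  fix f
  show "conv_op G (symbol G T) f = T f"
  proof (cases "f \<in> l2 G")
    case True
    show ?thesis
    proof
      fix s
      have "conv_op G (symbol G T) f s = (\<Sum>\<^sub>\<infinity>t. conv_kernel G (symbol G T) s t * f t)"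
        using True by (simp add: conv_op_def coef_kernel_op[OF kernel_bounded_symbol[OF T]] coef_l2[OF True])
      also have "\<dots> = T f s" by (rule infsumI[OF VN_has_sum[OF T True]])
      finally show "conv_op G (symbol G T) f s = T f s" .
    qed
  next
    case False
    then show ?thesis using bounded_opsD(2)[OF VN_bounded[OF T]] by (simp add: conv_op_def)
  qed
qed

lemma conv_op_lincomb:
  assumes x: "kernel_bounded (conv_kernel G x) C" and y: "kernel_bounded (conv_kernel G y) D"
  shows "conv_op G (\<lambda>s. a * x s + b * y s) = (\<lambda>f s. a * conv_op G x f s + b * conv_op G y f s)"
proof -
  have "coef (kernel_op (conv_kernel G (\<lambda>s. a * x s + b * y s)) v) s
      = a * coef (kernel_op (conv_kernel G x) v) s + b * coef (kernel_op (conv_kernel G y) v) s" for v s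
  proof -
    have eq: "conv_kernel G (\<lambda>s. a * x s + b * y s) p q * coef v q
        = a * (conv_kernel G x p q * coef v q) + b * (conv_kernel G y p q * coef v q)" for p q
      by (simp add: conv_kernel_def algebra_simps)
    have sm: "(\<lambda>q. a * (conv_kernel G x p q * coef v q)) summable_on UNIV"
       "(\<lambda>q. b * (conv_kernel G y p q * coef v q)) summable_on UNIV" for p
      by (intro summable_on_cmult_right kernel_op_summable[OF x] kernel_op_summable[OF y])+
    have inf: "(\<Sum>\<^sub>\<infinity>q. conv_kernel G (\<lambda>s. a * x s + b * y s) p q * coef v q)
        = a * coef (kernel_op (conv_kernel G x) v) p + b * coef (kernel_op (conv_kernel G y) v) p" for p
      unfolding eq infsum_add[OF sm] by (simp add: infsum_cmult_right' coef_kernel_op[OF x] coef_kernel_op[OF y])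
    \<comment> \<open>The series for the combination agree with the coefficients of a vector that
      already exists, which settles their square-summability.\<close>
    have "coef (kernel_op (conv_kernel G (\<lambda>s. a * x s + b * y s)) v)
        = (\<lambda>p. a * coef (kernel_op (conv_kernel G x) v) p + b * coef (kernel_op (conv_kernel G y) v) p)"
    proof -
      have "(\<lambda>p. a * coef (kernel_op (conv_kernel G x) v) p + b * coef (kernel_op (conv_kernel G y) v) p)
          = coef (cscale a (kernel_op (conv_kernel G x) v) + cscale b (kernel_op (conv_kernel G y) v))"
        by (simp add: fun_eq_iff coef_add coef_cscale)
      then show ?thesis unfolding kernel_op_def inf by (metis coef_inverse)
    qed
    then show ?thesis by simp
  qed
  then show ?thesis by (auto simp: conv_op_def fun_eq_iff)
qed

lemma kernel_bounded_symbol_iff_symbol_bounded: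
  "symbol_bounded G (carrier G) k (\<lambda>i j. symbol G (X i j)) C \<longleftrightarrow> kernel_bounded (matrix_kernel G k (\<lambda>i j. symbol G (X i j))) C"
proof -
  have "matrix_kernel G k (\<lambda>i j a. if a \<in> carrier G then symbol G (X i j) a else 0) = matrix_kernel G k (\<lambda>i j. symbol G (X i j))"
    by (auto simp: matrix_kernel_def fun_eq_iff)
  then show ?thesis by (simp add: symbol_bounded_def)
qed

end

section \<open>Transport of operators along reindexings\<close>

text \<open>Contravariant: operators travel from \<open>G\<close> to \<open>H\<close> by pulling
  symbols back along \<open>\<phi>\<close>, which runs from \<open>H\<close> to \<open>G\<close>.
  Truncation to the carrier makes the pulled back function equal to the symbol of its
  convolver.\<close>

definition transport :: "('a, 'b) monoid_scheme \<Rightarrow> ('c, 'd) monoid_scheme \<Rightarrow> ('c \<Rightarrow> 'a) \<Rightarrow> 'a op \<Rightarrow> 'c op" where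
  "transport G H \<phi> T = conv_op H (\<lambda>b. if b \<in> carrier H then symbol G T (\<phi> b) else 0)"

text \<open>The constant of \<open>cb_map\<close> bounds all matrix norms, because
  \<open>matnorm\<close> is itself a kernel bound on the side of \<open>G\<close> and lies below
  every kernel bound on the side of \<open>H\<close>.\<close>

lemma transport:
  assumes G: "group G" and H: "group H" and \<phi>: "cb_map H (carrier H) G (carrier G) \<phi>"
  shows transport_VN: "T \<in> VN G \<Longrightarrow> transport G H \<phi> T \<in> VN H"
    and symbol_transport: "T \<in> VN G \<Longrightarrow> symbol H (transport G H \<phi> T) = (\<lambda>b. if b \<in> carrier H then symbol G T (\<phi> b) else 0)"
    and completely_bounded_transport: "completely_bounded G H (transport G H \<phi>)"
    and linear_transport: "linear_on_VN G (transport G H \<phi>)"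
proof -
  interpret G: group G by fact
  interpret H: group H by fact
  obtain D where D: "D \<ge> 0" "\<And>k X C. symbol_bounded G (carrier G) k X C \<Longrightarrow> symbol_bounded H (carrier H) k (\<lambda>i j a. X i j (\<phi> a)) (D * C)"
    using \<phi> unfolding cb_map_def by blast
  define y where "y T = (\<lambda>b. if b \<in> carrier H then symbol G T (\<phi> b) else 0)" for T
  have tr: "transport G H \<phi> T = conv_op H (y T)" for T by (simp add: transport_def y_def)
  have mat: "kernel_bounded (matrix_kernel H k (\<lambda>i j. y (X i j))) (D * C)" if "kernel_bounded (matrix_kernel G k (\<lambda>i j. symbol G (X i j))) C" for k X C
    using D(2)[OF G.kernel_bounded_symbol_iff_symbol_bounded[THEN iffD2, OF that]] by (simp add: symbol_bounded_def y_def)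
  have y_bd: "kernel_bounded (conv_kernel H (y T)) (D * matnorm G 1 (\<lambda>i j. T))" if "T \<in> VN G" for T
    using mat[of 1 "\<lambda>i j. T"] G.kernel_bounded_symbol[OF that] by (simp add: kernel_bounded_matrix_kernel_1[unfolded One_nat_def])
  show VN: "transport G H \<phi> T \<in> VN H" if "T \<in> VN G" for T
    unfolding tr by (rule H.conv_op_VN[OF y_bd[OF that]])
  show sy: "symbol H (transport G H \<phi> T) = (\<lambda>b. if b \<in> carrier H then symbol G T (\<phi> b) else 0)" if "T \<in> VN G" for T
    unfolding tr y_def[symmetric] by (rule H.symbol_conv_op[OF y_bd[OF that]]) (simp add: y_def)
  show "completely_bounded G H (transport G H \<phi>)"
    unfolding completely_bounded_def
  proof (intro exI[of _ D] allI impI)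
    fix k :: nat and X assume X: "\<forall>i<k. \<forall>j<k. X i j \<in> VN G"
    have "kernel_bounded (matrix_kernel H k (\<lambda>i j. y (X i j))) (D * matnorm G k X)"
      using X by (intro mat G.kernel_bounded_matnorm) auto
    moreover have "matrix_kernel H k (\<lambda>i j. symbol H (transport G H \<phi> (X i j))) = matrix_kernel H k (\<lambda>i j. y (X i j))"
      using X sy by (auto simp: matrix_kernel_def fun_eq_iff y_def)
    ultimately show "matnorm H k (\<lambda>i j. transport G H \<phi> (X i j)) \<le> D * matnorm G k X"
      using X VN by (intro H.matnorm_le) auto
  qed
  show "linear_on_VN G (transport G H \<phi>)"
    unfolding linear_on_VN_def
  proof (intro ballI allI)
    fix S T a b assume S: "S \<in> VN G" and T: "T \<in> VN G"
    have "y (\<lambda>f s. a * S f s + b * T f s) = (\<lambda>s. a * y S s + b * y T s)"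
      by (auto simp: y_def symbol_def fun_eq_iff)
    then show "transport G H \<phi> (\<lambda>f s. a * S f s + b * T f s)
        = (\<lambda>f s. a * transport G H \<phi> S f s + b * transport G H \<phi> T f s)"
      unfolding tr by (simp add: H.conv_op_lincomb[OF y_bd[OF S] y_bd[OF T]])
  qed
qed

theorem cb_equiv_imp_completely_isomorphic:
  assumes G: "group G" and H: "group H" and "cb_equiv G (carrier G) H (carrier H)"
  shows "completely_isomorphic G H"
proof -
  interpret G: group G by fact
  interpret H: group H by fact
  obtain \<theta> \<theta>' where \<theta>: "\<And>a. a \<in> carrier G \<Longrightarrow> \<theta> a \<in> carrier H \<and> \<theta>' (\<theta> a) = a"
      and \<theta>': "\<And>b. b \<in> carrier H \<Longrightarrow> \<theta>' b \<in> carrier G \<and> \<theta> (\<theta>' b) = b"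
      and symbol_bounded: "cb_map G (carrier G) H (carrier H) \<theta>" "cb_map H (carrier H) G (carrier G) \<theta>'"
    using assms(3) unfolding cb_equiv_def by blast
  let ?u = "transport G H \<theta>'" and ?v = "transport H G \<theta>"
  have vu: "?v (?u T) = T" if T: "T \<in> VN G" for T
  proof -
    have "?v (?u T) = conv_op G (\<lambda>a. if a \<in> carrier G then symbol G T a else 0)"
      unfolding transport_def[of H G] symbol_transport[OF G H symbol_bounded(2) T] using \<theta>
      by (intro arg_cong[where f="conv_op G"]) auto
    also have "(\<lambda>a. if a \<in> carrier G then symbol G T a else 0) = symbol G T"
      using G.symbol_zero_outside[OF T] by auto
    finally show ?thesis using G.conv_op_symbol[OF T] by simp
  qed
  have uv: "?u (?v S) = S" if S: "S \<in> VN H" for S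
  proof -
    have "?u (?v S) = conv_op H (\<lambda>a. if a \<in> carrier H then symbol H S a else 0)"
      unfolding transport_def[of G H] symbol_transport[OF H G symbol_bounded(1) S] using \<theta>'
      by (intro arg_cong[where f="conv_op H"]) auto
    also have "(\<lambda>a. if a \<in> carrier H then symbol H S a else 0) = symbol H S"
      using H.symbol_zero_outside[OF S] by auto
    finally show ?thesis using H.conv_op_symbol[OF S] by simp
  qed
  have bij: "bij_betw ?u (VN G) (VN H)"
    using transport_VN[OF G H symbol_bounded(2)] transport_VN[OF H G symbol_bounded(1)] vu uv
    by (intro bij_betwI[where g="?v"]) auto
  have inv: "inv_into (VN G) ?u S = ?v S" if S: "S \<in> VN H" for S
    using bij uv[OF S] transport_VN[OF H G symbol_bounded(1) S] by (metis bij_betw_inv_into_left)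
  have "completely_bounded H G (inv_into (VN G) ?u)"
  proof -
    obtain C where C: "\<forall>k\<ge>1. \<forall>X. (\<forall>i<k. \<forall>j<k. X i j \<in> VN H) \<longrightarrow>
       matnorm G k (\<lambda>i j. ?v (X i j)) \<le> C * matnorm H k X"
      using completely_bounded_transport[OF H G symbol_bounded(1)] unfolding completely_bounded_def by blast
    \<comment> \<open>Entries with an index \<open>\<ge> k\<close> may lie outside
      \<open>VN H\<close>, where \<open>inv_into\<close> and \<open>?v\<close> can differ;
      \<open>matnorm\<close> never reads them.\<close>
    have "matnorm G k (\<lambda>i j. inv_into (VN G) ?u (X i j)) = matnorm G k (\<lambda>i j. ?v (X i j))"
      if "\<forall>i<k. \<forall>j<k. X i j \<in> VN H" for k X
    proof -
      have "(\<Sum>j<k. inv_into (VN G) ?u (X i j) (\<xi> j) y) = (\<Sum>j<k. ?v (X i j) (\<xi> j) y)" if "i < k" for i \<xi> y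
        using \<open>\<forall>i<k. \<forall>j<k. X i j \<in> VN H\<close> that inv by (intro sum.cong refl) simp
      then show ?thesis unfolding matnorm_def by (simp cong: sum.cong_simp)
    qed
    then show ?thesis unfolding completely_bounded_def using C by (intro exI[of _ C]) simp
  qed
  then show ?thesis
    unfolding completely_isomorphic_def
    using bij linear_transport[OF G H symbol_bounded(2)] completely_bounded_transport[OF G H symbol_bounded(2)] by blast
qed

section \<open>Free groups\<close>

lemma inv_letter [simp]: "fg_inv_letter (fg_inv_letter a) = a" "fg_inv_letter a \<noteq> a" "fst (fg_inv_letter a) = fst a"
  "snd (fg_inv_letter a) \<longleftrightarrow> \<not> snd a"
  by (cases a, simp add: fg_inv_letter_def)+

lemma reduced_Cons: "fg_reduced (a # w) \<longleftrightarrow> (w = [] \<or> hd w \<noteq> fg_inv_letter a) \<and> fg_reduced w"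
  by (cases w) auto

lemma reduced_append:
  "fg_reduced (u @ v) \<longleftrightarrow> fg_reduced u \<and> fg_reduced v \<and> (u = [] \<or> v = [] \<or> hd v \<noteq> fg_inv_letter (last u))"
  by (induction u) (auto simp: reduced_Cons hd_append)

lemma push_reduced: "fg_reduced v \<Longrightarrow> fg_reduced (fg_push a v)"
  by (auto simp: fg_push_def reduced_Cons split: list.splits)

lemma push_Cons: "fg_reduced (a # v) \<Longrightarrow> fg_push a v = a # v"
  by (auto simp: fg_push_def reduced_Cons split: list.splits)

lemma push_cancel [simp]: "fg_push a (fg_inv_letter a # v) = v" "fg_push (fg_inv_letter a) (a # v) = v"
  by (auto simp: fg_push_def)

lemma push_push: "fg_reduced v \<Longrightarrow> fg_push a (fg_push (fg_inv_letter a) v) = v"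
  by (cases v) (auto simp: fg_push_def reduced_Cons split: list.splits)

lemma set_push: "set (fg_push a v) \<subseteq> insert a (set v)"
  by (auto simp: fg_push_def split: list.splits if_splits)

abbreviation word_mult :: "fg_letter list \<Rightarrow> fg_letter list \<Rightarrow> fg_letter list" where
  "word_mult w v \<equiv> foldr fg_push w v"

lemma word_mult_reduced: "fg_reduced v \<Longrightarrow> fg_reduced (word_mult w v)"
  by (induction w) (auto intro: push_reduced)

lemma set_word_mult: "set (word_mult w v) \<subseteq> set w \<union> set v"
proof (induction w)
  case (Cons a w)
  then show ?case using set_push[of a "word_mult w v"] by auto
qed simp

text \<open>If \<open>a\<close> cancels the head of \<open>v\<close>, the right side pushes a letter
  after its inverse onto a reduced word, which \<open>push_push\<close> undoes. Associativity is
  this step iterated.\<close>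

lemma word_mult_push: "fg_reduced u \<Longrightarrow> word_mult (fg_push a v) u = fg_push a (word_mult v u)"
  using push_push[of "word_mult _ u" a] word_mult_reduced[of u]
  by (cases v) (auto simp: fg_push_def[of a "_ # _"] fg_push_def[of a "[]"])

lemma word_mult_assoc: "fg_reduced u \<Longrightarrow> word_mult (word_mult w v) u = word_mult w (word_mult v u)"
  by (induction w) (simp_all add: word_mult_push)

lemma word_mult_append: "fg_reduced (w @ v) \<Longrightarrow> word_mult w v = w @ v"
  by (induction w) (auto simp: reduced_Cons push_Cons)

definition word_inv :: "fg_letter list \<Rightarrow> fg_letter list" where
  "word_inv w = rev (map fg_inv_letter w)"

lemma word_inv_word_mult: "word_mult (word_inv w) w = []"
  by (induction w) (simp_all add: word_inv_def)

lemma free_grp_simps: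
  "w \<in> carrier (free_grp I) \<longleftrightarrow> fg_reduced w \<and> fst ` set w \<subseteq> I"
  "w \<otimes>\<^bsub>free_grp I\<^esub> v = word_mult w v" "\<one>\<^bsub>free_grp I\<^esub> = []"
  by (auto simp: free_grp_def)

lemma word_mult_closed:
  assumes "fst ` set w \<subseteq> I" "v \<in> carrier (free_grp I)"
  shows "word_mult w v \<in> carrier (free_grp I)"
proof -
  have "fst ` set (word_mult w v) \<subseteq> fst ` (set w \<union> set v)" by (rule image_mono[OF set_word_mult])
  also have "\<dots> \<subseteq> I" using assms unfolding free_grp_simps(1) by blast
  finally show ?thesis using assms unfolding free_grp_simps(1) by (simp add: word_mult_reduced)
qed

lemma group_free_grp: "group (free_grp I)"
proof (rule groupI)
  fix x y assume "x \<in> carrier (free_grp I)" "y \<in> carrier (free_grp I)"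
  then show "x \<otimes>\<^bsub>free_grp I\<^esub> y \<in> carrier (free_grp I)"
    unfolding free_grp_simps(2) by (intro word_mult_closed) (simp_all add: free_grp_simps)
next
  show "\<one>\<^bsub>free_grp I\<^esub> \<in> carrier (free_grp I)" by (simp add: free_grp_simps)
next
  fix x y z assume "x \<in> carrier (free_grp I)" "y \<in> carrier (free_grp I)" "z \<in> carrier (free_grp I)"
  then show "x \<otimes>\<^bsub>free_grp I\<^esub> y \<otimes>\<^bsub>free_grp I\<^esub> z = x \<otimes>\<^bsub>free_grp I\<^esub> (y \<otimes>\<^bsub>free_grp I\<^esub> z)"
    by (simp add: free_grp_simps word_mult_assoc)
next
  fix x assume x: "x \<in> carrier (free_grp I)"
  show "\<one>\<^bsub>free_grp I\<^esub> \<otimes>\<^bsub>free_grp I\<^esub> x = x" by (simp add: free_grp_simps)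
  \<comment> \<open>Multiplying the formal inverse onto the empty word forces a reduced result, and
    associativity still makes it a left inverse.\<close>
  let ?y = "word_mult (word_inv x) []"
  have "?y \<in> carrier (free_grp I)"
    using x by (intro word_mult_closed) (auto simp: free_grp_simps word_inv_def)
  moreover have "word_mult ?y x = []"
    using x by (simp add: free_grp_simps word_mult_assoc word_inv_word_mult)
  ultimately show "\<exists>y\<in>carrier (free_grp I). y \<otimes>\<^bsub>free_grp I\<^esub> x = \<one>\<^bsub>free_grp I\<^esub>"
    by (intro bexI[of _ ?y]) (simp_all add: free_grp_simps)
qed

section \<open>Homomorphisms that rename generators\<close>

definition relabel :: "(nat \<Rightarrow> nat) \<Rightarrow> fg_letter list \<Rightarrow> fg_letter list" where
  "relabel f = map (\<lambda>a. (f (fst a), snd a))"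

lemma relabel_reduced: "inj f \<Longrightarrow> fg_reduced (relabel f w) \<longleftrightarrow> fg_reduced w"
  by (induction w rule: fg_reduced.induct) (auto simp: relabel_def fg_inv_letter_def inj_eq prod_eq_iff)

lemma relabel_push: "inj f \<Longrightarrow> relabel f (fg_push a v) = fg_push (f (fst a), snd a) (relabel f v)"
  by (cases v) (auto simp: relabel_def fg_push_def fg_inv_letter_def inj_eq prod_eq_iff)

lemma relabel_word_mult: "inj f \<Longrightarrow> relabel f (word_mult w v) = word_mult (relabel f w) (relabel f v)"
  by (induction w) (auto simp: relabel_push, simp_all add: relabel_def)

lemma inj_relabel: "inj f \<Longrightarrow> inj (relabel f)"
  unfolding relabel_def by (intro inj_mapI injI) (auto simp: prod_eq_iff inj_eq)

lemma relabel_image: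
  assumes "inj f"
  shows "relabel f ` {w. fg_reduced w \<and> fst ` set w \<subseteq> I} = {w. fg_reduced w \<and> fst ` set w \<subseteq> f ` I}"
proof (intro subset_antisym subsetI)
  fix w assume "w \<in> relabel f ` {w. fg_reduced w \<and> fst ` set w \<subseteq> I}"
  then show "w \<in> {w. fg_reduced w \<and> fst ` set w \<subseteq> f ` I}"
    by (auto simp: relabel_reduced[OF assms]) (auto simp: relabel_def)
next
  fix w assume w: "w \<in> {w. fg_reduced w \<and> fst ` set w \<subseteq> f ` I}"
  let ?v = "map (\<lambda>a. (inv_into UNIV f (fst a), snd a)) w"
  have v: "relabel f ?v = w"
    unfolding relabel_def map_map o_def using w
    by (intro map_idI) (auto simp: prod_eq_iff image_subset_iff intro!: f_inv_into_f)
  have "fst ` set ?v \<subseteq> I" using w assms by (force simp: image_subset_iff)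
  then show "w \<in> relabel f ` {w. fg_reduced w \<and> fst ` set w \<subseteq> I}"
    using v w relabel_reduced[OF assms, of ?v] by (intro image_eqI[of _ _ ?v]) auto
qed

lemma group_hom_relabel:
  assumes "inj f" "f ` I \<subseteq> J"
  shows "group_hom (free_grp I) (free_grp J) (relabel f)"
proof (intro group_hom.intro group_hom_axioms.intro homI group_free_grp)
  show "relabel f w \<in> carrier (free_grp J)" if "w \<in> carrier (free_grp I)" for w
    using that assms by (auto simp: free_grp_simps relabel_reduced) (auto simp: relabel_def)
qed (simp add: free_grp_simps relabel_word_mult[OF assms(1)])

section \<open>Splitting a complete isomorphism along a decomposition\<close>

text \<open>A symbol on \<open>B1\<close> is extended by zero to \<open>B\<close>; by the last
  hypothesis the reindexed symbol on \<open>A\<close> is then supported on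
  \<open>A1\<close>.\<close>

lemma cb_map_restrict:
  assumes \<theta>: "cb_map G A H B \<theta>" and A1: "A1 \<subseteq> A" and B1: "B1 \<subseteq> B"
    and iff: "\<And>a. a \<in> A \<Longrightarrow> \<theta> a \<in> B1 \<longleftrightarrow> a \<in> A1"
  shows "cb_map G A1 H B1 \<theta>"
proof -
  obtain D where D: "D \<ge> 0" "\<And>k X C. symbol_bounded H B k X C \<Longrightarrow> symbol_bounded G A k (\<lambda>i j a. X i j (\<theta> a)) (D * C)"
    using \<theta> unfolding cb_map_def by blast
  show ?thesis
  proof (rule nbmapI[OF D(1)])
    fix k X C assume X: "symbol_bounded H B1 k X C"
    let ?X = "\<lambda>i j b. if b \<in> B1 then X i j b else 0"
    have "matrix_kernel H k (\<lambda>i j b. if b \<in> B then ?X i j b else 0) = matrix_kernel H k ?X"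
      using B1 by (auto simp: matrix_kernel_def fun_eq_iff)
    then have "symbol_bounded H B k ?X C" using X by (simp add: symbol_bounded_def)
    then have "symbol_bounded G A k (\<lambda>i j a. ?X i j (\<theta> a)) (D * C)" by (rule D(2))
    moreover have "matrix_kernel G k (\<lambda>i j a. if a \<in> A then ?X i j (\<theta> a) else 0)
        = matrix_kernel G k (\<lambda>i j a. if a \<in> A1 then X i j (\<theta> a) else 0)"
      using A1 iff by (auto simp: matrix_kernel_def fun_eq_iff)
    ultimately show "symbol_bounded G A1 k (\<lambda>i j a. X i j (\<theta> a)) (D * C)" by (simp add: symbol_bounded_def)
  qed
qed

text \<open>The bijection carries the decomposition along: with \<open>B1\<close> the image of
  \<open>A1\<close>, truncation to \<open>B1\<close> is conjugate to truncation to
  \<open>A1\<close>.\<close>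

lemma cb_equiv_split:
  assumes e: "cb_equiv G A H B" and c: "cb_complemented G A A1"
  obtains B1 where "cb_complemented H B B1" "cb_equiv G A1 H B1" "cb_equiv G (A - A1) H (B - B1)"
proof -
  obtain \<theta> \<theta>' where \<theta>: "\<And>a. a \<in> A \<Longrightarrow> \<theta> a \<in> B \<and> \<theta>' (\<theta> a) = a" and \<theta>': "\<And>b. b \<in> B \<Longrightarrow> \<theta>' b \<in> A \<and> \<theta> (\<theta>' b) = b"
    and symbol_bounded: "cb_map G A H B \<theta>" "cb_map H B G A \<theta>'" using e unfolding cb_equiv_def by blast
  have A1: "A1 \<subseteq> A" using c by (simp add: cb_complemented_def)
  define B1 where "B1 = \<theta> ` A1"
  have B1: "B1 \<subseteq> B" using \<theta> A1 by (auto simp: B1_def)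
  have iff: "\<theta> a \<in> B1 \<longleftrightarrow> a \<in> A1" if "a \<in> A" for a
  proof
    assume "\<theta> a \<in> B1"
    then obtain c where c: "c \<in> A1" "\<theta> a = \<theta> c" by (auto simp: B1_def)
    then have "a = c" using \<theta>[OF that] \<theta>[of c] A1 by force
    then show "a \<in> A1" using c by simp
  qed (simp add: B1_def)
  have iff': "\<theta>' b \<in> A1 \<longleftrightarrow> b \<in> B1" if "b \<in> B" for b
    using iff[of "\<theta>' b"] \<theta>'[OF that] by simp
  have "cb_equiv G A1 H B1"
    unfolding cb_equiv_def using cb_map_restrict[OF symbol_bounded(1) A1 B1 iff] cb_map_restrict[OF symbol_bounded(2) B1 A1 iff'] \<theta> \<theta>' A1 B1 iff iff'
    by (intro exI[of _ \<theta>] exI[of _ \<theta>']) (auto simp: subset_iff)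
  moreover have "cb_equiv G (A - A1) H (B - B1)"
  proof -
    have "cb_map G (A - A1) H (B - B1) \<theta>" by (rule cb_map_restrict[OF symbol_bounded(1)]) (use iff \<theta> in auto)
    moreover have "cb_map H (B - B1) G (A - A1) \<theta>'" by (rule cb_map_restrict[OF symbol_bounded(2)]) (use iff' \<theta>' in auto)
    ultimately show ?thesis
      unfolding cb_equiv_def using \<theta> \<theta>' iff iff' by (intro exI[of _ \<theta>] exI[of _ \<theta>']) auto
  qed
  moreover have "cb_complemented H B B1"
  proof -
    have 1: "cb_map H B1 G A1 \<theta>'" by (rule cb_map_restrict[OF symbol_bounded(2) B1 A1 iff'])
    have 2: "cb_map G A1 G A (\<lambda>a. a)" using c by (simp add: cb_complemented_def)
    have "cb_map H B1 H B (\<lambda>b. \<theta> (\<theta>' b))" by (rule cb_map_comp[OF cb_map_comp[OF 1 2] symbol_bounded(1)])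
    then have "cb_map H B1 H B (\<lambda>b. b)" by (rule cb_map_cong) (use \<theta>' B1 in auto)
    then show ?thesis using B1 by (simp add: cb_complemented_def)
  qed
  ultimately show thesis using that by blast
qed

section \<open>Unions of cosets of a free factor\<close>

text \<open>For \<open>S\<close> disjoint from \<open>J\<close> this is the union of the left cosets
  g H, where g runs through the generators in \<open>S\<close> and H is the subgroup generated by
  \<open>J\<close>.\<close>

definition pos_cosets :: "nat set \<Rightarrow> nat set \<Rightarrow> fg_letter list set" where
  "pos_cosets S J = {(g, False) # v | g v. g \<in> S \<and> fst ` set v \<subseteq> J \<and> fg_reduced ((g, False) # v)}"

text \<open>If \<open>p = g v\<close> with \<open>g\<close> a generator in \<open>S\<close> and \<open>v\<close> a word over \<open>J\<close>, then \<open>p t\<close> either starts with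
  \<open>g\<close> and agrees with \<open>t\<close> after \<open>g\<close> and the \<open>J\<close>-prefixes are stripped, or \<open>v\<close> cancels the
  \<open>J\<close>-prefix of \<open>t\<close> and \<open>g\<close> the next letter. So the indicator of \<open>s t\<inverse> \<in> pos_cosets S J\<close> is a sum of two
  indicators of equalities.\<close>
lemma cb_complemented_pos_cosets:
  assumes SJ: "S \<inter> J = {}"
  shows "cb_complemented (free_grp UNIV) (carrier (free_grp UNIV)) (pos_cosets S J)"
proof -
  let ?F = "free_grp UNIV"
  interpret F: group ?F by (rule group_free_grp)
  let ?d = "dropWhile (\<lambda>a. fst a \<in> J)" and ?t = "takeWhile (\<lambda>a. fst a \<in> J)"
  \<comment> \<open>\<open>None\<close> marks the words to which the case does not apply. It never
    matches, because both \<open>\<alpha>\<close> and \<open>\<beta>'\<close> are compared with a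
    \<open>Some\<close>.\<close>
  define \<alpha> where "\<alpha> s = (case s of [] \<Rightarrow> None | l # s1 \<Rightarrow> if fst l \<in> S \<and> \<not> snd l then Some (?d s1) else None)" for s :: "fg_letter list"
  define \<beta>' where "\<beta>' t = (case ?d t of [] \<Rightarrow> None | l # t' \<Rightarrow> if fst l \<in> S \<and> snd l then Some t' else None)" for t :: "fg_letter list"
  have car: "w \<in> carrier ?F \<longleftrightarrow> fg_reduced w" for w by (simp add: free_grp_simps)
  have sub: "pos_cosets S J \<subseteq> carrier ?F" by (auto simp: pos_cosets_def car)
  have dec: "fg_reduced (?t w) \<and> fg_reduced (?d w) \<and> word_mult (?t w) (?d w) = w" if "fg_reduced w" for w
    using that reduced_append[of "?t w" "?d w"] word_mult_append[of "?t w" "?d w"] by simp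
  have tJ: "fst ` set (?t w) \<subseteq> J" for w by (auto dest: set_takeWhileD)
  have glue: "word_mult h t' = h @ t'" "?d (h @ t') = t'"
    if "fg_reduced h" "fg_reduced t'" "fst ` set h \<subseteq> J" "?d t' = t'" for h t'
  proof -
    have "t' = [] \<or> fst (hd t') \<notin> J" using hd_dropWhile[of "\<lambda>a. fst a \<in> J" t'] that(4) by auto
    then have "fg_reduced (h @ t')"
      using that by (auto simp: reduced_append) (metis image_subset_iff inv_letter(3) last_in_set)
    then show "word_mult h t' = h @ t'" by (rule word_mult_append)
    show "?d (h @ t') = t'" using that by (subst dropWhile_append2) auto
  qed
  have gJ: "fg_reduced ((g, False) # v)" if "g \<in> S" "fst ` set v \<subseteq> J" "fg_reduced v" for g v
    using that SJ by (cases v) (auto simp: reduced_Cons fg_inv_letter_def)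
  \<comment> \<open>The inverse of the \<open>J\<close>-prefix of \<open>t\<close>, a word over
    \<open>J\<close> that strips this prefix.\<close>
  define hi where "hi t = word_mult (word_inv (?t t)) []" for t
  have hi: "fg_reduced (hi t)" "fst ` set (hi t) \<subseteq> J" for t
  proof -
    have "fst ` set (word_inv (?t t)) = fst ` set (?t t)" by (simp add: word_inv_def image_image)
    then have "hi t \<in> carrier (free_grp J)"
      unfolding hi_def using tJ[of t] by (intro word_mult_closed) (simp_all add: free_grp_simps)
    then show "fg_reduced (hi t)" "fst ` set (hi t) \<subseteq> J" by (simp_all add: free_grp_simps)
  qed
  have hi_t: "word_mult (hi t) t = ?d t" if "fg_reduced t" for t
  proof -
    have "word_mult (hi t) t = word_mult (word_inv (?t t)) (word_mult (?t t) (?d t))"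
      using dec[OF that] that by (simp add: hi_def word_mult_assoc)
    also have "\<dots> = word_mult (word_mult (word_inv (?t t)) (?t t)) (?d t)"
      using dec[OF that] by (simp add: word_mult_assoc)
    finally show ?thesis by (simp add: word_inv_word_mult)
  qed
  have mem: "s \<otimes>\<^bsub>?F\<^esub> inv\<^bsub>?F\<^esub> t \<in> pos_cosets S J \<longleftrightarrow> (\<exists>p\<in>pos_cosets S J. word_mult p t = s)"
    if "s \<in> carrier ?F" "t \<in> carrier ?F" for s t
  proof -
    have "s \<otimes>\<^bsub>?F\<^esub> inv\<^bsub>?F\<^esub> t = p \<longleftrightarrow> s = word_mult p t" if p: "p \<in> pos_cosets S J" for p
      unfolding free_grp_simps(2)[symmetric, of p t UNIV] using \<open>s \<in> _\<close> \<open>t \<in> _\<close> subsetD[OF sub p]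
      by (rule F.mult_inv_eq_iff)
    then have "(\<exists>p\<in>pos_cosets S J. s \<otimes>\<^bsub>?F\<^esub> inv\<^bsub>?F\<^esub> t = p) \<longleftrightarrow> (\<exists>p\<in>pos_cosets S J. word_mult p t = s)"
      by (intro bex_cong refl) auto
    then show ?thesis by simp
  qed
  show ?thesis
  proof (rule symbol_bounded_schur2[OF sub, where \<alpha>=\<alpha> and \<beta>="\<lambda>t. Some (?d t)" and \<alpha>'=Some and \<beta>'=\<beta>'])
    fix s t assume s: "s \<in> carrier ?F" and t: "t \<in> carrier ?F"
    have rs: "fg_reduced s" and rt: "fg_reduced t" using s t by (simp_all add: car)
    show "s \<otimes>\<^bsub>?F\<^esub> inv\<^bsub>?F\<^esub> t \<in> pos_cosets S J \<longleftrightarrow> \<alpha> s = Some (?d t) \<or> Some s = \<beta>' t"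
      unfolding mem[OF s t]
    proof
      assume "\<exists>p\<in>pos_cosets S J. word_mult p t = s"
      then obtain g v where g: "g \<in> S" and v: "fst ` set v \<subseteq> J" and r: "fg_reduced ((g, False) # v)"
        and s_eq: "s = fg_push (g, False) (word_mult v t)" by (auto simp: pos_cosets_def)
      \<comment> \<open>\<open>v\<close> meets only the \<open>J\<close>-prefix of \<open>t\<close>:
        the rest is empty or starts with a letter outside \<open>J\<close>, which cannot cancel
        against \<open>h\<close>.\<close>
      define h where "h = word_mult v (?t t)"
      have hJ: "fst ` set h \<subseteq> J"
        using set_word_mult[of v "?t t"] v tJ[of t] unfolding h_def by blast
      have h: "fg_reduced h" unfolding h_def using dec[OF rt] by (intro word_mult_reduced) blast
      have "word_mult v t = word_mult h (?d t)"
        using dec[OF rt] unfolding h_def by (metis word_mult_assoc)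
      then have vt: "word_mult v t = h @ ?d t" and d: "?d (h @ ?d t) = ?d t"
        using glue[OF h _ hJ, of "?d t"] dec[OF rt] by auto
      show "\<alpha> s = Some (?d t) \<or> Some s = \<beta>' t"
      \<comment> \<open>The only possible cancellation is \<open>g\<close> against a leading inverse
        of \<open>g\<close>. As \<open>g \<notin> J\<close>, that letter is then the head of
        \<open>?d t\<close>, and \<open>h\<close> is empty.\<close>
      proof (cases "\<exists>r. h @ ?d t = (g, True) # r")
        case True
        then obtain r where r: "h @ ?d t = (g, True) # r" by blast
        moreover have "g \<notin> J" using SJ g by blast
        ultimately have "?d t = (g, True) # r" using d by simp
        moreover have "s = r" unfolding s_eq vt r by (simp add: fg_push_def fg_inv_letter_def)
        ultimately show ?thesis using g by (simp add: \<beta>'_def)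
      next
        case False
        have "fg_push (g, False) R = (g, False) # R" if "\<nexists>r. R = (g, True) # r" for R
          using that by (cases R) (auto simp: fg_push_def fg_inv_letter_def)
        from this[OF False] have "s = (g, False) # (h @ ?d t)" unfolding s_eq vt .
        then show ?thesis using g d by (simp add: \<alpha>_def)
      qed
    next
      assume "\<alpha> s = Some (?d t) \<or> Some s = \<beta>' t"
      then show "\<exists>p\<in>pos_cosets S J. word_mult p t = s"
      proof
        assume "\<alpha> s = Some (?d t)"
        then obtain g s1 where s1: "s = (g, False) # s1" and g: "g \<in> S" and d: "?d s1 = ?d t"
          unfolding \<alpha>_def by (cases s) (auto split: if_splits)
        have r1: "fg_reduced s1" using rs s1 by (simp add: reduced_Cons)
        \<comment> \<open>\<open>k\<close> exchanges the \<open>J\<close>-prefix of \<open>t\<close>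
          for that of \<open>s1\<close>; the remainders agree by assumption.\<close>
        define k where "k = word_mult (?t s1) (hi t)"
        have k: "fg_reduced k" "fst ` set k \<subseteq> J"
          using hi[of t] word_mult_closed[OF tJ, of "hi t" s1] by (auto simp: k_def free_grp_simps)
        have "word_mult k t = word_mult (?t s1) (?d s1)"
          using rt hi_t[OF rt] by (simp add: k_def word_mult_assoc d)
        then have "word_mult k t = s1" using dec[OF r1] by simp
        then have "word_mult ((g, False) # k) t = s" using rs s1 by (simp add: push_Cons)
        moreover have "(g, False) # k \<in> pos_cosets S J" using g k gJ[OF g k(2,1)] by (auto simp: pos_cosets_def)
        ultimately show ?thesis by blast
      next
        assume "Some s = \<beta>' t"
        then obtain g where g: "g \<in> S" and d: "?d t = (g, True) # s"
          unfolding \<beta>'_def by (cases "?d t") (auto split: if_splits)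
        have "word_mult ((g, False) # hi t) t = s"
          using hi_t[OF rt] d by (simp add: fg_push_def fg_inv_letter_def)
        moreover have "(g, False) # hi t \<in> pos_cosets S J"
          using g hi gJ[OF g hi(2,1)] by (auto simp: pos_cosets_def)
        ultimately show ?thesis by blast
      qed
    qed
    \<comment> \<open>The first equality makes \<open>?d t\<close> shorter than \<open>s\<close>,
      the second makes it longer.\<close>
    show "\<not> (\<alpha> s = Some (?d t) \<and> Some s = \<beta>' t)"
    proof
      assume *: "\<alpha> s = Some (?d t) \<and> Some s = \<beta>' t"
      then have "length (?d t) < length s"
        using length_dropWhile_le[of "\<lambda>a. fst a \<in> J" "tl s"]
        unfolding \<alpha>_def by (cases s) (auto split: if_splits)
      moreover have "length s < length (?d t)"
        using * unfolding \<beta>'_def by (cases "?d t") (auto split: if_splits)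
      ultimately show False by simp
    qed
  qed
qed

lemma pos_cosets_Un: "pos_cosets (S \<union> T) J = pos_cosets S J \<union> pos_cosets T J"
  by (auto simp: pos_cosets_def)

lemma pos_cosets_disjoint: "S \<inter> T = {} \<Longrightarrow> pos_cosets S J \<inter> pos_cosets T J = {}"
  by (auto simp: pos_cosets_def)

lemma pos_cosets_sub: "pos_cosets S J \<subseteq> carrier (free_grp UNIV)"
  by (auto simp: pos_cosets_def free_grp_simps)

lemma relabel_pos_cosets:
  assumes f: "inj f"
  shows "relabel f ` pos_cosets S J = pos_cosets (f ` S) (f ` J)"
proof (intro subset_antisym subsetI)
  fix w assume "w \<in> relabel f ` pos_cosets S J"
  then obtain g v where v: "w = relabel f ((g, False) # v)" "g \<in> S" "fst ` set v \<subseteq> J" "fg_reduced ((g, False) # v)"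
    by (auto simp: pos_cosets_def)
  have "fg_reduced w" using v relabel_reduced[OF f] by simp
  then show "w \<in> pos_cosets (f ` S) (f ` J)" using v by (auto simp: pos_cosets_def relabel_def)
next
  fix w assume "w \<in> pos_cosets (f ` S) (f ` J)"
  then obtain g v where v: "w = (f g, False) # v" "g \<in> S" "fst ` set v \<subseteq> f ` J" "fg_reduced w"
    by (auto simp: pos_cosets_def)
  then have "v \<in> relabel f ` {w. fg_reduced w \<and> fst ` set w \<subseteq> J}"
    unfolding relabel_image[OF f] by (simp add: reduced_Cons)
  then obtain u where u: "v = relabel f u" "fst ` set u \<subseteq> J" by blast
  have w: "w = relabel f ((g, False) # u)" using v(1) u(1) by (simp add: relabel_def)
  then have "(g, False) # u \<in> pos_cosets S J"
    using v u relabel_reduced[OF f, of "(g, False) # u"] by (auto simp: pos_cosets_def)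
  then show "w \<in> relabel f ` pos_cosets S J" using w by blast
qed

text \<open>Hilbert's hotel. The even generators host a copy of the free group on \<open>I\<close>,
  the odd generators 1, 3, 5, ... label its cosets, and \<open>f'\<close> moves the coset of each
  odd i to that of i + 2. This vacates the coset of 1, a translate of that copy, and nothing outside
  the union of the cosets is moved.\<close>

lemma free_grp_absorbs:
  obtains A0 where "cb_complemented (free_grp UNIV) (carrier (free_grp UNIV)) A0"
    "cb_equiv (free_grp I) (carrier (free_grp I)) (free_grp UNIV) A0"
    "cb_equiv (free_grp UNIV) (carrier (free_grp UNIV)) (free_grp UNIV) (carrier (free_grp UNIV) - A0)"
proof -
  let ?F = "free_grp UNIV"
  define f :: "nat \<Rightarrow> nat" where "f i = 2 * i" for i
  define f' :: "nat \<Rightarrow> nat" where "f' i = (if even i then i else i + 2)" for i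
  define J where "J = f ` I"
  have f: "inj f" by (auto simp: f_def inj_def)
  have f': "inj f'" unfolding inj_def f'_def by (auto split: if_splits)
  have Je: "even j" if "j \<in> J" for j using that by (auto simp: J_def f_def)
  let ?A0 = "pos_cosets {1} J" and ?A1 = "pos_cosets ({i. odd i} - {1}) J" and ?U = "pos_cosets {i. odd i} J"
  have "?U = pos_cosets ({1} \<union> ({i. odd i} - {1})) J"
    by (rule arg_cong[where f="\<lambda>S. pos_cosets S J"]) auto
  also have "\<dots> = ?A0 \<union> ?A1" by (rule pos_cosets_Un)
  finally have A: "?U = ?A0 \<union> ?A1" .
  have dj: "?A0 \<inter> ?A1 = {}" by (rule pos_cosets_disjoint) simp
  have c0: "cb_complemented ?F (carrier ?F) ?A0" and c1: "cb_complemented ?F (carrier ?F) ?A1" and c: "cb_complemented ?F (carrier ?F) ?U"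
    using Je by (intro cb_complemented_pos_cosets; force)+
  have "cb_equiv (free_grp I) (carrier (free_grp I)) ?F ((\<lambda>b. [(1, False)] \<otimes>\<^bsub>?F\<^esub> relabel f b) ` carrier (free_grp I))"
    using inj_relabel[OF f] by (intro group_hom.cb_equiv_translate_hom group_hom_relabel f)
      (auto simp: free_grp_simps intro: inj_on_subset)
  also have "(\<lambda>b. [(1, False)] \<otimes>\<^bsub>?F\<^esub> relabel f b) ` carrier (free_grp I)
      = fg_push (1, False) ` relabel f ` {w. fg_reduced w \<and> fst ` set w \<subseteq> I}"
    by (auto simp: free_grp_def image_image)
  also have "\<dots> = ?A0"
  proof -
    have r: "fg_reduced ((1, False) # w)" if "fg_reduced w" "fst ` set w \<subseteq> J" for w
      using that Je[of 1] by (cases w) (auto simp: reduced_Cons fg_inv_letter_def)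
    show ?thesis unfolding relabel_image[OF f] J_def[symmetric]
      using r push_Cons by (force simp: pos_cosets_def image_iff reduced_Cons)
  qed
  finally have e0: "cb_equiv (free_grp I) (carrier (free_grp I)) ?F ?A0" .
  have "cb_equiv ?F ?U ?F ((\<lambda>b. [] \<otimes>\<^bsub>?F\<^esub> relabel f' b) ` ?U)"
    using inj_relabel[OF f'] pos_cosets_sub by (intro group_hom.cb_equiv_translate_hom group_hom_relabel f')
      (auto simp: free_grp_simps intro: inj_on_subset)
  also have "(\<lambda>b. [] \<otimes>\<^bsub>?F\<^esub> relabel f' b) ` ?U = relabel f' ` ?U" by (simp add: free_grp_simps)
  also have "\<dots> = ?A1"
  proof -
    have "f' ` J = J" using Je by (force simp: f'_def image_iff)
    moreover have "f' ` {i. odd i} = {i. odd i} - {1}"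
    proof (intro subset_antisym subsetI)
      fix i assume "i \<in> {i. odd i} - {1 :: nat}"
      then have "odd (i - 2)" "i = f' (i - 2)" by (auto simp: f'_def elim!: oddE)
      then show "i \<in> f' ` {i. odd i}" by blast
    qed (auto simp: f'_def)
    ultimately show ?thesis by (simp add: relabel_pos_cosets[OF f'])
  qed
  finally have e1: "cb_equiv ?F ?U ?F ?A1" .
  let ?R = "carrier ?F - ?U"
  have u: "carrier ?F = ?U \<union> ?R" using pos_cosets_sub[of "{i. odd i}" J] by auto
  have u1: "carrier ?F - ?A0 = ?A1 \<union> ?R" using pos_cosets_sub[of "{i. odd i}" J] A dj by blast
  have "cb_complemented ?F (carrier ?F - ?A0) ?A1"
    by (rule cb_complemented_subset[OF c1 _ cb_complemented_Diff[OF c0]]) (simp only: u1 Un_upper1)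
  then have c1': "cb_complemented ?F (?A1 \<union> ?R) ?A1" by (simp only: u1)
  have c': "cb_complemented ?F (?U \<union> ?R) ?U" using c by (simp only: u[symmetric])
  have "?A1 \<inter> ?R = {}" using A by blast
  \<comment> \<open>The shift on the cosets is glued to the identity on the rest
    \<open>?R\<close>.\<close>
  then have "cb_equiv ?F (?U \<union> ?R) ?F (?A1 \<union> ?R)"
    by (rule cb_equiv_union[OF c' Diff_disjoint c1' _ e1 cb_equiv_refl])
  then have "cb_equiv ?F (carrier ?F) ?F (carrier ?F - ?A0)" by (simp only: u1 u[symmetric])
  then show thesis using that c0 e0 by blast
qed

section \<open>Embedding of the free group on infinitely many generators\<close>

text \<open>The reduced word of an integral power of generator 0, called a below; generator 1 is
  b.\<close>

definition a_power :: "int \<Rightarrow> fg_letter list" where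
  "a_power m = (if m \<ge> 0 then replicate (nat m) (0, False) else replicate (nat (- m)) (0, True))"

lemma push_a_power:
  assumes "r = [] \<or> fst (hd r) \<noteq> 0"
  shows "fg_push (0, False) (a_power m @ r) = a_power (m + 1) @ r" "fg_push (0, True) (a_power m @ r) = a_power (m - 1) @ r"
proof -
  consider "m = 0" | k where "m = int (Suc k)" | k where "m = - int (Suc k)"
    by (metis int_cases nat.exhaust of_nat_0)
  then have "fg_push (0, False) (a_power m @ r) = a_power (m + 1) @ r \<and> fg_push (0, True) (a_power m @ r) = a_power (m - 1) @ r"
  proof cases
    case 1
    then show ?thesis using assms
      by (cases r) (auto simp: a_power_def fg_push_def fg_inv_letter_def)
  next
    case 2
    then have "a_power m = (0, False) # replicate k (0, False)" "a_power (m + 1) = (0, False) # (0, False) # replicate k (0, False)"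
      "a_power (m - 1) = replicate k (0, False)"
      by (auto simp: a_power_def nat_add_distrib)
    then show ?thesis by (simp add: fg_push_def fg_inv_letter_def)
  next
    case 3
    then have "a_power m = (0, True) # replicate k (0, True)" "a_power (m - 1) = (0, True) # (0, True) # replicate k (0, True)"
      "a_power (m + 1) = replicate k (0, True)"
      by (auto simp: a_power_def nat_add_distrib)
    then show ?thesis by (simp add: fg_push_def fg_inv_letter_def)
  qed
  then show "fg_push (0, False) (a_power m @ r) = a_power (m + 1) @ r" "fg_push (0, True) (a_power m @ r) = a_power (m - 1) @ r" by auto
qed

lemma word_mult_replicate_a_power:
  assumes "r = [] \<or> fst (hd r) \<noteq> 0"
  shows "word_mult (replicate i (0, False)) (a_power m @ r) = a_power (m + int i) @ r"
    "word_mult (replicate i (0, True)) (a_power m @ r) = a_power (m - int i) @ r"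
  by (induction i) (simp_all add: push_a_power[OF assms] algebra_simps)

text \<open>The conjugate of b, or of its inverse, by the power of a given by the generator index.
  Conjugation commutes with inversion, so the sign affects the middle letter alone.\<close>

definition conj_gen :: "fg_letter \<Rightarrow> fg_letter list" where
  "conj_gen a = replicate (fst a) (0, False) @ [(1, snd a)] @ replicate (fst a) (0, True)"

definition free_emb :: "fg_letter list \<Rightarrow> fg_letter list" where
  "free_emb w = foldr (\<lambda>a v. word_mult (conj_gen a) v) w []"

text \<open>\<open>emb_word p w\<close> is the reduced word of \<open>a\<^sup>-\<^sup>p\<close> times the image of \<open>w\<close>, where the \<open>i\<close>-th generator goes to
  \<open>a\<^sup>i b a\<^sup>-\<^sup>i\<close>: consecutive powers of \<open>a\<close> merge, the letters \<open>b\<close> never cancel.\<close>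
fun emb_word :: "int \<Rightarrow> fg_letter list \<Rightarrow> fg_letter list" where
  "emb_word p [] = a_power (- p)"
| "emb_word p (a # w) = a_power (int (fst a) - p) @ (1, snd a) # emb_word (int (fst a)) w"

lemma word_mult_replicate_emb_word:
  "word_mult (replicate i (0, False)) (emb_word p w) = emb_word (p - int i) w"
  "word_mult (replicate i (0, True)) (emb_word p w) = emb_word (p + int i) w"
  using word_mult_replicate_a_power[of "[]" i "- p"] word_mult_replicate_a_power[of "(1, snd (hd w)) # emb_word (int (fst (hd w))) (tl w)" i "int (fst (hd w)) - p"]
  by (cases w; simp add: algebra_simps)+

text \<open>In a reduced word, adjacent letters with equal index have equal sign. Hence, wherever
  the exponent of a between two neighbouring letters b vanishes, these have the same sign and do not
  cancel.\<close>

lemma free_emb_emb_word: "fg_reduced w \<Longrightarrow> free_emb w = emb_word 0 w"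
proof (induction w)
  case Nil
  then show ?case by (simp add: free_emb_def a_power_def)
next
  case (Cons a w)
  then have r: "fg_reduced w" and hd: "w = [] \<or> hd w \<noteq> fg_inv_letter a" by (simp_all add: reduced_Cons)
  have "free_emb (a # w) = word_mult (conj_gen a) (emb_word 0 w)"
    using Cons.IH[OF r] by (simp add: free_emb_def)
  also have "\<dots> = word_mult (replicate (fst a) (0, False)) (fg_push (1, snd a) (emb_word (int (fst a)) w))"
    by (simp add: conj_gen_def word_mult_replicate_emb_word del: foldr_replicate)
  \<comment> \<open>The empty power \<open>a_power 0\<close> is written out so that
    \<open>word_mult_replicate_a_power\<close> can absorb the remaining power of a.\<close>
  also have "fg_push (1, snd a) (emb_word (int (fst a)) w) = a_power 0 @ (1, snd a) # emb_word (int (fst a)) w"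
  proof (cases w)
    case Nil
    then show ?thesis by (cases "fst a") (auto simp: fg_push_def a_power_def fg_inv_letter_def nat_add_distrib)
  next
    case (Cons b w')
    then have b: "b \<noteq> fg_inv_letter a" using hd by simp
    define m where "m = int (fst b) - int (fst a)"
    show ?thesis
    proof (cases "m = 0")
      case True
      then have "snd b = snd a" using b by (auto simp: m_def fg_inv_letter_def prod_eq_iff)
      then show ?thesis using True by (simp add: Cons m_def a_power_def fg_push_def fg_inv_letter_def)
    next
      case False
      then consider k where "m = int (Suc k)" | k where "m = - int (Suc k)"
        by (metis int_cases nat.exhaust of_nat_0)
      then obtain e u where "a_power m = (0, e) # u"
        by cases (auto simp: a_power_def nat_add_distrib)
      then show ?thesis by (simp add: Cons m_def[symmetric] fg_push_def fg_inv_letter_def a_power_def[of 0])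
    qed
  qed
  also have "word_mult (replicate (fst a) (0, False)) \<dots> = emb_word 0 (a # w)"
    using word_mult_replicate_a_power(1)[of "(1, snd a) # emb_word (int (fst a)) w" "fst a" 0] by simp
  finally show ?case .
qed

lemma free_emb_reduced: "fg_reduced (free_emb w)"
  by (induction w) (auto simp: free_emb_def intro: word_mult_reduced)

lemma free_emb_closed:
  assumes "n \<ge> 2"
  shows "free_emb w \<in> carrier (free_grp {..<n})"
proof (induction w)
  case Nil
  then show ?case by (simp add: free_emb_def free_grp_simps)
next
  case (Cons a w)
  have "fst ` set (conj_gen a) \<subseteq> {..<n}" using assms by (auto simp: conj_gen_def)
  then show ?case using word_mult_closed[OF _ Cons] by (simp add: free_emb_def)
qed

lemma word_inv_conj_gen: "conj_gen (fg_inv_letter a) = word_inv (conj_gen a)"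
  by (simp add: conj_gen_def word_inv_def fg_inv_letter_def)

lemma free_emb_push: "free_emb (fg_push a v) = word_mult (conj_gen a) (free_emb v)"
proof (cases "\<exists>v'. v = fg_inv_letter a # v'")
  case True
  then obtain v' where v: "v = fg_inv_letter a # v'" by blast
  have "word_mult (conj_gen a) (free_emb v) = word_mult (word_inv (conj_gen (fg_inv_letter a))) (word_mult (conj_gen (fg_inv_letter a)) (free_emb v'))"
    using word_inv_conj_gen[of "fg_inv_letter a"] by (simp add: v free_emb_def)
  also have "\<dots> = word_mult (word_mult (word_inv (conj_gen (fg_inv_letter a))) (conj_gen (fg_inv_letter a))) (free_emb v')"
    by (simp only: word_mult_assoc[OF free_emb_reduced])
  finally show ?thesis by (simp add: word_inv_word_mult v)
next
  case False
  then have "fg_push a v = a # v" by (auto simp: fg_push_def split: list.split)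
  then show ?thesis by (simp add: free_emb_def)
qed

lemma free_emb_word_mult: "free_emb (word_mult w v) = word_mult (free_emb w) (free_emb v)"
proof (induction w)
  case Nil
  then show ?case by (simp add: free_emb_def)
next
  case (Cons a w)
  have "free_emb (word_mult (a # w) v) = word_mult (conj_gen a) (word_mult (free_emb w) (free_emb v))" by (simp add: free_emb_push Cons.IH)
  also have "\<dots> = word_mult (free_emb (a # w)) (free_emb v)" by (simp add: free_emb_def word_mult_assoc[OF free_emb_reduced, unfolded free_emb_def])
  finally show ?case .
qed

lemma free_group_embedding:
  assumes "n \<ge> 2"
  shows "group_hom (free_grp UNIV) (free_grp {..<n}) free_emb" "inj_on free_emb (carrier (free_grp UNIV))"
proof -
  show h: "group_hom (free_grp UNIV) (free_grp {..<n}) free_emb"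
    using free_emb_closed[OF assms]
    by (intro group_hom.intro group_hom_axioms.intro homI group_free_grp) (auto simp: free_grp_simps(2) free_emb_word_mult)
  \<comment> \<open>Every letter of \<open>w\<close> leaves a letter b in \<open>emb_word\<close>,
    so a nonempty word has a nonempty image.\<close>
  have "w = []" if w: "w \<in> carrier (free_grp UNIV)" "free_emb w = []" for w
    using w free_emb_emb_word[of w] by (cases w) (auto simp: free_grp_simps)
  then show "inj_on free_emb (carrier (free_grp UNIV))"
    using group_hom.inj_on_one_iff[OF h] by (simp add: free_grp_simps(3))
qed

section \<open>The decomposition argument\<close>

theorem theorem3:
  fixes n :: nat
  assumes "n \<ge> 2"
  shows "completely_isomorphic (free_grp {..<n}) (free_grp UNIV)"
proof (intro cb_equiv_imp_completely_isomorphic group_free_grp)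
  let ?F = "free_grp UNIV" and ?G = "free_grp {..<n}"
  interpret h: group_hom ?F ?G free_emb by (rule free_group_embedding[OF assms])
  define K where "K = free_emb ` carrier ?F"
  have KG: "K \<subseteq> carrier ?G" by (auto simp: K_def)
  have one: "(\<lambda>b. \<one>\<^bsub>?G\<^esub> \<otimes>\<^bsub>?G\<^esub> free_emb b) ` carrier ?F = K" "(\<lambda>k. \<one>\<^bsub>?G\<^esub> \<otimes>\<^bsub>?G\<^esub> k) ` K = K"
    by (auto simp: K_def free_grp_simps)
  \<comment> \<open>The subgroup is its own translate by the neutral element.\<close>
  have cK: "cb_complemented ?G (carrier ?G) K"
    using h.H.cb_complemented_translate[OF h.img_is_subgroup h.H.one_closed] one by (simp add: K_def)
  have eK: "cb_equiv ?F (carrier ?F) ?G K"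
    using h.cb_equiv_translate_hom[OF free_group_embedding(2)[OF assms] h.H.one_closed subset_refl] one by simp
  \<comment> \<open>Absorbing a copy of itself splits F_infinity into two parts, each isomorphic to
    the whole.\<close>
  obtain E where E: "cb_complemented ?F (carrier ?F) E" "cb_equiv ?F (carrier ?F) ?F E" "cb_equiv ?F (carrier ?F) ?F (carrier ?F - E)"
    by (rule free_grp_absorbs[of UNIV])
  obtain A0 where A0: "cb_complemented ?F (carrier ?F) A0" "cb_equiv ?G (carrier ?G) ?F A0"
     "cb_equiv ?F (carrier ?F) ?F (carrier ?F - A0)"
    by (rule free_grp_absorbs[of "{..<n}"])
  \<comment> \<open>The splitting is carried into the copy \<open>K\<close> of F_infinity, so that
    \<open>K1\<close> and \<open>K - K1\<close> are again copies of F_infinity.\<close>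
  obtain K1 where K1: "cb_complemented ?G K K1" "cb_equiv ?F E ?G K1" "cb_equiv ?F (carrier ?F - E) ?G (K - K1)"
    using cb_equiv_split[OF eK E(1)] by blast
  \<comment> \<open>\<open>K1\<close> is the surplus copy. Deleting it leaves \<open>?L\<close>,
    still isomorphic to all of \<open>?G\<close>, since \<open>K - K1\<close> can take the place of
    \<open>K\<close> next to \<open>?W\<close>.\<close>
  let ?W = "carrier ?G - K" and ?L = "carrier ?G - K1"
  have K1K: "K1 \<subseteq> K" using K1(1) by (simp add: cb_complemented_def)
  have c1: "cb_complemented ?G (carrier ?G) K1" using cK K1(1) by (rule cb_complemented_trans)
  have L: "?L = ?W \<union> (K - K1)" using KG K1K by auto
  have "cb_complemented ?G ?L ?W" by (rule cb_complemented_subset[OF cb_complemented_Diff[OF cK] _ cb_complemented_Diff[OF c1]]) (use K1K in auto)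
  then have "cb_equiv ?G (?W \<union> (K - K1)) ?G (?W \<union> K)"
  proof (intro cb_equiv_union cb_equiv_refl)
    show "cb_complemented ?G (?W \<union> K) ?W" using cb_complemented_Diff[OF cK] KG by (simp add: Un_absorb2 Un_Diff_cancel2)
    show "cb_equiv ?G (K - K1) ?G K"
      using cb_equiv_trans[OF cb_equiv_sym[OF K1(3)] cb_equiv_trans[OF cb_equiv_sym[OF E(3)] eK]] .
  qed (auto simp flip: L)
  then have eL: "cb_equiv ?G ?L ?G (carrier ?G)" using KG by (simp add: L Un_absorb2)
  have uG: "carrier ?G = K1 \<union> ?L" using K1K KG by auto
  have uF: "carrier ?F = (carrier ?F - A0) \<union> A0" using A0(1) by (auto simp: cb_complemented_def)
  \<comment> \<open>On the left \<open>K1\<close> is a copy of F_infinity and \<open>?L\<close> one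
    of F_n. On the right \<open>A0\<close> is the copy of F_n absorbed by F_infinity, and its
    complement is F_infinity again.\<close>
  have "cb_equiv ?G (K1 \<union> ?L) ?F ((carrier ?F - A0) \<union> A0)"
  proof (rule cb_equiv_union)
    show "cb_complemented ?G (K1 \<union> ?L) K1" using c1 by (simp only: uG[symmetric])
    show "cb_complemented ?F ((carrier ?F - A0) \<union> A0) (carrier ?F - A0)" using cb_complemented_Diff[OF A0(1)] by (simp only: uF[symmetric])
    show "cb_equiv ?G K1 ?F (carrier ?F - A0)"
      by (rule cb_equiv_trans[OF cb_equiv_sym[OF K1(2)] cb_equiv_trans[OF cb_equiv_sym[OF E(2)] A0(3)]])
    show "cb_equiv ?G ?L ?F A0" by (rule cb_equiv_trans[OF eL A0(2)])
  qed auto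
  then show "cb_equiv ?G (carrier ?G) ?F (carrier ?F)" by (simp only: uG[symmetric] uF[symmetric])
qed

end
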